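(* Let $A$ be a smooth $A_\infty$-category and $\alpha\in C^n_{(2)}(A)$ a closed element. If $A$ is connective, $n\ge2$, and $(E_0,H)$ is a trivialization of $E$ onto a subcomplex $W\subseteq C_*(A,A)$ concentrated in degree zero, then the triple $(W,H,\alpha)$ is balanced.
   Context: **Conventions.** $\Bbbk$ is a commutative ring. Complexes are homologically graded with differential of degree $-1$; $X[n]_p=X_{p-n}$, so a degree $0$ map $X\to Y[n]$ is a degree $-n$ map; a superscript degree is the negative of the homological degree. $A_\infty$-categories $(A,\mu)$ are $\mathbb Z$-graded, strictly unital, with $\Bbbk$-cofibrant morphism complexes; formulas are written for one object. $\bar A=A/\Bbbk1$, $A^e=A\otimes A^{op}$. $C_*(A,A)=\bigoplus_kA\otimes\bar A[1]^{\otimes k}$ and $C^*(A,A)=\prod_k\mathrm{Hom}_\Bbbk(\bar A[1]^{\otimes k},A)$ are the normalized Hochschild complexes. Connective: concentrated in non-negative homological degrees; smooth: the diagonal bimodule is perfect; $A^!$ models $\mathbb R\mathrm{Hom}_{A^e}(A,A^e)$. $C^*_{(2)}(A)=\prod\mathrm{Hom}_\Bbbk(\bar A[1]^{\otimes n_1}\otimes\bar A[1]^{\otimes n_2},A\otimes A)$ is the complex of vertices with two outputs, with differential $[\mu,-]$ (necklace bracket). **Diagrams.** Operations are given by acyclic directed ribbon graphs drawn on surfaces with numbered edges, order $(N\cdots21)$. $\times$ marks the coefficient of an input Hochschild chain, $\circ$ (or an edge reaching an outgoing circle) that of an output chain, $\bullet$ is a vertex with one output labelled by $\mu$. Bar entries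 of input chains, bar factors emitted by vertices (and the arguments of an output cochain, which enter from its boundary circle) travel along auxiliary $\bar A[1]$-arrows disjoint from the graph, ending at corners of vertices or on outgoing circles; one sums over all isotopy classes of drawings. Signs are Koszul signs with each edge an odd symbol (suspension), applied in the order $1,\dots,N$. Lists "at $v$" are clockwise. **$\mathrm{co}$, $\eta$, $E$, $G$.** $\mathrm{co}$ is a fixed closed degree $0$ element of $\bigoplus_{i,j}A\otimes\bar A[1]^{\otimes i}\otimes A^!\otimes\bar A[1]^{\otimes j}$ representing $\mathrm{id}_A$ under $A\otimes^{\mathbb L}_{A^e}A^!\simeq\mathbb R\mathrm{Hom}_{A^e}(A,A)$; as a vertex it emits an $A$-edge, an $A^!$-edge and bar factors in its two corners. $\eta$ is a fixed closed degree $0$ element of $\prod\mathrm{Hom}(\bar A[1]^{\otimes i}\otimes A\otimes\bar A[1]^{\otimes j}\otimes\bar A[1]^{\otimes k}\otimes A^!\otimes\bar A[1]^{\otimes l},A\otimes A)$ (modelling $\mathbb R\mathrm{Hom}_{A^e\otimes A^e}(A\otimes A^!,A^{op}\otimes A)$); as a vertex it has, clockwise, $A$-input (top), right output, $A^!$-input (bottom), left output, and bar inputs in the corners. Contracting the $A^!$-input of $\eta$ with $\mathrm{co}$ and multiplying (left output)$\cdot$($A$-factor of $\mathrm{co}$)$\cdot$(right output) must give a bimodule map cohomologous to $\mathrm{id}_A$. On the annulus with outgoing circles left and right, $E\in C_*(A,A)\otimes C_*(A,A)$ (closed of degree $0$) is the diagram: $1$: $A$-edge $\mathrm{co}\to\eta$,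 $2$: $A^!$-edge $\mathrm{co}\to\eta$, $3$: left output of $\eta\to$ left circle, $4$: right output of $\eta\to$ right circle (the loop $1,2$ is the core). $G(\varphi)$, $\varphi\in C^*(A,A)$, is the sum of four diagrams with $5$ edges; $2$ is the $A^!$-edge, $4,5$ the edges to the left and right circles, and $1$ the $A$-edge $\mathrm{co}\to\eta$ unless said otherwise: (i) $3:\varphi\to\eta$ in the corner between left output and top; (ii) $1:\mathrm{co}\to\varphi$, $3:\varphi\to\eta$ (top); (iii) $3:\varphi\to\eta$ in the corner between top and right output; (iv) $3:\eta\to\varphi$ (right output), $5:\varphi\to$ right circle. $G$ is a graded map $C^*(A,A)\to C_*(A,A)^{\otimes2}[-1]$. The cap product $\varphi\frown x$ is the annulus diagram $1:\varphi\to\bullet$, $2:\times\to\bullet$, $3:\bullet\to\circ$, clockwise $1,2,3$ at $\bullet$. **Trivializations and balancedness.** $g_\alpha:C_*(A,A)\to C^*(A,A)[n]$ is the disc diagram $1:\alpha\to B$, $2:\alpha\to R$, $3:\times\to R$, $4:R\to B$, $5:B\to$ boundary, $\times$ inside the circle $1,2,4$, at $R$: $2,4,3$, at $B$: $5,1,4$. Let $W\subseteq C_*(A,A)$ be a subcomplex with $H_*(W)\to HH_*(A,A)$ injective. A trivialization of $E$ onto $W$ is a pair $(E_0,H)$ with $E_0\in W\otimes C_*(A,A)\cap C_*(A,A)\otimes W$, $H\in C_*(A,A)\otimes C_*(A,A)$ and $dH=E-E_0$. Put $\widetilde\lambda_H(\varphi)=G(\varphi)-(-1)^{\deg\varphi}((\varphi\frown\otimes\mathrm{id})H-(\mathrm{id}\otimes\varphi\frown)H)$.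 The triple $(W,H,\alpha)$ is balanced if the graded map $\widetilde\lambda_H\circ g_\alpha:C_*(A,A)\to C_*(A,A)\otimes C_*(A,A)[n-1]$ sends $W$ into $C_*(A,A)\otimes W\cap W\otimes C_*(A,A)$. *)

theory Defs
  imports Complex_Main "HOL-Library.Poly_Mapping"
begin

section \<open>Free modules, Koszul signs\<close>

text \<open>
  Tensor products over \<open>k\<close> are presented by generators and relations. A generator is a word
  (a list of letters); for a set \<open>V\<close> of words, \<open>free V\<close> is the free module on \<open>V\<close> and \<open>rel A N V\<close>
  its submodule of multilinearity relations, so that the module meant is \<open>free V / rel A N V\<close>.
  Elements of it are given by representatives in \<open>free V\<close>, equality is congruence modulo \<open>rel A N V\<close>,
  and submodules are given by their preimages, i.e. submodules between \<open>rel A N V\<close> and \<open>free V\<close>.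
\<close>

definition fscl :: "'k::comm_ring_1 \<Rightarrow> ('w \<Rightarrow>\<^sub>0 'k) \<Rightarrow> ('w \<Rightarrow>\<^sub>0 'k)" where
  "fscl c t = Poly_Mapping.map ((*) c) t"

lemma lookup_fscl: "Poly_Mapping.lookup (fscl c t) w = c * Poly_Mapping.lookup t w"
  unfolding fscl_def by (transfer) (auto simp: when_def)

lemma module_fscl: "module (fscl :: 'k::comm_ring_1 \<Rightarrow> ('w \<Rightarrow>\<^sub>0 'k) \<Rightarrow> ('w \<Rightarrow>\<^sub>0 'k))"
  by (unfold_locales)
     (auto intro!: poly_mapping_eqI simp: lookup_fscl lookup_add algebra_simps)

definition wd :: "'w \<Rightarrow> ('w \<Rightarrow>\<^sub>0 'k::comm_ring_1)" where
  "wd w = Poly_Mapping.single w 1"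

definition free :: "'w set \<Rightarrow> ('w \<Rightarrow>\<^sub>0 'k::comm_ring_1) set" where
  "free V = {t. Poly_Mapping.keys t \<subseteq> V}"

definition lext :: "('k::comm_ring_1 \<Rightarrow> 'b \<Rightarrow> 'b::ab_group_add) \<Rightarrow> ('w \<Rightarrow> 'b) \<Rightarrow> ('w \<Rightarrow>\<^sub>0 'k) \<Rightarrow> 'b" where
  "lext s f t = (\<Sum>w\<in>Poly_Mapping.keys t. s (Poly_Mapping.lookup t w) (f w))"

abbreviation ext :: "('w \<Rightarrow> ('v \<Rightarrow>\<^sub>0 'k)) \<Rightarrow> ('w \<Rightarrow>\<^sub>0 'k::comm_ring_1) \<Rightarrow> ('v \<Rightarrow>\<^sub>0 'k)" where
  "ext \<equiv> lext fscl"

definition fcat :: "('l list \<Rightarrow>\<^sub>0 'k::comm_ring_1) \<Rightarrow> ('l list \<Rightarrow>\<^sub>0 'k) \<Rightarrow> ('l list \<Rightarrow>\<^sub>0 'k)" where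
  "fcat s t = ext (\<lambda>u. ext (\<lambda>v. wd (u @ v)) t) s"

definition sg :: "int \<Rightarrow> 'k::comm_ring_1" where
  "sg n = (if even n then 1 else - 1)"

text \<open>
  Koszul sign of a rearrangement of homogeneous symbols: \<open>ds\<close> lists their degrees in the initial
  order, \<open>\<pi>\<close> lists their initial positions (from 0) in the final order. Only parities matter, so
  cohomological degrees may be used as well.
\<close>

definition koszul :: "int list \<Rightarrow> nat list \<Rightarrow> 'k::comm_ring_1" where
  "koszul ds \<pi> = (\<Prod>(i, j)\<in>{(i, j). i < j \<and> j < length \<pi> \<and> \<pi> ! j < \<pi> ! i}.
                   sg (ds ! (\<pi> ! i) * ds ! (\<pi> ! j)))"

definition cut2 :: "'x list \<Rightarrow> ('x list \<times> 'x list) set" where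
  "cut2 xs = {(a, b). a @ b = xs}"
definition cut3 :: "'x list \<Rightarrow> ('x list \<times> 'x list \<times> 'x list) set" where
  "cut3 xs = {(a, b, c). a @ b @ c = xs}"
definition cut4 :: "'x list \<Rightarrow> ('x list \<times> 'x list \<times> 'x list \<times> 'x list) set" where
  "cut4 xs = {(a, b, c, d). a @ b @ c @ d = xs}"
definition cut5 :: "'x list \<Rightarrow> ('x list \<times> 'x list \<times> 'x list \<times> 'x list \<times> 'x list) set" where
  "cut5 xs = {(a, b, c, d, e). a @ b @ c @ d @ e = xs}"


section \<open>\<open>k\<close>-cofibrant complexes\<close>

text \<open>
  Cofibrancy in the projective model structure on unbounded complexes: a retract of a complex \<open>F\<close>
  that is free on a graded basis \<open>B\<close> whose differential \<open>D\<close> strictly lowers a rank function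
  (a cell complex). The complex in question has components \<open>X p\<close> and differential \<open>d p\<close> on \<open>X p\<close>.
  Every such \<open>X\<close> has a cell complex resolution with at most as many cells as there are elements of
  \<open>('e \<times> 'k) list\<close>, hence fixing the type of basis elements is no restriction.
\<close>

definition cofibrant ::
  "('k::comm_ring_1 \<Rightarrow> 'e \<Rightarrow> 'e::ab_group_add) \<Rightarrow> (int \<Rightarrow> 'e set) \<Rightarrow> (int \<Rightarrow> 'e \<Rightarrow> 'e) \<Rightarrow> bool" where
  "cofibrant s X d \<longleftrightarrow>
    (\<exists>(B :: ('e \<times> 'k) list set) (bd :: ('e \<times> 'k) list \<Rightarrow> int) (rk :: ('e \<times> 'k) list \<Rightarrow> nat)
      (D :: ('e \<times> 'k) list \<Rightarrow> (('e \<times> 'k) list \<Rightarrow>\<^sub>0 'k)) (i :: int \<Rightarrow> 'e \<Rightarrow> (('e \<times> 'k) list \<Rightarrow>\<^sub>0 'k))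
      (r :: ('e \<times> 'k) list \<Rightarrow> 'e).
      (\<forall>b\<in>B. D b \<in> free {b'\<in>B. bd b' = bd b - 1 \<and> rk b' < rk b} \<and> ext D (D b) = 0) \<and>
      (\<forall>p. \<forall>x\<in>X p. i p x \<in> free {b\<in>B. bd b = p} \<and> i (p - 1) (d p x) = ext D (i p x)) \<and>
      (\<forall>p c. \<forall>x\<in>X p. \<forall>y\<in>X p. i p (s c x + y) = fscl c (i p x) + i p y) \<and>
      (\<forall>b\<in>B. r b \<in> X (bd b) \<and> lext s r (D b) = d (bd b) (r b)) \<and>
      (\<forall>p. \<forall>x\<in>X p. lext s r (i p x) = x))"


section \<open>\<open>A\<^sub>\<infinity>\<close>-categories\<close>

text \<open>
  Morphisms are composed in path order: \<open>a\<^sub>1, \<dots>, a\<^sub>k\<close> with \<open>a\<^sub>i\<close> from \<open>x\<^sub>i\<^sub>-\<^sub>1\<close> to \<open>x\<^sub>i\<close> is composable,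
  and is read clockwise at a vertex, starting after the output. All degrees are homological.
\<close>

datatype ('o, 'e) arr = Arr (src: 'o) (tgt: 'o) (adeg: int) (elt: 'e)

text \<open>
  \<open>mu [a\<^sub>1, \<dots>, a\<^sub>k]\<close> is \<open>\<mu>\<close> as an element of \<open>C\<^sup>2(A,A)\<close>: its arguments are in \<open>A[1]\<close>, its value is
  in \<open>A\<close> and it has homological degree \<open>-2\<close>; the usual \<open>b\<close> on \<open>A[1]\<close> is the suspension of \<open>mu\<close>.
  Thus \<open>mu [a, b] = (-1)^|a| a \<cdot> b\<close> and \<open>mu [a] = - d a\<close> for a differential graded category.
\<close>

record ('k, 'o, 'a) ainf =
  smul :: "'k \<Rightarrow> 'a \<Rightarrow> 'a"
  mor :: "'o \<Rightarrow> 'o \<Rightarrow> int \<Rightarrow> 'a set"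
  mu :: "('o, 'a) arr list \<Rightarrow> 'a"
  idn :: "'o \<Rightarrow> 'a"

definition homs :: "('k, 'o, 'a) ainf \<Rightarrow> 'o \<Rightarrow> 'o \<Rightarrow> ('o, 'a) arr set" where
  "homs A x y = {a. src a = x \<and> tgt a = y \<and> elt a \<in> mor A x y (adeg a)}"

fun path :: "'o \<Rightarrow> ('o, 'a) arr list \<Rightarrow> 'o \<Rightarrow> bool" where
  "path x [] y \<longleftrightarrow> x = y"
| "path x (a # as) y \<longleftrightarrow> src a = x \<and> path (tgt a) as y"

definition paths :: "('k, 'o, 'a) ainf \<Rightarrow> 'o \<Rightarrow> 'o \<Rightarrow> ('o, 'a) arr list set" where
  "paths A x y = {as. path x as y \<and> (\<forall>a\<in>set as. a \<in> homs A (src a) (tgt a))}"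

definition pend :: "'o \<Rightarrow> ('o, 'a) arr list \<Rightarrow> 'o" where
  "pend x as = (if as = [] then x else tgt (last as))"

text \<open>Degree of a list of morphisms regarded as an element of a tensor power of \<open>A[1]\<close>.\<close>

definition bdeg :: "('o, 'a) arr list \<Rightarrow> int" where
  "bdeg as = (\<Sum>a\<leftarrow>as. adeg a + 1)"

definition unit_arr :: "('k, 'o, 'a) ainf \<Rightarrow> 'o \<Rightarrow> ('o, 'a) arr" where
  "unit_arr A x = Arr x x 0 (idn A x)"

definition mu_arr :: "('k, 'o, 'a) ainf \<Rightarrow> ('o, 'a) arr list \<Rightarrow> ('o, 'a) arr" where
  "mu_arr A as = Arr (src (hd as)) (tgt (last as)) (bdeg as - 2) (mu A as)"

definition ainf_category :: "('k::comm_ring_1, 'o, 'a::ab_group_add) ainf \<Rightarrow> bool" where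
  "ainf_category A \<longleftrightarrow>
    module (smul A) \<and>
    (\<forall>x y d. module.subspace (smul A) (mor A x y d)) \<and>
    (\<forall>x y. \<forall>as\<in>paths A x y. as \<noteq> [] \<longrightarrow> mu A as \<in> mor A x y (bdeg as - 2)) \<and>
    (\<forall>p x y q d c. \<forall>u\<in>paths A p x. \<forall>v\<in>paths A y q. \<forall>a\<in>mor A x y d. \<forall>b\<in>mor A x y d.
        mu A (u @ [Arr x y d (smul A c a + b)] @ v)
          = smul A c (mu A (u @ [Arr x y d a] @ v)) + mu A (u @ [Arr x y d b] @ v)) \<and>
    (\<forall>x y. \<forall>as\<in>paths A x y.
        (\<Sum>(u, v, z)\<in>{(u, v, z)\<in>cut3 as. v \<noteq> []}.
            smul A (sg (bdeg u)) (mu A (u @ [mu_arr A v] @ z))) = 0) \<and>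
    (\<forall>x. idn A x \<in> mor A x x 0 \<and> mu A [unit_arr A x] = 0) \<and>
    (\<forall>x y. \<forall>a\<in>homs A x y.
        mu A [unit_arr A x, a] = elt a \<and>
        mu A [a, unit_arr A y] = smul A (sg (adeg a)) (elt a)) \<and>
    (\<forall>x y z. \<forall>u\<in>paths A x y. \<forall>v\<in>paths A y z.
        length u + length v \<ge> 2 \<longrightarrow> mu A (u @ [unit_arr A y] @ v) = 0) \<and>
    (\<forall>x y. cofibrant (smul A) (mor A x y) (\<lambda>d a. - mu A [Arr x y d a]))"

definition connective :: "('k::comm_ring_1, 'o, 'a::ab_group_add) ainf \<Rightarrow> bool" where
  "connective A \<longleftrightarrow> (\<forall>x y d. d < 0 \<longrightarrow> mor A x y d = {0})"

text \<open>
  Data of an \<open>A\<^sub>\<infinity>\<close>-bimodule \<open>N\<close> (later \<open>A\<^sup>!\<close>); \<open>mact L m R\<close> is the structure map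
  \<open>A[1]\<^sup>\<otimes>\<^sup>i \<otimes> N \<otimes> A[1]\<^sup>\<otimes>\<^sup>j \<rightarrow> N\<close> of degree \<open>-1\<close>.
\<close>

record ('k, 'o, 'a, 'm) abim =
  msmul :: "'k \<Rightarrow> 'm \<Rightarrow> 'm"
  mmor :: "'o \<Rightarrow> 'o \<Rightarrow> int \<Rightarrow> 'm set"
  mact :: "('o, 'a) arr list \<Rightarrow> ('o, 'm) arr \<Rightarrow> ('o, 'a) arr list \<Rightarrow> 'm"

definition mhoms :: "('k, 'o, 'a, 'm) abim \<Rightarrow> 'o \<Rightarrow> 'o \<Rightarrow> ('o, 'm) arr set" where
  "mhoms N x y = {m. src m = x \<and> tgt m = y \<and> elt m \<in> mmor N x y (adeg m)}"


section \<open>Words\<close>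

text \<open>
  \<open>Coef\<close>: a factor \<open>A\<close>; \<open>Bar\<close>: a factor \<open>A/k1[1]\<close>, given by a representative in \<open>A\<close>; \<open>Dual\<close>: a
  factor \<open>N\<close>; \<open>Shift j s\<close>: a formal symbol of degree \<open>s\<close>, used to index direct sums of shifts.
\<close>

datatype ('o, 'a, 'm) letter =
  Coef "('o, 'a) arr" | is_Bar: Bar "('o, 'a) arr" | Dual "('o, 'm) arr" | Shift nat int

type_synonym ('o, 'a, 'm) word = "('o, 'a, 'm) letter list"
type_synonym ('k, 'o, 'a, 'm) ten = "('o, 'a, 'm) word \<Rightarrow>\<^sub>0 'k"

fun ldeg :: "('o, 'a, 'm) letter \<Rightarrow> int" where
  "ldeg (Coef a) = adeg a"
| "ldeg (Bar a) = adeg a + 1"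
| "ldeg (Dual m) = adeg m"
| "ldeg (Shift j s) = s"

definition wdeg :: "('o, 'a, 'm) word \<Rightarrow> int" where
  "wdeg w = sum_list (map ldeg w)"

fun arr_of :: "('o, 'a, 'm) letter \<Rightarrow> ('o, 'a) arr" where
  "arr_of (Coef a) = a"
| "arr_of (Bar a) = a"
| "arr_of _ = undefined"

abbreviation arrs :: "('o, 'a, 'm) word \<Rightarrow> ('o, 'a) arr list" where
  "arrs \<equiv> map arr_of"

definition lin_rels ::
  "(('o, 'e) arr \<Rightarrow> ('o, 'a, 'm) letter) \<Rightarrow> ('k::comm_ring_1 \<Rightarrow> 'e \<Rightarrow> 'e::ab_group_add)
    \<Rightarrow> ('o, 'a, 'm) word set \<Rightarrow> ('k, 'o, 'a, 'm) ten set" where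
  "lin_rels mk s V =
    {wd (u @ [mk (Arr x y d (s c a + b))] @ v)
       - fscl c (wd (u @ [mk (Arr x y d a)] @ v)) - wd (u @ [mk (Arr x y d b)] @ v) | u v x y d c a b.
     u @ [mk (Arr x y d (s c a + b))] @ v \<in> V \<and>
     u @ [mk (Arr x y d a)] @ v \<in> V \<and> u @ [mk (Arr x y d b)] @ v \<in> V}"

definition rel ::
  "('k::comm_ring_1, 'o, 'a::ab_group_add) ainf \<Rightarrow> ('k, 'o, 'a, 'm::ab_group_add) abim
    \<Rightarrow> ('o, 'a, 'm) word set \<Rightarrow> ('k, 'o, 'a, 'm) ten set" where
  "rel A N V = module.span fscl
    (lin_rels Coef (smul A) V \<union> lin_rels Bar (smul A) V \<union> lin_rels Dual (msmul N) V \<union>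
     {wd (u @ [Bar (unit_arr A x)] @ v) | u v x. u @ [Bar (unit_arr A x)] @ v \<in> V})"

text \<open>A function on words that defines a linear map between the presented modules.\<close>

definition mlin ::
  "('k::comm_ring_1, 'o, 'a::ab_group_add) ainf \<Rightarrow> ('k, 'o, 'a, 'm::ab_group_add) abim
    \<Rightarrow> ('o, 'a, 'm) word set \<Rightarrow> (('o, 'a, 'm) word \<Rightarrow> ('k, 'o, 'a, 'm) ten) \<Rightarrow> ('o, 'a, 'm) word set \<Rightarrow> bool" where
  "mlin A N V f V' \<longleftrightarrow> (\<forall>t\<in>rel A N V. ext f t \<in> rel A N V')"

definition hpart :: "int \<Rightarrow> ('k::comm_ring_1, 'o, 'a, 'm) ten \<Rightarrow> ('k, 'o, 'a, 'm) ten" where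
  "hpart p t = (\<Sum>w\<in>{w\<in>Poly_Mapping.keys t. wdeg w = p}.
                  Poly_Mapping.single w (Poly_Mapping.lookup t w))"

definition two :: "(('o, 'a) arr \<Rightarrow> ('o, 'a) arr \<Rightarrow> 'b) \<Rightarrow> ('o, 'a, 'm) word \<Rightarrow> 'b::zero" where
  "two f w = (case w of [Coef x, Coef y] \<Rightarrow> f x y | _ \<Rightarrow> 0)"

text \<open>Words for \<open>A(p,v) \<otimes> A(w,q)\<close>.\<close>

definition W2 :: "('k, 'o, 'a) ainf \<Rightarrow> 'o \<Rightarrow> 'o \<Rightarrow> 'o \<Rightarrow> 'o \<Rightarrow> ('o, 'a, 'm) word set" where
  "W2 A p v w q = {[Coef x, Coef y] | x y. x \<in> homs A p v \<and> y \<in> homs A w q}"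


section \<open>\<open>A\<^sub>\<infinity>\<close>-bimodules and their morphisms\<close>

text \<open>Structure map of the diagonal bimodule: \<open>b\<close> transported from \<open>A[1]\<close> to \<open>A\<close>.\<close>

definition bA :: "('k::comm_ring_1, 'o, 'a) ainf \<Rightarrow> ('o, 'a) arr list \<Rightarrow> ('o, 'a) arr \<Rightarrow> ('o, 'a) arr list
    \<Rightarrow> ('o, 'a) arr" where
  "bA A L a R = (let as = L @ [a] @ R in
    Arr (src (hd as)) (tgt (last as)) (bdeg L + adeg a + bdeg R - 1)
      (smul A (- sg (bdeg L)) (mu A as)))"

definition bN :: "('k, 'o, 'a, 'm) abim \<Rightarrow> ('o, 'a) arr list \<Rightarrow> ('o, 'm) arr \<Rightarrow> ('o, 'a) arr list
    \<Rightarrow> ('o, 'm) arr" where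
  "bN N L m R = Arr (if L = [] then src m else src (hd L)) (pend (tgt m) R)
     (bdeg L + adeg m + bdeg R - 1) (mact N L m R)"

text \<open>
  A bimodule whose underlying modules are presented: \<open>gens W p q\<close> are the generating words of the
  module at \<open>(p, q)\<close>, \<open>act W\<close> is the structure map.
\<close>

record (overloaded) ('k, 'o, 'a, 'm) wbim =
  gens :: "'o \<Rightarrow> 'o \<Rightarrow> ('o, 'a, 'm) word set"
  act :: "('o, 'a) arr list \<Rightarrow> ('o, 'a, 'm) word \<Rightarrow> ('o, 'a) arr list \<Rightarrow> ('o, 'a, 'm) word \<Rightarrow>\<^sub>0 'k"

type_synonym ('k, 'o, 'a, 'm) bmap =
  "('o, 'a) arr list \<Rightarrow> ('o, 'a, 'm) word \<Rightarrow> ('o, 'a) arr list \<Rightarrow> ('k, 'o, 'a, 'm) ten"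

definition diag :: "('k::comm_ring_1, 'o, 'a) ainf \<Rightarrow> ('k, 'o, 'a, 'm) wbim" where
  "diag A = \<lparr> gens = (\<lambda>p q. {[Coef a] | a. a \<in> homs A p q}),
    act = (\<lambda>L w R. case w of [Coef a] \<Rightarrow> wd [Coef (bA A L a R)] | _ \<Rightarrow> 0) \<rparr>"

definition wbim_of :: "('k::comm_ring_1, 'o, 'a, 'm) abim \<Rightarrow> ('k, 'o, 'a, 'm) wbim" where
  "wbim_of N = \<lparr> gens = (\<lambda>p q. {[Dual m] | m. m \<in> mhoms N p q}),
    act = (\<lambda>L w R. case w of [Dual m] \<Rightarrow> wd [Dual (bN N L m R)] | _ \<Rightarrow> 0) \<rparr>"

text \<open>The representable bimodule \<open>A(-,v) \<otimes> A(w,-)\<close>.\<close>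

definition rep :: "('k::comm_ring_1, 'o, 'a) ainf \<Rightarrow> 'o \<Rightarrow> 'o \<Rightarrow> ('k, 'o, 'a, 'm) wbim" where
  "rep A v w = \<lparr> gens = (\<lambda>p q. W2 A p v w q),
    act = (\<lambda>L u R. two (\<lambda>x y.
      (if R = [] then wd [Coef (bA A L x []), Coef y] else 0) +
      (if L = [] then fscl (sg (adeg x)) (wd [Coef x, Coef (bA A [] y R)]) else 0)) u) \<rparr>"

text \<open>
  Families of maps \<open>A[1]\<^sup>\<otimes>\<^sup>i \<otimes> W \<otimes> A[1]\<^sup>\<otimes>\<^sup>j \<rightarrow> W'\<close> of degree \<open>e\<close>; unnormalized for \<open>mk = Coef\<close>
  (then the letters only record multilinearity), normalized for \<open>mk = Bar\<close>.
\<close>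

definition bimap ::
  "(('o, 'a) arr \<Rightarrow> ('o, 'a, 'm) letter) \<Rightarrow>
   ('k::comm_ring_1, 'o, 'a::ab_group_add) ainf \<Rightarrow> ('k, 'o, 'a, 'm::ab_group_add) abim \<Rightarrow>
   ('k, 'o, 'a, 'm) wbim \<Rightarrow> ('k, 'o, 'a, 'm) wbim \<Rightarrow> int \<Rightarrow> ('k, 'o, 'a, 'm) bmap \<Rightarrow> bool" where
  "bimap mk A N W W' e f \<longleftrightarrow> (\<forall>x p q y.
    (\<forall>L\<in>paths A x p. \<forall>w\<in>gens W p q. \<forall>R\<in>paths A q y.
        f L w R \<in> free {w'\<in>gens W' x y. wdeg w' = bdeg L + wdeg w + bdeg R + e}) \<and>
    (\<forall>w\<in>gens W p q. \<forall>R\<in>paths A q y.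
        mlin A N (map mk ` paths A x p) (\<lambda>u. f (arrs u) w R) (gens W' x y)) \<and>
    (\<forall>L\<in>paths A x p. \<forall>R\<in>paths A q y.
        mlin A N (gens W p q) (\<lambda>w. f L w R) (gens W' x y)) \<and>
    (\<forall>L\<in>paths A x p. \<forall>w\<in>gens W p q.
        mlin A N (map mk ` paths A q y) (\<lambda>u. f L w (arrs u)) (gens W' x y)))"

abbreviation premor where "premor \<equiv> bimap Bar"

text \<open>Value of \<open>f\<close> on the differential of the input \<open>L \<otimes> w \<otimes> R\<close>.\<close>

definition pre_bar ::
  "('k::comm_ring_1, 'o, 'a) ainf \<Rightarrow> ('k, 'o, 'a, 'm) bmap \<Rightarrow> ('k, 'o, 'a, 'm) bmap" where
  "pre_bar A f L w R =
    (\<Sum>(u, v, z)\<in>{(u, v, z)\<in>cut3 L. v \<noteq> []}. fscl (sg (bdeg u)) (f (u @ [mu_arr A v] @ z) w R)) +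
    (\<Sum>(u, v, z)\<in>{(u, v, z)\<in>cut3 R. v \<noteq> []}.
        fscl (sg (bdeg L + wdeg w + bdeg u)) (f L w (u @ [mu_arr A v] @ z)))"

definition pre_act ::
  "('k::comm_ring_1, 'o, 'a, 'm) wbim \<Rightarrow> ('k, 'o, 'a, 'm) bmap \<Rightarrow> ('k, 'o, 'a, 'm) bmap" where
  "pre_act W f L w R =
    (\<Sum>(L1, L2)\<in>cut2 L. \<Sum>(R1, R2)\<in>cut2 R.
        fscl (sg (bdeg L1)) (ext (\<lambda>w'. f L1 w' R2) (act W L2 w R1)))"

definition is_bimodule ::
  "('k::comm_ring_1, 'o, 'a::ab_group_add) ainf \<Rightarrow> ('k, 'o, 'a, 'm::ab_group_add) abim \<Rightarrow>
   ('k, 'o, 'a, 'm) wbim \<Rightarrow> bool" where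
  "is_bimodule A N W \<longleftrightarrow>
    bimap Coef A N W W (- 1) (act W) \<and>
    (\<forall>x p q y. \<forall>L\<in>paths A x p. \<forall>w\<in>gens W p q. \<forall>R\<in>paths A q y.
        pre_act W (act W) L w R + pre_bar A (act W) L w R \<in> rel A N (gens W x y)) \<and>
    (\<forall>p q. \<forall>w\<in>gens W p q.
        act W [unit_arr A p] w [] - wd w \<in> rel A N (gens W p q) \<and>
        act W [] w [unit_arr A q] + fscl (sg (wdeg w)) (wd w) \<in> rel A N (gens W p q)) \<and>
    (\<forall>x p q y. \<forall>L\<in>paths A x p. \<forall>w\<in>gens W p q. \<forall>R\<in>paths A q y.
        length L + length R \<ge> 2 \<and> (\<exists>z. unit_arr A z \<in> set L \<union> set R) \<longrightarrow>
        act W L w R \<in> rel A N (gens W x y))"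

definition mdiff ::
  "('k::comm_ring_1, 'o, 'a) ainf \<Rightarrow> ('k, 'o, 'a, 'm) wbim \<Rightarrow> ('k, 'o, 'a, 'm) wbim \<Rightarrow> int \<Rightarrow>
   ('k, 'o, 'a, 'm) bmap \<Rightarrow> ('k, 'o, 'a, 'm) bmap" where
  "mdiff A W W' e f L w R =
    (\<Sum>(L1, L2)\<in>cut2 L. \<Sum>(R1, R2)\<in>cut2 R.
        fscl (sg (e * bdeg L1)) (ext (\<lambda>w'. act W' L1 w' R2) (f L2 w R1)))
    - fscl (sg e) (pre_act W f L w R + pre_bar A f L w R)"

definition mor_eq ::
  "('k::comm_ring_1, 'o, 'a::ab_group_add) ainf \<Rightarrow> ('k, 'o, 'a, 'm::ab_group_add) abim \<Rightarrow>
   ('k, 'o, 'a, 'm) wbim \<Rightarrow> ('k, 'o, 'a, 'm) wbim \<Rightarrow> ('k, 'o, 'a, 'm) bmap \<Rightarrow> ('k, 'o, 'a, 'm) bmap \<Rightarrow> bool" where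
  "mor_eq A N W W' f g \<longleftrightarrow> (\<forall>x p q y. \<forall>L\<in>paths A x p. \<forall>w\<in>gens W p q. \<forall>R\<in>paths A q y.
     f L w R - g L w R \<in> rel A N (gens W' x y))"

definition closed_mor where
  "closed_mor A N W W' e f \<longleftrightarrow>
     premor A N W W' e f \<and> mor_eq A N W W' (mdiff A W W' e f) (\<lambda>L w R. 0)"

definition cohomologous where
  "cohomologous A N W W' e f g \<longleftrightarrow> (\<exists>h. premor A N W W' (e + 1) h \<and>
     mor_eq A N W W' (\<lambda>L w R. f L w R - g L w R) (mdiff A W W' (e + 1) h))"

definition id_mor :: "('k::comm_ring_1, 'o, 'a, 'm) bmap" where
  "id_mor L w R = (if L = [] \<and> R = [] then wd w else 0)"

text \<open>Only for \<open>f\<close> of degree 0 (no sign).\<close>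

definition mcomp :: "('k::comm_ring_1, 'o, 'a, 'm) bmap \<Rightarrow> ('k, 'o, 'a, 'm) bmap \<Rightarrow> ('k, 'o, 'a, 'm) bmap" where
  "mcomp g f L w R =
    (\<Sum>(L1, L2)\<in>cut2 L. \<Sum>(R1, R2)\<in>cut2 R. ext (\<lambda>w'. g L1 w' R2) (f L2 w R1))"


section \<open>Smoothness\<close>

text \<open>
  A finite twisted complex: the sum over \<open>j < r\<close> of the representables \<open>rep A (v j) (w j)\<close> shifted
  by \<open>s j\<close>, with a bimodule structure that is the given one plus maps strictly lowering the index.
\<close>

definition twisted_complex ::
  "('k::comm_ring_1, 'o, 'a::ab_group_add) ainf \<Rightarrow> ('k, 'o, 'a, 'm::ab_group_add) abim \<Rightarrow>
   nat \<Rightarrow> (nat \<Rightarrow> 'o) \<Rightarrow> (nat \<Rightarrow> 'o) \<Rightarrow> (nat \<Rightarrow> int) \<Rightarrow> ('k, 'o, 'a, 'm) wbim \<Rightarrow> bool" where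
  "twisted_complex A N r v w s P \<longleftrightarrow>
    gens P = (\<lambda>p q. {Shift j (s j) # u | j u. j < r \<and> u \<in> W2 A p (v j) (w j) q}) \<and>
    is_bimodule A N P \<and>
    (\<forall>x p q y. \<forall>L\<in>paths A x p. \<forall>R\<in>paths A q y. \<forall>j<r. \<forall>u\<in>W2 A p (v j) (w j) q.
      \<exists>t\<in>free {Shift i (s i) # u' | i u'. i < j \<and> u' \<in> W2 A x (v i) (w i) y}.
        act P L (Shift j (s j) # u) R
          - fscl (sg (s j * (bdeg L + 1))) (fcat (wd [Shift j (s j)]) (act (rep A (v j) (w j)) L u R))
          - t \<in> rel A N (gens P x y))"

text \<open>
  The thick subcategory of the derived category of bimodules generated by the representables
  consists of the homotopy retracts of finite twisted complexes of shifted representables.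
\<close>

definition perfect ::
  "('k::comm_ring_1, 'o, 'a::ab_group_add) ainf \<Rightarrow> ('k, 'o, 'a, 'm::ab_group_add) abim \<Rightarrow>
   ('k, 'o, 'a, 'm) wbim \<Rightarrow> bool" where
  "perfect A N M \<longleftrightarrow> (\<exists>r v w s P f g.
     twisted_complex A N r v w s P \<and> closed_mor A N M P 0 f \<and> closed_mor A N P M 0 g \<and>
     cohomologous A N M M 0 (mcomp g f) id_mor)"

text \<open>Words without \<open>Dual\<close> letters do not involve a second bimodule; this is a placeholder for it.\<close>

definition no_dual :: "('k, 'o, 'a::zero) ainf \<Rightarrow> ('k, 'o, 'a, 'a) abim" where
  "no_dual A = \<lparr> msmul = smul A, mmor = (\<lambda>x y d. {0}), mact = (\<lambda>L m R. 0) \<rparr>"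

definition smooth :: "('k::comm_ring_1, 'o, 'a::ab_group_add) ainf \<Rightarrow> bool" where
  "smooth A \<longleftrightarrow> perfect A (no_dual A) (diag A)"


section \<open>Hochschild chains\<close>

text \<open>
  The differential of words: apply the structure map to each contiguous block that has at most one
  letter different from \<open>Bar\<close>. For cyclic words (the first letter is then a \<open>Coef\<close>), blocks may
  also wrap around the end of the word.
\<close>

definition blk :: "('k::comm_ring_1, 'o, 'a) ainf \<Rightarrow> ('k, 'o, 'a, 'm) abim \<Rightarrow> ('o, 'a, 'm) word
    \<Rightarrow> ('k, 'o, 'a, 'm) ten" where
  "blk A N w =
    (let L = arrs (takeWhile is_Bar w); R = arrs (tl (dropWhile is_Bar w)) in
     case filter (\<lambda>l. \<not> is_Bar l) w of
       [] \<Rightarrow> wd [Bar (mu_arr A (arrs w))]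
     | [Coef a] \<Rightarrow> wd [Coef (bA A L a R)]
     | [Dual m] \<Rightarrow> wd [Dual (bN N L m R)]
     | _ \<Rightarrow> 0)"

definition lind :: "('k::comm_ring_1, 'o, 'a) ainf \<Rightarrow> ('k, 'o, 'a, 'm) abim \<Rightarrow> ('o, 'a, 'm) word
    \<Rightarrow> ('k, 'o, 'a, 'm) ten" where
  "lind A N w = (\<Sum>(u, v, z)\<in>{(u, v, z)\<in>cut3 w. v \<noteq> []}.
     fscl (sg (wdeg u)) (fcat (wd u) (fcat (blk A N v) (wd z))))"

definition cycd :: "('k::comm_ring_1, 'o, 'a) ainf \<Rightarrow> ('k, 'o, 'a, 'm) abim \<Rightarrow> ('o, 'a, 'm) word
    \<Rightarrow> ('k, 'o, 'a, 'm) ten" where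
  "cycd A N w = lind A N w +
     (\<Sum>(v1, u, v2)\<in>{(v1, u, v2)\<in>cut3 w. v1 \<noteq> [] \<and> v2 \<noteq> []}.
        fscl (sg (wdeg v2 * (wdeg v1 + wdeg u))) (fcat (blk A N (v2 @ v1)) (wd u)))"

text \<open>Words for \<open>C\<^sub>*(A,A)\<close> and for \<open>C\<^sub>*(A,A) \<otimes> C\<^sub>*(A,A)\<close>.\<close>

definition CH :: "('k, 'o, 'a) ainf \<Rightarrow> ('o, 'a, 'm) word set" where
  "CH A = {Coef a # map Bar B | a B x y. a \<in> homs A x y \<and> B \<in> paths A y x}"

definition CHCH :: "('k, 'o, 'a) ainf \<Rightarrow> ('o, 'a, 'm) word set" where
  "CHCH A = {u @ v | u v. u \<in> CH A \<and> v \<in> CH A}"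

definition fst_chain :: "('o, 'a, 'm) word \<Rightarrow> ('o, 'a, 'm) word" where
  "fst_chain w = hd w # takeWhile is_Bar (tl w)"
definition snd_chain :: "('o, 'a, 'm) word \<Rightarrow> ('o, 'a, 'm) word" where
  "snd_chain w = dropWhile is_Bar (tl w)"

text \<open>\<open>f \<otimes> id\<close> and \<open>id \<otimes> f\<close> on \<open>C\<^sub>*(A,A) \<otimes> C\<^sub>*(A,A)\<close>, for \<open>f\<close> of degree \<open>e\<close>.\<close>

definition on_fst where
  "on_fst f t = ext (\<lambda>w. fcat (f (fst_chain w)) (wd (snd_chain w))) t"
definition on_snd where
  "on_snd e f t = ext (\<lambda>w. fscl (sg (e * wdeg (fst_chain w))) (fcat (wd (fst_chain w)) (f (snd_chain w)))) t"

definition dC where "dC A N t = ext (cycd A N) t"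

definition dCC where "dCC A N t = on_fst (cycd A N) t + on_snd 1 (cycd A N) t"


section \<open>\<open>A\<^sup>!\<close>, \<open>\<eta>\<close> and \<open>co\<close>\<close>

text \<open>
  The complex containing \<open>\<eta>\<close>: functions \<open>\<eta> w1 w2\<close> of words \<open>w1\<close> (bars, \<open>A\<close>-input, bars; read
  clockwise) and \<open>w2\<close> (bars, \<open>A\<^sup>!\<close>-input, bars). The value is \<open>(left output) \<otimes> (right output)\<close>;
  clockwise, the right output comes after \<open>w1\<close> and the left output after \<open>w2\<close>.
\<close>

type_synonym ('k, 'o, 'a, 'm) etamap =
  "('o, 'a, 'm) word \<Rightarrow> ('o, 'a, 'm) word \<Rightarrow> ('o, 'a, 'm) word \<Rightarrow>\<^sub>0 'k"

definition WA :: "('k, 'o, 'a) ainf \<Rightarrow> 'o \<Rightarrow> 'o \<Rightarrow> ('o, 'a, 'm) word set" where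
  "WA A u0 u1 = {map Bar i @ [Coef a] @ map Bar j | i a j p q.
     i \<in> paths A u0 p \<and> a \<in> homs A p q \<and> j \<in> paths A q u1}"

definition WN :: "('k, 'o, 'a) ainf \<Rightarrow> ('k, 'o, 'a, 'm) abim \<Rightarrow> 'o \<Rightarrow> 'o \<Rightarrow> ('o, 'a, 'm) word set" where
  "WN A N v0 v1 = {map Bar k @ [Dual m] @ map Bar l | k m l p q.
     k \<in> paths A v0 p \<and> m \<in> mhoms N p q \<and> l \<in> paths A q v1}"

definition eta_d :: "('k::comm_ring_1, 'o, 'a) ainf \<Rightarrow> ('k, 'o, 'a, 'm) abim \<Rightarrow> ('k, 'o, 'a, 'm) etamap
    \<Rightarrow> ('o, 'a) arr list \<Rightarrow> ('o, 'a) arr \<Rightarrow> ('o, 'a) arr list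
    \<Rightarrow> ('o, 'a) arr list \<Rightarrow> ('o, 'm) arr \<Rightarrow> ('o, 'a) arr list \<Rightarrow> ('k, 'o, 'a, 'm) ten" where
  "eta_d A N \<eta> i a j k m l =
    \<comment> \<open>\<open>\<mu>\<close> on the left output; second sign: \<open>s, i1, x, y, l2\<close> to \<open>i1, s, x, l2, y\<close>\<close>
    - (\<Sum>(i1, i2)\<in>cut2 i. \<Sum>(l1, l2)\<in>cut2 l.
        ext (two (\<lambda>x y. fscl (koszul [1, bdeg i1, adeg x, adeg y, bdeg l2] [1, 0, 2, 4, 3])
               (wd [Coef (mu_arr A (i1 @ [x] @ l2)), Coef y])))
          (\<eta> (map Bar i2 @ [Coef a] @ map Bar j) (map Bar k @ [Dual m] @ map Bar l1)))
    \<comment> \<open>\<open>\<mu>\<close> on the right output; \<open>i, a, j1, j2, k1, k2, m, l\<close> to \<open>i, a, j1, k2, m, l, k1, j2\<close>, then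
        \<open>s, x, y, k1, j2\<close> to \<open>x, k1, s, y, j2\<close>\<close>
    - (\<Sum>(j1, j2)\<in>cut2 j. \<Sum>(k1, k2)\<in>cut2 k.
        fscl (koszul [bdeg i, adeg a, bdeg j1, bdeg j2, bdeg k1, bdeg k2, adeg m, bdeg l]
                     [0, 1, 2, 5, 6, 7, 4, 3])
        (ext (two (\<lambda>x y. fscl (koszul [1, adeg x, adeg y, bdeg k1, bdeg j2] [1, 3, 0, 2, 4])
               (wd [Coef x, Coef (mu_arr A (k1 @ [y] @ j2))])))
          (\<eta> (map Bar i @ [Coef a] @ map Bar j1) (map Bar k2 @ [Dual m] @ map Bar l))))
    - (let w1 = map Bar i @ [Coef a] @ map Bar j; w2 = map Bar k @ [Dual m] @ map Bar l in
       ext (\<lambda>w. \<eta> w w2) (lind A N w1) + fscl (sg (wdeg w1)) (ext (\<lambda>w. \<eta> w1 w) (lind A N w2)))"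

definition eta_cocycle :: "('k::comm_ring_1, 'o, 'a::ab_group_add) ainf
    \<Rightarrow> ('k, 'o, 'a, 'm::ab_group_add) abim \<Rightarrow> ('k, 'o, 'a, 'm) etamap \<Rightarrow> bool" where
  "eta_cocycle A N \<eta> \<longleftrightarrow>
    (\<forall>u0 u1 v0 v1. \<forall>w1\<in>WA A u0 u1. \<forall>w2\<in>WN A N v0 v1.
       \<eta> w1 w2 \<in> free {w\<in>W2 A u0 v1 v0 u1. wdeg w = wdeg w1 + wdeg w2} \<and>
       mlin A N (WA A u0 u1) (\<lambda>w. \<eta> w w2) (W2 A u0 v1 v0 u1) \<and>
       mlin A N (WN A N v0 v1) (\<lambda>w. \<eta> w1 w) (W2 A u0 v1 v0 u1)) \<and>
    (\<forall>u0 p q u1 v0 r s v1.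
       \<forall>i\<in>paths A u0 p. \<forall>a\<in>homs A p q. \<forall>j\<in>paths A q u1.
       \<forall>k\<in>paths A v0 r. \<forall>m\<in>mhoms N r s. \<forall>l\<in>paths A s v1.
         eta_d A N \<eta> i a j k m l \<in> rel A N (W2 A u0 v1 v0 u1))"

text \<open>
  \<open>N\<close> models \<open>\<real>Hom(A, A \<otimes> A)\<close> (morphisms of bimodules for the outer structure, bimodule structure
  induced by the inner one): a bimodule quasi-isomorphism from \<open>N\<close> to the complex of
  \<open>A\<^sub>\<infinity>\<close>-morphisms \<open>A \<rightarrow> A \<otimes> A\<close> is the same as a closed \<open>\<theta>\<close> of the same type as \<open>\<eta>\<close>, such that
  \<open>m \<mapsto> \<theta>(-; m)\<close> is a quasi-isomorphism for each pair of objects.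
\<close>

definition eval_at :: "('k::comm_ring_1, 'o, 'a, 'm) etamap \<Rightarrow> ('o, 'm) arr \<Rightarrow> ('k, 'o, 'a, 'm) bmap" where
  "eval_at \<theta> m L w R =
     fscl (sg (adeg m * (bdeg L + wdeg w + bdeg R))) (\<theta> (map Bar L @ w @ map Bar R) [Dual m])"

definition models_dual :: "('k::comm_ring_1, 'o, 'a::ab_group_add) ainf
    \<Rightarrow> ('k, 'o, 'a, 'm::ab_group_add) abim \<Rightarrow> ('k, 'o, 'a, 'm) etamap \<Rightarrow> bool" where
  "models_dual A N \<theta> \<longleftrightarrow>
    module (msmul N) \<and> (\<forall>x y d. module.subspace (msmul N) (mmor N x y d)) \<and>
    is_bimodule A N (wbim_of N) \<and>
    eta_cocycle A N \<theta> \<and>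
    (\<forall>v0 v1 d.
      (\<forall>m\<in>mmor N v0 v1 d.
         mact N [] (Arr v0 v1 d m) [] = 0 \<and>
         cohomologous A N (diag A) (rep A v1 v0) d (eval_at \<theta> (Arr v0 v1 d m)) (\<lambda>L w R. 0)
         \<longrightarrow> (\<exists>m'\<in>mmor N v0 v1 (d + 1). mact N [] (Arr v0 v1 (d + 1) m') [] = m)) \<and>
      (\<forall>f. closed_mor A N (diag A) (rep A v1 v0) d f \<longrightarrow>
         (\<exists>m\<in>mmor N v0 v1 d. mact N [] (Arr v0 v1 d m) [] = 0 \<and>
            cohomologous A N (diag A) (rep A v1 v0) d f (eval_at \<theta> (Arr v0 v1 d m)))))"

text \<open>Words \<open>a, r, m, l\<close> for \<open>A \<otimes> bars \<otimes> A\<^sup>! \<otimes> bars\<close>, cyclically composable.\<close>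

definition Wco :: "('k, 'o, 'a) ainf \<Rightarrow> ('k, 'o, 'a, 'm) abim \<Rightarrow> ('o, 'a, 'm) word set" where
  "Wco A N = {Coef a # map Bar r @ [Dual m] @ map Bar l | a r m l x y z w.
     a \<in> homs A x y \<and> r \<in> paths A y z \<and> m \<in> mhoms N z w \<and> l \<in> paths A w x}"

definition on_co :: "(('o, 'a) arr \<Rightarrow> ('o, 'a) arr list \<Rightarrow> ('o, 'm) arr \<Rightarrow> ('o, 'a) arr list \<Rightarrow> 'b)
    \<Rightarrow> ('o, 'a, 'm) word \<Rightarrow> 'b::zero" where
  "on_co f w = (case w of Coef a # w' \<Rightarrow>
       (case dropWhile is_Bar w' of Dual m # l \<Rightarrow> f a (arrs (takeWhile is_Bar w')) m (arrs l) | _ \<Rightarrow> 0)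
     | _ \<Rightarrow> 0)"

text \<open>
  Contract the \<open>A\<^sup>!\<close>-input of \<open>\<eta>\<close> with \<open>co\<close> and multiply (left output)(\<open>A\<close>-factor)(right output),
  as a map of bimodules \<open>A \<rightarrow> A\<close>. Multiplication is the composite of the two \<open>A\<^sub>\<infinity>\<close>-bimodule maps
  induced by \<open>\<mu>\<close>, the left product being formed first; \<open>z\<close> denotes that product.
\<close>

definition contract :: "('k::comm_ring_1, 'o, 'a) ainf \<Rightarrow> ('k, 'o, 'a, 'm) etamap
    \<Rightarrow> ('k, 'o, 'a, 'm) ten \<Rightarrow> ('k, 'o, 'a, 'm) bmap" where
  "contract A \<eta> co L w R = (case w of [Coef a'] \<Rightarrow>
    ext (on_co (\<lambda>a r m l.
      \<Sum>(r1, r2, r3)\<in>cut3 r. \<Sum>(l1, l2)\<in>cut2 l. \<Sum>(L1, L2, L3)\<in>cut3 L. \<Sum>(R1, R2)\<in>cut2 R.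
        \<comment> \<open>\<open>a, r1, r2, r3, m, l1, l2, L1, L2, L3, a', R1, R2\<close> to
            \<open>L3, a', R1, r3, m, l1, a, r1, r2, l2, L1, L2, R2\<close>\<close>
        fscl (koszul [adeg a, bdeg r1, bdeg r2, bdeg r3, adeg m, bdeg l1, bdeg l2,
                      bdeg L1, bdeg L2, bdeg L3, adeg a', bdeg R1, bdeg R2]
                     [9, 10, 11, 3, 4, 5, 0, 1, 2, 6, 7, 8, 12])
        (ext (two (\<lambda>x y.
          \<comment> \<open>\<open>s\<^sub>z, s\<^sub>y, s\<^sub>x, s\<^sub>a, x, y, a, r1, r2, l2, L1, L2, R2\<close> to
              \<open>L1, s\<^sub>z, L2, s\<^sub>x, x, l2, s\<^sub>a, a, r1, r2, s\<^sub>y, y, R2\<close>\<close>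
          fscl (koszul [1, 1, 1, 1, adeg x, adeg y, adeg a, bdeg r1, bdeg r2, bdeg l2,
                        bdeg L1, bdeg L2, bdeg R2]
                       [10, 0, 11, 2, 4, 9, 3, 6, 7, 8, 1, 5, 12])
          (wd [Coef (mu_arr A (L1 @ [mu_arr A (L2 @ [x] @ l2 @ [a] @ r1)] @ r2 @ [y] @ R2))])))
        (\<eta> (map Bar L3 @ [Coef a'] @ map Bar R1) (map Bar r3 @ [Dual m] @ map Bar l1))))) co
    | _ \<Rightarrow> 0)"

definition contracts_to_id where
  "contracts_to_id A N \<eta> co \<longleftrightarrow>
     cohomologous A N (diag A) (diag A) 0 (contract A \<eta> co) id_mor"

text \<open>
  \<open>co\<close> represents \<open>id\<^sub>A\<close> under the identification defined by the quasi-isomorphism \<open>\<theta>\<close> that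
  exhibits \<open>N\<close> as a model of \<open>A\<^sup>!\<close>.
\<close>

definition is_co :: "('k::comm_ring_1, 'o, 'a::ab_group_add) ainf
    \<Rightarrow> ('k, 'o, 'a, 'm::ab_group_add) abim \<Rightarrow> ('k, 'o, 'a, 'm) etamap \<Rightarrow> ('k, 'o, 'a, 'm) ten \<Rightarrow> bool" where
  "is_co A N \<theta> co \<longleftrightarrow>
     co \<in> free {w\<in>Wco A N. wdeg w = 0} \<and> ext (cycd A N) co \<in> rel A N (Wco A N) \<and>
     contracts_to_id A N \<theta> co"

definition is_eta :: "('k::comm_ring_1, 'o, 'a::ab_group_add) ainf
    \<Rightarrow> ('k, 'o, 'a, 'm::ab_group_add) abim \<Rightarrow> ('k, 'o, 'a, 'm) ten \<Rightarrow> ('k, 'o, 'a, 'm) etamap \<Rightarrow> bool" where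
  "is_eta A N co \<eta> \<longleftrightarrow> eta_cocycle A N \<eta> \<and> contracts_to_id A N \<eta> co"


section \<open>The operations\<close>

text \<open>
  Sign rule. The edges are odd symbols (suspensions) in the order \<open>e\<^sub>N \<dots> e\<^sub>2 e\<^sub>1\<close>, followed by the
  inputs; the symbols are rearranged into the order in which they occur in the formula, each \<open>e\<^sub>i\<close>
  in front of the factor carried by that edge. The \<open>A\<close>- and \<open>A\<^sup>!\<close>-inputs of \<open>\<eta>\<close> and the outgoing
  coefficients are not suspended: they have desuspension symbols \<open>d\<^sub>A\<close>, \<open>d\<^sub>N\<close> resp. \<open>d\<^sub>L\<close>, \<open>d\<^sub>R\<close>, put
  at the left. \<open>\<mu>\<close>, \<open>co\<close> and \<open>\<eta>\<close> are even and need no symbol. With a single outgoing edge \<open>e\<^sub>N\<close>, it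
  and its desuspension stay adjacent and are omitted.
  A cochain \<open>\<phi>\<close> of cohomological degree \<open>q\<close> is a function of the first object and the arguments.
\<close>

type_synonym ('o, 'a) cochain = "'o \<Rightarrow> ('o, 'a) arr list \<Rightarrow> 'a"

definition out_arr :: "int \<Rightarrow> ('o, 'a) cochain \<Rightarrow> 'o \<Rightarrow> ('o, 'a) arr list \<Rightarrow> ('o, 'a) arr" where
  "out_arr q \<phi> x B = Arr x (pend x B) (bdeg B - q) (\<phi> x B)"

definition on_chain :: "(('o, 'a) arr \<Rightarrow> ('o, 'a) arr list \<Rightarrow> 'b) \<Rightarrow> ('o, 'a, 'm) word \<Rightarrow> 'b::zero" where
  "on_chain f w = (case w of Coef a # B \<Rightarrow> f a (arrs B) | _ \<Rightarrow> 0)"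

definition cap :: "('k::comm_ring_1, 'o, 'a) ainf \<Rightarrow> int \<Rightarrow> ('o, 'a) cochain \<Rightarrow> ('o, 'a, 'm) word
    \<Rightarrow> ('k, 'o, 'a, 'm) ten" where
  "cap A q \<phi> = on_chain (\<lambda>a B. \<Sum>(B1, B2, B3, B4, B5)\<in>cut5 B.
     \<comment> \<open>\<open>e\<^sub>2, e\<^sub>1, \<phi>, a, B1, \<dots>, B5\<close> to \<open>B3, e\<^sub>1, \<phi>, B4, B5, e\<^sub>2, a, B1, B2\<close>\<close>
     fscl (koszul [1, 1, q, adeg a, bdeg B1, bdeg B2, bdeg B3, bdeg B4, bdeg B5]
                  [6, 1, 2, 7, 8, 0, 3, 4, 5])
     (wd (Coef (mu_arr A (B3 @ [out_arr q \<phi> (tgt (last (a # B1 @ B2 @ B3))) B4] @ B5 @ [a] @ B1))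
          # map Bar B2)))"

text \<open>
  \<open>x, y\<close> are the outputs of \<open>\<eta>\<close>, \<open>l\<close> and \<open>r\<close> the bar factors that reach the left and right circle;
  \<open>d\<^sub>L, d\<^sub>R, e\<^sub>r, e\<^sub>l, x, y, l, r\<close> to \<open>d\<^sub>L, e\<^sub>l, x, l, d\<^sub>R, e\<^sub>r, y, r\<close>, where \<open>e\<^sub>l\<close>, \<open>e\<^sub>r\<close> are the edges
  to the left and right circle.
\<close>

definition to_circles :: "('o, 'a) arr list \<Rightarrow> ('o, 'a) arr list \<Rightarrow> ('k::comm_ring_1, 'o, 'a, 'm) ten
    \<Rightarrow> ('k, 'o, 'a, 'm) ten" where
  "to_circles l r t = ext (two (\<lambda>x y.
     fscl (koszul [1, 1, 1, 1, adeg x, adeg y, bdeg l, bdeg r] [0, 3, 4, 6, 1, 2, 5, 7])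
       (wd (Coef x # map Bar l @ Coef y # map Bar r)))) t"

text \<open>
  In the word \<open>a, r, m, l\<close> of \<open>co\<close> the factors \<open>r\<close> are emitted in the right corner, ordered from
  the \<open>A\<close>-edge to the \<open>A\<^sup>!\<close>-edge, and \<open>l\<close> in the left corner, ordered from the \<open>A\<^sup>!\<close>-edge to the
  \<open>A\<close>-edge. Each side of the annulus is a disc after cutting along the edge to its circle, so a
  drawing is a way to cut \<open>r\<close> and \<open>l\<close> into consecutive segments.
\<close>

definition E :: "('k::comm_ring_1, 'o, 'a) ainf \<Rightarrow> ('k, 'o, 'a, 'm) ten \<Rightarrow> ('k, 'o, 'a, 'm) etamap
    \<Rightarrow> ('k, 'o, 'a, 'm) ten" where
  "E A co \<eta> = ext (on_co (\<lambda>a r m l. \<Sum>(r1, r2, r3)\<in>cut3 r. \<Sum>(l1, l2, l3)\<in>cut3 l.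
     \<comment> \<open>\<open>d\<^sub>A, d\<^sub>N, e\<^sub>2, e\<^sub>1, a, r1, r2, r3, m, l1, l2, l3\<close> to
         \<open>l3, d\<^sub>A, e\<^sub>1, a, r1, r3, d\<^sub>N, e\<^sub>2, m, l1, l2, r2\<close>\<close>
     fscl (koszul [1, 1, 1, 1, adeg a, bdeg r1, bdeg r2, bdeg r3, adeg m, bdeg l1, bdeg l2, bdeg l3]
                  [11, 0, 3, 4, 5, 7, 1, 2, 8, 9, 10, 6])
     (to_circles l2 r2
        (\<eta> (map Bar l3 @ [Coef a] @ map Bar r1) (map Bar r3 @ [Dual m] @ map Bar l1))))) co"

text \<open>\<open>\<phi> \<rightarrow> \<eta>\<close> in the corner between the left output and the \<open>A\<close>-input (top).\<close>

definition G1 :: "int \<Rightarrow> ('o, 'a) cochain \<Rightarrow> ('k::comm_ring_1, 'o, 'a, 'm) ten \<Rightarrow> ('k, 'o, 'a, 'm) etamap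
    \<Rightarrow> ('k, 'o, 'a, 'm) ten" where
  "G1 q \<phi> co \<eta> = ext (on_co (\<lambda>a r m l. \<Sum>(r1, r2, r3)\<in>cut3 r. \<Sum>(l1, l2, l3, l4, l5)\<in>cut5 l.
     \<comment> \<open>\<open>d\<^sub>A, d\<^sub>N, e\<^sub>3, e\<^sub>2, e\<^sub>1, \<phi>, a, r1, r2, r3, m, l1, \<dots>, l5\<close> to
         \<open>l3, e\<^sub>3, \<phi>, l4, l5, d\<^sub>A, e\<^sub>1, a, r1, r3, d\<^sub>N, e\<^sub>2, m, l1, l2, r2\<close>\<close>
     fscl (koszul [1, 1, 1, 1, 1, q, adeg a, bdeg r1, bdeg r2, bdeg r3, adeg m,
                   bdeg l1, bdeg l2, bdeg l3, bdeg l4, bdeg l5]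
                  [13, 2, 5, 14, 15, 0, 4, 6, 7, 9, 1, 3, 10, 11, 12, 8])
     (to_circles l2 r2
        (\<eta> (map Bar (l3 @ [out_arr q \<phi> (pend (tgt m) (l1 @ l2 @ l3)) l4] @ l5) @ [Coef a] @ map Bar r1)
            (map Bar r3 @ [Dual m] @ map Bar l1))))) co"

text \<open>\<open>co \<rightarrow> \<phi> \<rightarrow> \<eta>\<close>: \<open>\<phi>\<close> sits on the \<open>A\<close>-edge.\<close>

definition G2 :: "int \<Rightarrow> ('o, 'a) cochain \<Rightarrow> ('k::comm_ring_1, 'o, 'a, 'm) ten \<Rightarrow> ('k, 'o, 'a, 'm) etamap
    \<Rightarrow> ('k, 'o, 'a, 'm) ten" where
  "G2 q \<phi> co \<eta> = ext (on_co (\<lambda>a r m l. \<Sum>(r1, r2, r3, r4)\<in>cut4 r. \<Sum>(l1, l2, l3, l4)\<in>cut4 l.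
     \<comment> \<open>\<open>d\<^sub>A, d\<^sub>N, e\<^sub>3, e\<^sub>2, e\<^sub>1, \<phi>, a, r1, \<dots>, r4, m, l1, \<dots>, l4\<close> to
         \<open>l3, d\<^sub>A, e\<^sub>3, \<phi>, l4, e\<^sub>1, a, r1, r2, r4, d\<^sub>N, e\<^sub>2, m, l1, l2, r3\<close>\<close>
     fscl (koszul [1, 1, 1, 1, 1, q, adeg a, bdeg r1, bdeg r2, bdeg r3, bdeg r4, adeg m,
                   bdeg l1, bdeg l2, bdeg l3, bdeg l4]
                  [14, 0, 2, 5, 15, 4, 6, 7, 8, 10, 1, 3, 11, 12, 13, 9])
     (to_circles l2 r3
        (\<eta> (map Bar l3 @ [Coef (out_arr q \<phi> (pend (tgt m) (l1 @ l2 @ l3)) (l4 @ [a] @ r1))] @ map Bar r2)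
            (map Bar r4 @ [Dual m] @ map Bar l1))))) co"

text \<open>\<open>\<phi> \<rightarrow> \<eta>\<close> in the corner between the \<open>A\<close>-input and the right output.\<close>

definition G3 :: "int \<Rightarrow> ('o, 'a) cochain \<Rightarrow> ('k::comm_ring_1, 'o, 'a, 'm) ten \<Rightarrow> ('k, 'o, 'a, 'm) etamap
    \<Rightarrow> ('k, 'o, 'a, 'm) ten" where
  "G3 q \<phi> co \<eta> = ext (on_co (\<lambda>a r m l. \<Sum>(r1, r2, r3, r4, r5)\<in>cut5 r. \<Sum>(l1, l2, l3)\<in>cut3 l.
     \<comment> \<open>\<open>d\<^sub>A, d\<^sub>N, e\<^sub>3, e\<^sub>2, e\<^sub>1, \<phi>, a, r1, \<dots>, r5, m, l1, l2, l3\<close> to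
         \<open>l3, d\<^sub>A, e\<^sub>1, a, r1, e\<^sub>3, \<phi>, r2, r3, r5, d\<^sub>N, e\<^sub>2, m, l1, l2, r4\<close>\<close>
     fscl (koszul [1, 1, 1, 1, 1, q, adeg a, bdeg r1, bdeg r2, bdeg r3, bdeg r4, bdeg r5, adeg m,
                   bdeg l1, bdeg l2, bdeg l3]
                  [15, 0, 4, 6, 7, 2, 5, 8, 9, 11, 1, 3, 12, 13, 14, 10])
     (to_circles l2 r4
        (\<eta> (map Bar l3 @ [Coef a] @ map Bar (r1 @ [out_arr q \<phi> (pend (tgt a) r1) r2] @ r3))
            (map Bar r5 @ [Dual m] @ map Bar l1))))) co"

text \<open>\<open>\<phi>\<close> sits on the right output; here \<open>e\<^sub>3\<close> is applied after \<open>\<eta>\<close>.\<close>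

definition G4 :: "int \<Rightarrow> ('o, 'a) cochain \<Rightarrow> ('k::comm_ring_1, 'o, 'a, 'm) ten \<Rightarrow> ('k, 'o, 'a, 'm) etamap
    \<Rightarrow> ('k, 'o, 'a, 'm) ten" where
  "G4 q \<phi> co \<eta> = ext (on_co (\<lambda>a r m l. \<Sum>(r1, r2, r3, r4, r5)\<in>cut5 r. \<Sum>(l1, l2, l3)\<in>cut3 l.
     \<comment> \<open>\<open>d\<^sub>A, d\<^sub>N, e\<^sub>2, e\<^sub>1, \<phi>, a, r1, \<dots>, r5, m, l1, l2, l3\<close> to
         \<open>\<phi>, l3, d\<^sub>A, e\<^sub>1, a, r1, r5, d\<^sub>N, e\<^sub>2, m, l1, l2, r2, r3, r4\<close>\<close>
     fscl (koszul [1, 1, 1, 1, q, adeg a, bdeg r1, bdeg r2, bdeg r3, bdeg r4, bdeg r5, adeg m,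
                   bdeg l1, bdeg l2, bdeg l3]
                  [4, 14, 0, 3, 5, 6, 10, 1, 2, 11, 12, 13, 7, 8, 9])
     (ext (two (\<lambda>x y.
        \<comment> \<open>\<open>d\<^sub>L, d\<^sub>R, e\<^sub>5, e\<^sub>4, e\<^sub>3, \<phi>, x, y, l2, r2, r3, r4\<close> to
            \<open>d\<^sub>L, e\<^sub>4, x, l2, d\<^sub>R, e\<^sub>5, \<phi>, r4, e\<^sub>3, y, r2, r3\<close>\<close>
        fscl (koszul [1, 1, 1, 1, 1, q, adeg x, adeg y, bdeg l2, bdeg r2, bdeg r3, bdeg r4]
                     [0, 3, 6, 8, 1, 2, 5, 11, 4, 7, 9, 10])
        (wd (Coef x # map Bar l2
             @ Coef (out_arr q \<phi> (pend (tgt a) (r1 @ r2 @ r3)) (r4 @ [y] @ r2)) # map Bar r3))))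
        (\<eta> (map Bar l3 @ [Coef a] @ map Bar r1) (map Bar r5 @ [Dual m] @ map Bar l1))))) co"

definition G where
  "G co \<eta> q \<phi> = G1 q \<phi> co \<eta> + G2 q \<phi> co \<eta> + G3 q \<phi> co \<eta> + G4 q \<phi> co \<eta>"


section \<open>\<open>C\<^sup>*\<^sub>(\<^sub>2\<^sub>)(A)\<close> and \<open>g\<^sub>\<alpha>\<close>\<close>

text \<open>
  Clockwise at a vertex \<open>\<alpha>\<close> with two outputs: first output, arguments \<open>P\<close> (a path starting at
  \<open>p\<close>), second output, arguments \<open>Q\<close> (a path starting at \<open>q\<close>).
\<close>

type_synonym ('k, 'o, 'a, 'm) vertex2 =
  "'o \<Rightarrow> ('o, 'a) arr list \<Rightarrow> 'o \<Rightarrow> ('o, 'a) arr list \<Rightarrow> ('o, 'a, 'm) word \<Rightarrow>\<^sub>0 'k"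

definition C2 :: "('k::comm_ring_1, 'o, 'a::ab_group_add) ainf
    \<Rightarrow> ('k, 'o, 'a, 'm::ab_group_add) abim \<Rightarrow> int \<Rightarrow> ('k, 'o, 'a, 'm) vertex2 set" where
  "C2 A N n = {\<alpha>. \<forall>p p' q q'. \<forall>P\<in>paths A p p'. \<forall>Q\<in>paths A q q'.
     \<alpha> p P q Q \<in> free {w\<in>W2 A p q' q p'. wdeg w = bdeg P + bdeg Q - n} \<and>
     mlin A N (map Bar ` paths A p p') (\<lambda>u. \<alpha> p (arrs u) q Q) (W2 A p q' q p') \<and>
     mlin A N (map Bar ` paths A q q') (\<lambda>u. \<alpha> p P q (arrs u)) (W2 A p q' q p')}"

text \<open>The differential \<open>[\<mu>, -]\<close> (up to a global sign): \<open>\<mu>\<close> on either output, minus \<open>\<mu>\<close> on the inputs.\<close>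

definition d2 :: "('k::comm_ring_1, 'o, 'a) ainf \<Rightarrow> int \<Rightarrow> ('k, 'o, 'a, 'm) vertex2 \<Rightarrow> ('k, 'o, 'a, 'm) vertex2" where
  "d2 A n \<alpha> p P q Q =
    - (\<Sum>(P1, P2)\<in>cut2 P. \<Sum>(Q1, Q2)\<in>cut2 Q.
        \<comment> \<open>\<open>\<alpha>, P1, P2, Q1, Q2\<close> to \<open>P1, \<alpha>, P2, Q1, Q2\<close>, then \<open>s, P1, x, y, Q2\<close> to \<open>P1, s, x, Q2, y\<close>\<close>
        fscl (koszul [n, bdeg P1, bdeg P2, bdeg Q1, bdeg Q2] [1, 0, 2, 3, 4])
        (ext (two (\<lambda>x y. fscl (koszul [1, bdeg P1, adeg x, adeg y, bdeg Q2] [1, 0, 2, 4, 3])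
               (wd [Coef (mu_arr A (P1 @ [x] @ Q2)), Coef y])))
          (\<alpha> (pend p P1) P2 q Q1)))
    - (\<Sum>(P1, P2)\<in>cut2 P. \<Sum>(Q1, Q2)\<in>cut2 Q.
        \<comment> \<open>\<open>\<alpha>, P1, P2, Q1, Q2\<close> to \<open>\<alpha>, P1, Q2, Q1, P2\<close>, then \<open>s, x, y, Q1, P2\<close> to \<open>x, Q1, s, y, P2\<close>\<close>
        fscl (koszul [n, bdeg P1, bdeg P2, bdeg Q1, bdeg Q2] [0, 1, 4, 3, 2])
        (ext (two (\<lambda>x y. fscl (koszul [1, adeg x, adeg y, bdeg Q1, bdeg P2] [1, 3, 0, 2, 4])
               (wd [Coef x, Coef (mu_arr A (Q1 @ [y] @ P2))])))
          (\<alpha> p P1 (pend q Q1) Q2)))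
    - fscl (sg n)
       ((\<Sum>(u, v, z)\<in>{(u, v, z)\<in>cut3 P. v \<noteq> []}.
           fscl (sg (bdeg u)) (\<alpha> p (u @ [mu_arr A v] @ z) q Q)) +
        (\<Sum>(u, v, z)\<in>{(u, v, z)\<in>cut3 Q. v \<noteq> []}.
           fscl (sg (bdeg P + bdeg u)) (\<alpha> p P q (u @ [mu_arr A v] @ z))))"

definition C2_closed where
  "C2_closed A N n \<alpha> \<longleftrightarrow> (\<forall>p p' q q'. \<forall>P\<in>paths A p p'. \<forall>Q\<in>paths A q q'.
     d2 A n \<alpha> p P q Q \<in> rel A N (W2 A p q' q p'))"

text \<open>
  The first output of \<open>\<alpha>\<close> is edge 1, the second is edge 2. The bar factors \<open>X\<close> of the input chain
  stay inside the circle formed by the edges 1, 2, 4; they are distributed anticlockwise,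
  starting at edge 3. The arguments \<open>Y\<close> of the resulting cochain enter clockwise from outside,
  starting at edge 5.
\<close>

definition g :: "('k::comm_ring_1, 'o, 'a::ab_group_add) ainf \<Rightarrow> int \<Rightarrow> ('k, 'o, 'a, 'm) vertex2
    \<Rightarrow> ('k, 'o, 'a, 'm) ten \<Rightarrow> ('o, 'a) cochain" where
  "g A n \<alpha> t x Y = lext (smul A) (on_chain (\<lambda>a X.
     \<Sum>(X1, X2, X3, X4)\<in>cut4 X. \<Sum>(Y1, Y2, Y3, Y4)\<in>cut4 Y.
       \<comment> \<open>\<open>\<alpha>, a, X1, \<dots>, X4, Y1, \<dots>, Y4\<close> to \<open>\<alpha>, Y2, X2, a, X1, X3, X4, Y1, Y3, Y4\<close>\<close>
       smul A (koszul [n, adeg a, bdeg X1, bdeg X2, bdeg X3, bdeg X4, bdeg Y1, bdeg Y2, bdeg Y3, bdeg Y4]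
                      [0, 7, 3, 1, 2, 4, 5, 6, 8, 9])
       (lext (smul A) (two (\<lambda>o1 o2.
          \<comment> \<open>\<open>e\<^sub>4, e\<^sub>3, e\<^sub>2, e\<^sub>1, o1, o2, a, X1, X3, X4, Y1, Y3, Y4\<close> to
              \<open>Y1, e\<^sub>1, o1, X3, e\<^sub>4, X4, e\<^sub>3, a, X1, e\<^sub>2, o2, Y3, Y4\<close>\<close>
          smul A (koszul [1, 1, 1, 1, adeg o1, adeg o2, adeg a, bdeg X1, bdeg X3, bdeg X4,
                          bdeg Y1, bdeg Y3, bdeg Y4]
                         [10, 3, 4, 8, 0, 9, 1, 6, 7, 2, 5, 11, 12])
          (mu A (Y1 @ [o1] @ X3 @ [mu_arr A (X4 @ [a] @ X1 @ [o2] @ Y3)] @ Y4))))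
        (\<alpha> (pend x Y1) Y2 (tgt (last (a # X1))) X2)))) t"


section \<open>Trivializations and balancedness\<close>

definition subcomplex :: "('k::comm_ring_1, 'o, 'a::ab_group_add) ainf
    \<Rightarrow> ('k, 'o, 'a, 'm::ab_group_add) abim \<Rightarrow> ('k, 'o, 'a, 'm) ten set \<Rightarrow> bool" where
  "subcomplex A N W \<longleftrightarrow>
     module.subspace fscl W \<and> rel A N (CH A) \<subseteq> W \<and> W \<subseteq> free (CH A) \<and>
     (\<forall>t\<in>W. \<forall>p. hpart p t \<in> W) \<and> (\<forall>t\<in>W. dC A N t \<in> W)"

definition homology_injective :: "('k::comm_ring_1, 'o, 'a::ab_group_add) ainf
    \<Rightarrow> ('k, 'o, 'a, 'm::ab_group_add) abim \<Rightarrow> ('k, 'o, 'a, 'm) ten set \<Rightarrow> bool" where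
  "homology_injective A N W \<longleftrightarrow>
     (\<forall>t\<in>W. dC A N t \<in> rel A N (CH A) \<and> (\<exists>c\<in>free (CH A). t - dC A N c \<in> rel A N (CH A))
        \<longrightarrow> (\<exists>t'\<in>W. t - dC A N t' \<in> rel A N (CH A)))"

definition concentrated_in :: "int \<Rightarrow> ('k::comm_ring_1, 'o, 'a::ab_group_add) ainf
    \<Rightarrow> ('k, 'o, 'a, 'm::ab_group_add) abim \<Rightarrow> ('o, 'a, 'm) word set \<Rightarrow> ('k, 'o, 'a, 'm) ten \<Rightarrow> bool" where
  "concentrated_in d A N V t \<longleftrightarrow> (\<forall>p. p \<noteq> d \<longrightarrow> hpart p t \<in> rel A N V)"

text \<open>The image of \<open>S \<otimes> T\<close> in \<open>C\<^sub>*(A,A) \<otimes> C\<^sub>*(A,A)\<close>.\<close>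

definition tensor_sub :: "('k::comm_ring_1, 'o, 'a::ab_group_add) ainf
    \<Rightarrow> ('k, 'o, 'a, 'm::ab_group_add) abim \<Rightarrow> ('k, 'o, 'a, 'm) ten set \<Rightarrow> ('k, 'o, 'a, 'm) ten set
    \<Rightarrow> ('k, 'o, 'a, 'm) ten set" where
  "tensor_sub A N S T = module.span fscl (rel A N (CHCH A) \<union> {fcat s t | s t. s \<in> S \<and> t \<in> T})"

text \<open>
  \<open>e\<close> has degree 0 and \<open>H\<close> is taken homogeneous of degree 1 (modulo relations), so that \<open>\<lambda>\<^sub>H\<close> below
  is a map of graded modules of degree 1.
\<close>

definition trivialization :: "('k::comm_ring_1, 'o, 'a::ab_group_add) ainf
    \<Rightarrow> ('k, 'o, 'a, 'm::ab_group_add) abim \<Rightarrow> ('k, 'o, 'a, 'm) ten \<Rightarrow> ('k, 'o, 'a, 'm) ten set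
    \<Rightarrow> ('k, 'o, 'a, 'm) ten \<Rightarrow> ('k, 'o, 'a, 'm) ten \<Rightarrow> bool" where
  "trivialization A N e W E0 H \<longleftrightarrow>
     E0 \<in> tensor_sub A N W (free (CH A)) \<inter> tensor_sub A N (free (CH A)) W \<and>
     H \<in> free (CHCH A) \<and> concentrated_in 1 A N (CHCH A) H \<and>
     dCC A N H - (e - E0) \<in> rel A N (CHCH A)"

text \<open>\<open>\<lambda>\<^sub>H\<close> on a cochain \<open>\<phi>\<close> of cohomological degree \<open>q\<close>.\<close>

definition lam where
  "lam A co \<eta> H q \<phi> =
     G co \<eta> q \<phi> - fscl (sg q) (on_fst (cap A q \<phi>) H - on_snd q (cap A q \<phi>) H)"

text \<open>On a chain of degree \<open>p\<close> the value of \<open>g\<^sub>\<alpha>\<close> has cohomological degree \<open>n - p\<close>.\<close>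

definition balanced :: "('k::comm_ring_1, 'o, 'a::ab_group_add) ainf
    \<Rightarrow> ('k, 'o, 'a, 'm::ab_group_add) abim \<Rightarrow> ('k, 'o, 'a, 'm) ten \<Rightarrow> ('k, 'o, 'a, 'm) etamap \<Rightarrow> int
    \<Rightarrow> ('k, 'o, 'a, 'm) ten set \<Rightarrow> ('k, 'o, 'a, 'm) ten \<Rightarrow> ('k, 'o, 'a, 'm) vertex2 \<Rightarrow> bool" where
  "balanced A N co \<eta> n W H \<alpha> \<longleftrightarrow>
     (\<forall>p. \<forall>t\<in>W. (\<forall>w\<in>Poly_Mapping.keys t. wdeg w = p) \<longrightarrow>
        lam A co \<eta> H (n - p) (g A n \<alpha> t)
          \<in> tensor_sub A N (free (CH A)) W \<inter> tensor_sub A N W (free (CH A)))"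

end

theory Submission
  imports Defs
begin

text \<open>
  The idea is a count of degrees. Let \<open>t \<in> W\<close> have degree \<open>p\<close> and put \<open>\<phi> = g\<^sub>\<alpha>(t)\<close>, a cochain of
  cohomological degree \<open>n - p\<close>. Since \<open>W\<close> is concentrated in degree 0, \<open>t\<close> is zero in \<open>C\<^sub>*(A,A)\<close> if
  \<open>p \<noteq> 0\<close>; in that case \<open>\<phi>\<close> vanishes, and so does \<open>\<lambda>\<^sub>H(\<phi>)\<close>. If \<open>p = 0\<close>, then both \<open>G(\<phi>)\<close> and the terms
  with the cap product and \<open>H\<close> have homological degree \<open>1 - n < 0\<close>, while the tensor square of \<open>C\<^sub>*(A,A)\<close> has
  no elements of negative degree because \<open>A\<close> is connective (\<open>negative_word_in_rel\<close>). Thus \<open>\<lambda>\<^sub>H \<circ> g\<^sub>\<alpha>\<close> is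
  zero on \<open>W\<close>, and zero lies in every submodule.

  Chains are represented by combinations of words, and being zero means lying in the span \<open>rel\<close> of the
  multilinearity and unit relations. The work therefore consists in showing that the operations respect
  these relations where the argument passes to the quotient. This happens twice. First, \<open>t\<close> is zero only
  modulo relations, so \<open>g\<^sub>\<alpha>\<close> must kill relations (\<open>g_kills_rel\<close>). Secondly, \<open>H\<close> is homogeneous only modulo
  relations, so capping with \<open>\<phi>\<close> on either tensor factor must preserve relations (\<open>mlin_cap\<close>,
  \<open>ext_factor_words_rel\<close>); this needs that \<open>\<phi>\<close> is multilinear and normalized (\<open>cochain_g\<close>). The element \<open>co\<close>
  is homogeneous on the nose and \<open>\<eta>\<close> has homogeneous values, so the four diagrams of \<open>G\<close> only require a look at
  each word (\<open>G_null\<close>).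

  All these operations are sums over cuts of lists of morphisms. They are linear in each letter because,
  for each cut, the letter is copied or reaches one vertex, which is linear in it; \<open>lin_on\<close> and the lemmas on
  cuts organize this argument.
\<close>

section \<open>Linear extension, and linearity in one letter\<close>

interpretation fs: module "fscl :: 'k::comm_ring_1 \<Rightarrow> ('w \<Rightarrow>\<^sub>0 'k) \<Rightarrow> _"
  by (rule module_fscl)

lemma lext_superset:
  assumes "module s" "finite S" "Poly_Mapping.keys t \<subseteq> S"
  shows "lext s f t = (\<Sum>w\<in>S. s (Poly_Mapping.lookup t w) (f w))"
  unfolding lext_def
  by (rule sum.mono_neutral_left[OF assms(2,3)])
     (auto simp: in_keys_iff module.scale_zero_left[OF assms(1)])

lemma lext_add:
  assumes "module s"
  shows "lext s f (t + t') = lext s f t + lext s f t'"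
proof -
  let ?S = "Poly_Mapping.keys t \<union> Poly_Mapping.keys t'"
  have "Poly_Mapping.keys (t + t') \<subseteq> ?S" by (rule keys_add)
  then show ?thesis
    by (simp add: lext_superset[OF assms, of ?S] lookup_add module.scale_left_distrib[OF assms]
        sum.distrib)
qed

lemma lext_scale:
  assumes "module s"
  shows "lext s f (fscl c t) = s c (lext s f t)"
proof -
  have "Poly_Mapping.keys (fscl c t) \<subseteq> Poly_Mapping.keys t"
    by (auto simp: in_keys_iff lookup_fscl)
  then show ?thesis
    by (simp add: lext_superset[OF assms, of "Poly_Mapping.keys t"] lookup_fscl
        module.scale_scale[OF assms] module.scale_sum_right[OF assms])
qed

lemma lext_zero [simp]: "lext s f 0 = 0"
  by (simp add: lext_def)

lemma lext_minus:
  assumes "module s"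
  shows "lext s f (- t) = - lext s f t"
  using lext_add[OF assms, of f t "- t"] by (simp add: eq_neg_iff_add_eq_0 add.commute)

lemma lext_diff:
  assumes "module s"
  shows "lext s f (t - t') = lext s f t - lext s f t'"
  using lext_add[OF assms, of f t "- t'"] lext_minus[OF assms, of f t'] by simp

lemma lext_sum:
  assumes "module s"
  shows "lext s f (sum h I) = (\<Sum>i\<in>I. lext s f (h i))"
  by (induction I rule: infinite_finite_induct) (simp_all add: lext_add[OF assms])

lemma lext_wd [simp]:
  assumes "module s"
  shows "lext s f (wd w) = f w"
  by (simp add: lext_superset[OF assms, of "{w}"] wd_def module.scale_one[OF assms])

lemma ext_wd [simp]: "ext f (wd w) = f w"
  by (rule lext_wd[OF module_fscl])

lemma lext_in_subspace:
  assumes "module s" "module.subspace s R" "\<And>w. w \<in> Poly_Mapping.keys t \<Longrightarrow> f w \<in> R"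
  shows "lext s f t \<in> R"
  unfolding lext_def
  by (rule module.subspace_sum[OF assms(1,2)]) (rule module.subspace_scale[OF assms(1,2)], rule assms(3))

lemma lext_free_in_subspace:
  assumes "module s" "module.subspace s R" "t \<in> free V" "\<And>w. w \<in> V \<Longrightarrow> f w \<in> R"
  shows "lext s f t \<in> R"
  using assms by (intro lext_in_subspace) (auto simp: free_def)

lemma lext_span_in_subspace:
  assumes "module s" "module.subspace s R" "t \<in> module.span fscl B" "\<And>b. b \<in> B \<Longrightarrow> lext s f b \<in> R"
  shows "lext s f t \<in> R"
proof -
  have "fs.subspace {t. lext s f t \<in> R}"
    using module.subspace_0[OF assms(1,2)] module.subspace_add[OF assms(1,2)]
      module.subspace_scale[OF assms(1,2)]
    by (auto simp: fs.subspace_def lext_add[OF assms(1)] lext_scale[OF assms(1)])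
  from fs.span_minimal[OF _ this] assms(3,4) show ?thesis by blast
qed

lemma subspace_free: "fs.subspace (free V)"
  unfolding fs.subspace_def free_def
proof (intro conjI allI ballI CollectI)
  fix c :: 'a and t s :: "'b \<Rightarrow>\<^sub>0 'a"
  assume "t \<in> {t. Poly_Mapping.keys t \<subseteq> V}"
  then show "Poly_Mapping.keys (fscl c t) \<subseteq> V" by (force simp: in_keys_iff lookup_fscl)
  assume "s \<in> {t. Poly_Mapping.keys t \<subseteq> V}"
  with \<open>t \<in> _\<close> show "Poly_Mapping.keys (t + s) \<subseteq> V" using keys_add[of t s] by auto
qed auto

lemma wd_in_free: "w \<in> V \<Longrightarrow> wd w \<in> free V"
  by (auto simp: wd_def free_def)

text \<open>
  Linearity modulo \<open>R\<close> in one entry. The maps met below are described on words, and they are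
  linear in an entry as long as the other entries stay fixed; every statement that a map
  respects the relations is reduced to this notion. Asking for \<open>s c a + b \<in> S\<close> allows \<open>S\<close> to be the set
  of all entries that fit into a given place of a word.
\<close>

definition lin_on ::
  "('k \<Rightarrow> 'e \<Rightarrow> 'e) \<Rightarrow> 'e set \<Rightarrow> ('k \<Rightarrow> 'b \<Rightarrow> 'b) \<Rightarrow> 'b set \<Rightarrow> ('e::ab_group_add \<Rightarrow> 'b::ab_group_add) \<Rightarrow> bool"
  where "lin_on s S s' R h \<longleftrightarrow>
    (\<forall>c. \<forall>a\<in>S. \<forall>b\<in>S. s c a + b \<in> S \<longrightarrow> h (s c a + b) - s' c (h a) - h b \<in> R)"

lemma lin_on_subset: "lin_on s S s' R h \<Longrightarrow> T \<subseteq> S \<Longrightarrow> lin_on s T s' R h"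
  unfolding lin_on_def by blast

lemma lin_on_cong:
  "(\<And>e. e \<in> S \<Longrightarrow> h e = h' e) \<Longrightarrow> lin_on s S s' R h' \<Longrightarrow> lin_on s S s' R h"
  unfolding lin_on_def by auto

lemma lin_on_sum:
  assumes "module s'" "module.subspace s' R" "\<And>i. i \<in> I \<Longrightarrow> lin_on s S s' R (h i)"
  shows "lin_on s S s' R (\<lambda>e. \<Sum>i\<in>I. h i e)"
  unfolding lin_on_def
proof (intro allI ballI impI)
  fix c a b assume ab: "a \<in> S" "b \<in> S" "s c a + b \<in> S"
  have "(\<Sum>i\<in>I. h i (s c a + b) - s' c (h i a) - h i b) \<in> R"
    using assms(3) ab by (intro module.subspace_sum[OF assms(1,2)]) (auto simp: lin_on_def)
  then show "(\<Sum>i\<in>I. h i (s c a + b)) - s' c (\<Sum>i\<in>I. h i a) - (\<Sum>i\<in>I. h i b) \<in> R"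
    by (simp add: sum_subtractf module.scale_sum_right[OF assms(1)])
qed

lemma lin_on_add:
  assumes "module s'" "module.subspace s' R" "lin_on s S s' R f" "lin_on s S s' R h"
  shows "lin_on s S s' R (\<lambda>e. f e + h e)"
  unfolding lin_on_def
proof (intro allI ballI impI)
  fix c a b assume ab: "a \<in> S" "b \<in> S" "s c a + b \<in> S"
  have "(f (s c a + b) - s' c (f a) - f b) + (h (s c a + b) - s' c (h a) - h b) \<in> R"
    using assms(3,4) ab by (intro module.subspace_add[OF assms(1,2)]) (auto simp: lin_on_def)
  then show "f (s c a + b) + h (s c a + b) - s' c (f a + h a) - (f b + h b) \<in> R"
    by (simp add: module.scale_right_distrib[OF assms(1)] algebra_simps)
qed

lemma lin_on_scale:
  assumes "module s'" "module.subspace s' R" "lin_on s S s' R h"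
  shows "lin_on s S s' R (\<lambda>e. s' (k::'k::comm_ring_1) (h e))"
  unfolding lin_on_def
proof (intro allI ballI impI)
  fix c a b assume ab: "a \<in> S" "b \<in> S" "s c a + b \<in> S"
  have "s' k (h (s c a + b) - s' c (h a) - h b) \<in> R"
    using assms(3) ab by (intro module.subspace_scale[OF assms(1,2)]) (auto simp: lin_on_def)
  then show "s' k (h (s c a + b)) - s' c (s' k (h a)) - s' k (h b) \<in> R"
    by (simp add: module.scale_right_diff_distrib[OF assms(1)] module.scale_scale[OF assms(1)]
        mult.commute)
qed

lemma lin_on_lext:
  assumes "module s'" "module.subspace s' R" "\<And>w. w \<in> Poly_Mapping.keys t \<Longrightarrow> lin_on s S s' R (\<lambda>e. f e w)"
  shows "lin_on s S s' R (\<lambda>e. lext s' (f e) t)"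
  unfolding lext_def
  by (rule lin_on_sum[OF assms(1,2)]) (rule lin_on_scale[OF assms(1,2)], rule assms(3))

text \<open>
  The entry may sit deep inside an expression: an exactly linear map can be put before one
  that is linear modulo \<open>R\<close>, and afterwards (\<open>lin_on_lext_image\<close>) any linear extension that sends \<open>R\<close>
  to \<open>R'\<close> can be applied.
\<close>

lemma lin_on_compose:
  assumes "lin_on s S s' {0} h" "\<And>e. e \<in> S \<Longrightarrow> h e \<in> S'" "lin_on s' S' s'' R f"
  shows "lin_on s S s'' R (\<lambda>e. f (h e))"
  unfolding lin_on_def
proof (intro allI ballI impI)
  fix c a b assume ab: "a \<in> S" "b \<in> S" "s c a + b \<in> S"
  then have "h (s c a + b) = s' c (h a) + h b"
    using assms(1) by (auto simp: lin_on_def algebra_simps)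
  with assms(2)[OF ab(3)] assms(2)[OF ab(1)] assms(2)[OF ab(2)] assms(3)
  show "f (h (s c a + b)) - s'' c (f (h a)) - f (h b) \<in> R"
    by (auto simp: lin_on_def)
qed

lemma lin_on_lext_image:
  assumes "module s'" "lin_on s S fscl R \<tau>" "\<And>t. t \<in> R \<Longrightarrow> lext s' f t \<in> R'"
  shows "lin_on s S s' R' (\<lambda>e. lext s' f (\<tau> e))"
  unfolding lin_on_def
proof (intro allI ballI impI)
  fix c a b assume ab: "a \<in> S" "b \<in> S" "s c a + b \<in> S"
  then have "lext s' f (\<tau> (s c a + b) - fscl c (\<tau> a) - \<tau> b) \<in> R'"
    using assms(2,3) by (auto simp: lin_on_def)
  then show "lext s' f (\<tau> (s c a + b)) - s' c (lext s' f (\<tau> a)) - lext s' f (\<tau> b) \<in> R'"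
    by (simp add: lext_diff[OF assms(1)] lext_scale[OF assms(1)])
qed

lemma lin_on_zero:
  assumes "module s" "module s'" "module.subspace s' R" "0 \<in> S" "lin_on s S s' R h"
  shows "h 0 \<in> R"
proof -
  have s1: "s 1 0 = 0" "s' 1 (h 0) = h 0"
    by (rule module.scale_one[OF assms(1)], rule module.scale_one[OF assms(2)])
  have "s 1 0 + 0 \<in> S" using s1(1) assms(4) by simp
  with assms(4,5) have "h (s 1 0 + 0) - s' 1 (h 0) - h 0 \<in> R"
    unfolding lin_on_def by blast
  with s1 have "- h 0 \<in> R" by simp
  then show ?thesis using module.subspace_neg[OF assms(2,3)] by fastforce
qed

section \<open>Sums over the cuts of a list\<close>

lemma cut2_Nil: "cut2 [] = {([], [])}"
  by (auto simp: cut2_def)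

lemma cut2_Cons: "cut2 (x # xs) = insert ([], x # xs) ((\<lambda>(a, b). (x # a, b)) ` cut2 xs)"
  by (auto simp: cut2_def append_eq_Cons_conv image_iff)

lemma finite_cut2 [simp]: "finite (cut2 xs)"
  by (induction xs) (auto simp: cut2_Nil cut2_Cons)

lemma sum_cut2_Cons:
  "(\<Sum>(a, b)\<in>cut2 (x # xs). F a b) = F [] (x # xs) + (\<Sum>(a, b)\<in>cut2 xs. F (x # a) b)"
proof -
  have "inj_on (\<lambda>(a, b). (x # a, b)) (cut2 xs)" by (auto simp: inj_on_def)
  then show ?thesis
    unfolding cut2_Cons by (subst sum.insert) (auto simp: sum.reindex split_def)
qed

text \<open>
  The place where a list is cut lies either left or right of a given letter. Hence a sum over
  all cuts is linear in this letter if each term is, and in a term the letter belongs to a known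
  segment; the lemmas \<open>lin_on_cut2\<close> to \<open>lin_on_cut5\<close> have one assumption for each segment.
\<close>

lemma sum_cut2_insert:
  "(\<Sum>(a, b)\<in>cut2 (u @ z # v). F a b) =
    (\<Sum>(a, b)\<in>cut2 u. F a (b @ z # v)) + (\<Sum>(a, b)\<in>cut2 v. F (u @ z # a) b)"
  by (induction u arbitrary: F) (simp_all add: cut2_Nil sum_cut2_Cons add.assoc)

lemma sum_cut3: "(\<Sum>(a, b, c)\<in>cut3 xs. F a b c) = (\<Sum>(a, y)\<in>cut2 xs. \<Sum>(b, c)\<in>cut2 y. F a b c)"
proof -
  have "(\<Sum>(a, b, c)\<in>cut3 xs. F a b c) =
      (\<Sum>((a, y), b, c)\<in>(SIGMA p:cut2 xs. cut2 (snd p)). F a b c)"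
    by (rule sum.reindex_bij_witness[where j = "\<lambda>(a, b, c). ((a, b @ c), b, c)"
          and i = "\<lambda>((a, y), b, c). (a, b, c)"]) (auto simp: cut3_def cut2_def)
  then show ?thesis by (simp add: sum.Sigma case_prod_beta)
qed

lemma finite_cut3 [simp]: "finite (cut3 xs)"
proof (rule finite_subset)
  show "cut3 xs \<subseteq> (\<Union>p\<in>cut2 xs. Pair (fst p) ` cut2 (snd p))"
    by (auto simp: cut3_def cut2_def image_iff)
qed (rule finite_UN_I, simp_all)

lemma sum_cut4:
  "(\<Sum>(a, b, c, d)\<in>cut4 xs. F a b c d) = (\<Sum>(a, y)\<in>cut2 xs. \<Sum>(b, c, d)\<in>cut3 y. F a b c d)"
proof -
  have "(\<Sum>(a, b, c, d)\<in>cut4 xs. F a b c d) =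
      (\<Sum>((a, y), b, c, d)\<in>(SIGMA p:cut2 xs. cut3 (snd p)). F a b c d)"
    by (rule sum.reindex_bij_witness[where j = "\<lambda>(a, b, c, d). ((a, b @ c @ d), b, c, d)"
          and i = "\<lambda>((a, y), b, c, d). (a, b, c, d)"]) (auto simp: cut3_def cut4_def cut2_def)
  then show ?thesis by (simp add: sum.Sigma case_prod_beta)
qed

lemma sum_cut5:
  "(\<Sum>(a, b, c, d, e)\<in>cut5 xs. F a b c d e) = (\<Sum>(a, b, y)\<in>cut3 xs. \<Sum>(c, d, e)\<in>cut3 y. F a b c d e)"
proof -
  have "(\<Sum>(a, b, c, d, e)\<in>cut5 xs. F a b c d e) =
      (\<Sum>((a, b, y), c, d, e)\<in>(SIGMA p:cut3 xs. cut3 (snd (snd p))). F a b c d e)"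
    by (rule sum.reindex_bij_witness[where j = "\<lambda>(a, b, c, d, e). ((a, b, c @ d @ e), c, d, e)"
          and i = "\<lambda>((a, b, y), c, d, e). (a, b, c, d, e)"]) (auto simp: cut3_def cut5_def)
  then show ?thesis by (simp add: sum.Sigma case_prod_beta)
qed

lemma lin_on_cut2:
  assumes "module s'" "module.subspace s' R"
    and "\<And>a b. a @ b = u \<Longrightarrow> lin_on s S s' R (\<lambda>e. F a (b @ Z e # v))"
    and "\<And>a b. a @ b = v \<Longrightarrow> lin_on s S s' R (\<lambda>e. F (u @ Z e # a) b)"
  shows "lin_on s S s' R (\<lambda>e. \<Sum>(a, b)\<in>cut2 (u @ Z e # v). F a b)"
  unfolding sum_cut2_insert using assms(3,4)
  by (intro lin_on_add lin_on_sum assms(1,2)) (auto simp: cut2_def)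

lemma lin_on_cut3:
  assumes "module s'" "module.subspace s' R"
    and "\<And>a b c. a @ b @ c = u \<Longrightarrow> lin_on s S s' R (\<lambda>e. F a b (c @ Z e # v))"
    and "\<And>a b c d. a @ b = u \<Longrightarrow> c @ d = v \<Longrightarrow> lin_on s S s' R (\<lambda>e. F a (b @ Z e # c) d)"
    and "\<And>a b c. a @ b @ c = v \<Longrightarrow> lin_on s S s' R (\<lambda>e. F (u @ Z e # a) b c)"
  shows "lin_on s S s' R (\<lambda>e. \<Sum>(a, b, c)\<in>cut3 (u @ Z e # v). F a b c)"
  unfolding sum_cut3
proof (rule lin_on_cut2[OF assms(1,2)])
  show "lin_on s S s' R (\<lambda>e. \<Sum>(b, c)\<in>cut2 (b @ Z e # v). F a b c)" if "a @ b = u" for a b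
    using that assms(3,4) by (intro lin_on_cut2 assms(1,2)) auto
  show "lin_on s S s' R (\<lambda>e. \<Sum>(b, c)\<in>cut2 b. F (u @ Z e # a) b c)" if "a @ b = v" for a b
    using that assms(5) by (intro lin_on_sum assms(1,2)) (auto simp: cut2_def)
qed

lemma lin_on_cut4:
  assumes "module s'" "module.subspace s' R"
    and "\<And>a b c d. a @ b @ c @ d = u \<Longrightarrow> lin_on s S s' R (\<lambda>e. F a b c (d @ Z e # v))"
    and "\<And>a b c d e'. a @ b @ c = u \<Longrightarrow> d @ e' = v \<Longrightarrow> lin_on s S s' R (\<lambda>e. F a b (c @ Z e # d) e')"
    and "\<And>a b c d e'. a @ b = u \<Longrightarrow> c @ d @ e' = v \<Longrightarrow> lin_on s S s' R (\<lambda>e. F a (b @ Z e # c) d e')"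
    and "\<And>a b c d. a @ b @ c @ d = v \<Longrightarrow> lin_on s S s' R (\<lambda>e. F (u @ Z e # a) b c d)"
  shows "lin_on s S s' R (\<lambda>e. \<Sum>(a, b, c, d)\<in>cut4 (u @ Z e # v). F a b c d)"
  unfolding sum_cut4
proof (rule lin_on_cut2[OF assms(1,2)])
  show "lin_on s S s' R (\<lambda>e. \<Sum>(b, c, d)\<in>cut3 (b @ Z e # v). F a b c d)" if "a @ b = u" for a b
    using that assms(3-5) by (intro lin_on_cut3 assms(1,2)) auto
  show "lin_on s S s' R (\<lambda>e. \<Sum>(b, c, d)\<in>cut3 b. F (u @ Z e # a) b c d)" if "a @ b = v" for a b
    using that assms(6) by (intro lin_on_sum assms(1,2)) (auto simp: cut3_def)
qed

lemma lin_on_cut5: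
  assumes "module s'" "module.subspace s' R"
    and "\<And>a b c d f. a @ b @ c @ d @ f = u \<Longrightarrow> lin_on s S s' R (\<lambda>e. F a b c d (f @ Z e # v))"
    and "\<And>a b c d f g. a @ b @ c @ d = u \<Longrightarrow> f @ g = v \<Longrightarrow> lin_on s S s' R (\<lambda>e. F a b c (d @ Z e # f) g)"
    and "\<And>a b c d f g. a @ b @ c = u \<Longrightarrow> d @ f @ g = v \<Longrightarrow> lin_on s S s' R (\<lambda>e. F a b (c @ Z e # d) f g)"
    and "\<And>a b c d f g. a @ b = u \<Longrightarrow> c @ d @ f @ g = v \<Longrightarrow> lin_on s S s' R (\<lambda>e. F a (b @ Z e # c) d f g)"
    and "\<And>a b c d f. a @ b @ c @ d @ f = v \<Longrightarrow> lin_on s S s' R (\<lambda>e. F (u @ Z e # a) b c d f)"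
  shows "lin_on s S s' R (\<lambda>e. \<Sum>(a, b, c, d, f)\<in>cut5 (u @ Z e # v). F a b c d f)"
  unfolding sum_cut5
proof (rule lin_on_cut3[OF assms(1,2)])
  show "lin_on s S s' R (\<lambda>e. \<Sum>(c, d, f)\<in>cut3 (c @ Z e # v). F a b c d f)" if "a @ b @ c = u" for a b c
    using that assms(3-5) by (intro lin_on_cut3 assms(1,2)) auto
  show "lin_on s S s' R (\<lambda>e. \<Sum>(p, q, r)\<in>cut3 d. F a (b @ Z e # c) p q r)"
    if "a @ b = u" "c @ d = v" for a b c d
    using that assms(6) by (intro lin_on_sum assms(1,2)) (auto simp: cut3_def)
  show "lin_on s S s' R (\<lambda>e. \<Sum>(p, q, r)\<in>cut3 c. F (u @ Z e # a) b p q r)"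
    if "a @ b @ c = v" for a b c
    using that assms(7) by (intro lin_on_sum assms(1,2)) (auto simp: cut3_def)
qed

section \<open>Composable lists and words\<close>

text \<open>
  The endpoint of every list is expressed through \<open>pend\<close>. Composability of any arrangement of
  segments then is a conjunction of conditions on the single segments, which the simplifier
  produces both from assumptions and from goals.
\<close>

lemma pend_simps [simp]:
  "pend x [] = x" "pend x (a # as) = pend (tgt a) as" "pend x (as @ bs) = pend (pend x as) bs"
  by (auto simp: pend_def)

lemma path_append: "path x (as @ bs) y \<longleftrightarrow> path x as (pend x as) \<and> path (pend x as) bs y"
  by (induction as arbitrary: x) simp_all

lemma pend_eq: "as \<in> paths A x y \<Longrightarrow> pend x as = y"
proof -
  have "path x as y \<Longrightarrow> pend x as = y" by (induction as arbitrary: x) auto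
  then show "as \<in> paths A x y \<Longrightarrow> pend x as = y" by (simp add: paths_def)
qed

lemma paths_simps [simp]:
  "[] \<in> paths A x y \<longleftrightarrow> x = y"
  "a # as \<in> paths A x y \<longleftrightarrow> src a = x \<and> elt a \<in> mor A x (tgt a) (adeg a) \<and> as \<in> paths A (tgt a) y"
  "as @ bs \<in> paths A x y \<longleftrightarrow> as \<in> paths A x (pend x as) \<and> bs \<in> paths A (pend x as) y"
  by (auto simp: paths_def path_append homs_def)

lemma bdeg_simps [simp]:
  "bdeg [] = 0" "bdeg (a # as) = adeg a + 1 + bdeg as" "bdeg (as @ bs) = bdeg as + bdeg bs"
  by (simp_all add: bdeg_def)

lemma wdeg_simps [simp]:
  "wdeg [] = 0" "wdeg (l # w) = ldeg l + wdeg w" "wdeg (v @ w) = wdeg v + wdeg w"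
  "wdeg (map Bar B) = bdeg B"
  by (simp_all add: wdeg_def bdeg_def o_def)

lemma homs_iff: "a \<in> homs A x y \<longleftrightarrow> src a = x \<and> tgt a = y \<and> elt a \<in> mor A x y (adeg a)"
  by (simp add: homs_def)

lemma arr_of_comp_Bar [simp]: "arr_of \<circ> Bar = id"
  by (simp add: fun_eq_iff)

lemma takeWhile_map_Bar [simp]: "takeWhile is_Bar (map Bar B @ w) = map Bar B @ takeWhile is_Bar w"
  by (induction B) auto

lemma dropWhile_map_Bar [simp]: "dropWhile is_Bar (map Bar B @ w) = dropWhile is_Bar w"
  by (induction B) auto

lemma chains_simps [simp]:
  "fst_chain (Coef a # map Bar X @ Coef b # w) = Coef a # map Bar X"
  "snd_chain (Coef a # map Bar X @ Coef b # w) = Coef b # w"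
  by (simp_all add: fst_chain_def snd_chain_def)

lemma two_Coef [simp]: "two f [Coef x, Coef y] = f x y"
  by (simp add: two_def)

lemma on_chain_Coef [simp]: "on_chain f (Coef a # map Bar B) = f a B"
  by (simp add: on_chain_def)

lemma on_co_word [simp]:
  "on_co f (Coef a # map Bar r @ [Dual m] @ map Bar l) = f a r m l"
  by (simp add: on_co_def)

lemma map_Bar_eq [simp]: "map Bar B = map Bar B' \<longleftrightarrow> B = B'"
  by (rule inj_map_eq_map) (auto simp: inj_on_def)

lemma CH_iff: "Coef a # map Bar B \<in> CH A \<longleftrightarrow> a \<in> homs A (src a) (tgt a) \<and> B \<in> paths A (tgt a) (src a)"
  by (auto simp: CH_def homs_iff)

lemma CH_E:
  assumes "w \<in> CH A"
  obtains a B where "w = Coef a # map Bar B" "a \<in> homs A (src a) (tgt a)" "B \<in> paths A (tgt a) (src a)"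
  using assms by (auto simp: CH_def homs_iff)

lemma CHCH_E:
  assumes "w \<in> CHCH A"
  obtains w1 w2 where "w = w1 @ w2" "w1 \<in> CH A" "w2 \<in> CH A"
  using assms by (auto simp: CHCH_def)

lemma fst_chain_append [simp]: "w1 \<in> CH A \<Longrightarrow> w2 \<in> CH A \<Longrightarrow> fst_chain (w1 @ w2) = w1"
  and snd_chain_append [simp]: "w1 \<in> CH A \<Longrightarrow> w2 \<in> CH A \<Longrightarrow> snd_chain (w1 @ w2) = w2"
  by (auto elim!: CH_E)

lemma Bar_in_chain_word:
  assumes "Coef a # map Bar B = u @ [Bar z] @ v"
  obtains u' v' where "u = Coef a # map Bar u'" "v = map Bar v'" "B = u' @ z # v'"
  using assms by (auto simp: Cons_eq_append_conv map_eq_append_conv)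

lemma Coef_in_chain_word:
  assumes "Coef a # map Bar B = u @ [Coef z] @ v"
  shows "u = [] \<and> a = z \<and> v = map Bar B"
  using assms by (auto simp: Cons_eq_append_conv map_eq_append_conv)

text \<open>
  A relation involves three words that differ in one letter; whether a word is a Hochschild chain
  depends on the endpoints and the degree of that letter only.
\<close>

lemma CH_replace:
  assumes "u @ [mk (Arr x y d e)] @ v \<in> CH A" "e' \<in> mor A x y d" "mk = Coef \<or> mk = Bar"
  shows "u @ [mk (Arr x y d e')] @ v \<in> CH A"
  using assms(3)
proof
  assume mk: "mk = Coef"
  from assms(1) obtain a B where B: "u @ [Coef (Arr x y d e)] @ v = Coef a # map Bar B"
    "a \<in> homs A (src a) (tgt a)" "B \<in> paths A (tgt a) (src a)" unfolding mk by (rule CH_E)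
  from Coef_in_chain_word[OF B(1)[symmetric]] B(2,3) assms(2) show ?thesis
    by (auto simp: mk CH_iff homs_iff)
next
  assume mk: "mk = Bar"
  from assms(1) obtain a B where B: "u @ [Bar (Arr x y d e)] @ v = Coef a # map Bar B"
    "a \<in> homs A (src a) (tgt a)" "B \<in> paths A (tgt a) (src a)" unfolding mk by (rule CH_E)
  from B(1)[symmetric] obtain u' v' where "u = Coef a # map Bar u'" "v = map Bar v'"
    "B = u' @ Arr x y d e # v'" by (rule Bar_in_chain_word)
  then show ?thesis using B(2,3) assms(2)
    CH_iff[of a "u' @ Arr x y d e' # v'"] by (auto simp: mk)
qed

lemma CH_letters: "w \<in> CH A \<Longrightarrow> l \<in> set w \<Longrightarrow> \<exists>a. (l = Coef a \<or> l = Bar a) \<and> elt a \<in> mor A (src a) (tgt a) (adeg a)"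
  by (auto simp: CH_def homs_iff paths_def)

lemma CHCH_letters: "w \<in> CHCH A \<Longrightarrow> l \<in> set w \<Longrightarrow> \<exists>a. (l = Coef a \<or> l = Bar a) \<and> elt a \<in> mor A (src a) (tgt a) (adeg a)"
  by (auto simp: CHCH_def dest: CH_letters)

section \<open>Relations\<close>

lemma subspace_rel: "fs.subspace (rel A N V)"
  unfolding rel_def by (rule fs.subspace_span)

lemma rel_generators:
  "lin_rels Coef (smul A) V \<subseteq> rel A N V" "lin_rels Bar (smul A) V \<subseteq> rel A N V"
  "lin_rels Dual (msmul N) V \<subseteq> rel A N V"
  "u @ [Bar (unit_arr A x)] @ v \<in> V \<Longrightarrow> wd (u @ [Bar (unit_arr A x)] @ v) \<in> rel A N V"
  unfolding rel_def by (auto intro!: fs.span_base)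

lemma lin_on_wd:
  assumes "lin_rels mk s V \<subseteq> R" "\<And>e. e \<in> S \<Longrightarrow> u @ [mk (Arr x y d e)] @ v \<in> V"
  shows "lin_on s S fscl R (\<lambda>e. wd (u @ [mk (Arr x y d e)] @ v))"
  unfolding lin_on_def
proof (intro allI ballI impI)
  fix c a b assume "a \<in> S" "b \<in> S" "s c a + b \<in> S"
  with assms(2) have "wd (u @ [mk (Arr x y d (s c a + b))] @ v) - fscl c (wd (u @ [mk (Arr x y d a)] @ v))
      - wd (u @ [mk (Arr x y d b)] @ v) \<in> lin_rels mk s V"
    unfolding lin_rels_def by blast
  then show "wd (u @ [mk (Arr x y d (s c a + b))] @ v) - fscl c (wd (u @ [mk (Arr x y d a)] @ v))
      - wd (u @ [mk (Arr x y d b)] @ v) \<in> R" using assms(1) by blast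
qed

lemma lin_on_nonempty: "(\<And>e. e \<in> S \<Longrightarrow> lin_on s S s' R h) \<Longrightarrow> lin_on s S s' R h"
  unfolding lin_on_def by blast

lemma lin_on_nonempty_subset:
  "(\<And>e. e \<in> S \<Longrightarrow> S \<subseteq> T \<and> lin_on s T s' R h) \<Longrightarrow> lin_on s S s' R h"
  by (rule lin_on_nonempty) (blast intro: lin_on_subset)

lemma lext_lin_rels:
  assumes "module s"
    and "\<And>u v x y d. lin_on sc {e. u @ [mk (Arr x y d e)] @ v \<in> V} s R (\<lambda>e. f (u @ [mk (Arr x y d e)] @ v))"
    and "b \<in> lin_rels mk sc V"
  shows "lext s f b \<in> R"
proof -
  from assms(3) obtain u v x y d c a a' where "b = wd (u @ [mk (Arr x y d (sc c a + a'))] @ v)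
     - fscl c (wd (u @ [mk (Arr x y d a)] @ v)) - wd (u @ [mk (Arr x y d a')] @ v)"
    and "u @ [mk (Arr x y d (sc c a + a'))] @ v \<in> V" "u @ [mk (Arr x y d a)] @ v \<in> V"
      "u @ [mk (Arr x y d a')] @ v \<in> V"
    unfolding lin_rels_def by blast
  with assms(2)[of u x y d v] show ?thesis
    by (simp add: lin_on_def lext_diff[OF assms(1)] lext_scale[OF assms(1)] lext_wd[OF assms(1)])
qed

text \<open>
  The universal property of a module presented by generators and relations.
\<close>

lemma lext_rel_in_subspace:
  assumes "module s" "module.subspace s R"
    and Coef: "\<And>u v x y d. lin_on (smul A) {e. u @ [Coef (Arr x y d e)] @ v \<in> V} s R
                  (\<lambda>e. f (u @ [Coef (Arr x y d e)] @ v))"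
    and Bar: "\<And>u v x y d. lin_on (smul A) {e. u @ [Bar (Arr x y d e)] @ v \<in> V} s R
                  (\<lambda>e. f (u @ [Bar (Arr x y d e)] @ v))"
    and Dual: "\<And>u v x y d. lin_on (msmul N) {e. u @ [Dual (Arr x y d e)] @ v \<in> V} s R
                  (\<lambda>e. f (u @ [Dual (Arr x y d e)] @ v))"
    and unit: "\<And>u v x. u @ [Bar (unit_arr A x)] @ v \<in> V \<Longrightarrow> f (u @ [Bar (unit_arr A x)] @ v) \<in> R"
    and t: "t \<in> rel A N V"
  shows "lext s f t \<in> R"
proof (rule lext_span_in_subspace[OF assms(1,2) t[unfolded rel_def]])
  fix b
  assume "b \<in> lin_rels Coef (smul A) V \<union> lin_rels Bar (smul A) V \<union> lin_rels Dual (msmul N) V \<union>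
     {wd (u @ [Bar (unit_arr A x)] @ v) | u v x. u @ [Bar (unit_arr A x)] @ v \<in> V}"
  then consider "b \<in> lin_rels Coef (smul A) V" | "b \<in> lin_rels Bar (smul A) V"
    | "b \<in> lin_rels Dual (msmul N) V"
    | u v x where "b = wd (u @ [Bar (unit_arr A x)] @ v)" "u @ [Bar (unit_arr A x)] @ v \<in> V"
    by blast
  then show "lext s f b \<in> R"
  proof cases
    case 1 then show ?thesis by (rule lext_lin_rels[OF assms(1) Coef])
  next
    case 2 then show ?thesis by (rule lext_lin_rels[OF assms(1) Bar])
  next
    case 3 then show ?thesis by (rule lext_lin_rels[OF assms(1) Dual])
  next
    case 4 then show ?thesis using unit by (simp only: lext_wd[OF assms(1)])
  qed
qed

lemma rel_shift:
  assumes "\<And>w. w \<in> V \<Longrightarrow> p @ w @ q \<in> V'" "t \<in> rel A N V"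
  shows "ext (\<lambda>w. wd (p @ w @ q)) t \<in> rel A N V'"
proof (rule lext_rel_in_subspace[OF module_fscl subspace_rel _ _ _ _ assms(2)])
  fix u v x y d
  have "lin_on (smul A) {e. u @ [Coef (Arr x y d e)] @ v \<in> V} fscl (rel A N V')
       (\<lambda>e. wd ((p @ u) @ [Coef (Arr x y d e)] @ (v @ q)))"
    by (rule lin_on_wd[OF rel_generators(1)]) (drule CollectD, drule assms(1), simp)
  then show "lin_on (smul A) {e. u @ [Coef (Arr x y d e)] @ v \<in> V} fscl (rel A N V')
       (\<lambda>e. wd (p @ (u @ [Coef (Arr x y d e)] @ v) @ q))" by simp
  have "lin_on (smul A) {e. u @ [Bar (Arr x y d e)] @ v \<in> V} fscl (rel A N V')
       (\<lambda>e. wd ((p @ u) @ [Bar (Arr x y d e)] @ (v @ q)))"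
    by (rule lin_on_wd[OF rel_generators(2)]) (drule CollectD, drule assms(1), simp)
  then show "lin_on (smul A) {e. u @ [Bar (Arr x y d e)] @ v \<in> V} fscl (rel A N V')
       (\<lambda>e. wd (p @ (u @ [Bar (Arr x y d e)] @ v) @ q))" by simp
  have "lin_on (msmul N) {e. u @ [Dual (Arr x y d e)] @ v \<in> V} fscl (rel A N V')
       (\<lambda>e. wd ((p @ u) @ [Dual (Arr x y d e)] @ (v @ q)))"
    by (rule lin_on_wd[OF rel_generators(3)]) (drule CollectD, drule assms(1), simp)
  then show "lin_on (msmul N) {e. u @ [Dual (Arr x y d e)] @ v \<in> V} fscl (rel A N V')
       (\<lambda>e. wd (p @ (u @ [Dual (Arr x y d e)] @ v) @ q))" by simp
next
  fix u v x assume "u @ [Bar (unit_arr A x)] @ v \<in> V"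
  then show "wd (p @ (u @ [Bar (unit_arr A x)] @ v) @ q) \<in> rel A N V'"
    using assms(1)[of "u @ [Bar (unit_arr A x)] @ v"] rel_generators(4)[of "p @ u" A x "v @ q" V' N]
    by simp
qed

lemma rel_zero_letter:
  assumes "module (smul A)" "u @ [mk (Arr x y d 0)] @ v \<in> V" "mk = Coef \<or> mk = Bar"
  shows "wd (u @ [mk (Arr x y d 0)] @ v) \<in> rel A N V"
proof -
  have "lin_rels mk (smul A) V \<subseteq> rel A N V" using assms(3) rel_generators by blast
  then have "lin_on (smul A) {0} fscl (rel A N V) (\<lambda>e. wd (u @ [mk (Arr x y d e)] @ v))"
    by (rule lin_on_wd) (use assms(2) in simp)
  from lin_on_zero[OF assms(1) module_fscl subspace_rel _ this] show ?thesis by simp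
qed

lemma sum_list_neg: "sum_list (map f xs) < 0 \<Longrightarrow> \<exists>x\<in>set xs. f x < (0::int)"
  by (induction xs) fastforce+

text \<open>
  The reason for the theorem: the degree of a word is the sum of the degrees of its letters, so a
  word of negative degree has a letter of negative degree. As bar letters are shifted upwards,
  its underlying morphism has negative degree, too, and is zero if \<open>A\<close> is connective.
\<close>

lemma negative_word_in_rel:
  assumes "module (smul A)" "connective A" "w \<in> CHCH A" "wdeg w < 0"
  shows "wd w \<in> rel A N (CHCH A)"
proof -
  from assms(4) obtain l where l: "l \<in> set w" "ldeg l < 0"
    unfolding wdeg_def using sum_list_neg by blast
  from CHCH_letters[OF assms(3) l(1)] obtain mk x y d e
    where mk: "mk = Coef \<or> mk = Bar" "l = mk (Arr x y d e)" "e \<in> mor A x y d"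
    by (metis arr.exhaust_sel)
  with l(2) have "d < 0" by auto
  then have "e = 0" using mk(3) assms(2) unfolding connective_def by blast
  moreover from l(1) obtain u v where "w = u @ [l] @ v" by (auto dest: split_list)
  ultimately show ?thesis using rel_zero_letter[OF assms(1) _ mk(1)] mk(2) assms(3) by metis
qed

lemma fcat_wd_right: "fcat t (wd v) = ext (\<lambda>u. wd (u @ v)) t"
  and fcat_wd_left: "fcat (wd u) t = ext (\<lambda>v. wd (u @ v)) t"
  by (simp_all add: fcat_def)

lemma lext_rel_CH:
  fixes A :: "('k::comm_ring_1, 'o, 'a::ab_group_add) ainf" and N :: "('k, 'o, 'a, 'm::ab_group_add) abim"
    and f :: "('o, 'a, 'm) word \<Rightarrow> 'b::ab_group_add"
  assumes "module s" "module.subspace s R"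
    and Coef: "\<And>x y d X. X \<in> paths A y x \<Longrightarrow>
      lin_on (smul A) (mor A x y d) s R (\<lambda>e. f (Coef (Arr x y d e) # map Bar X))"
    and Bar: "\<And>a x y u p q d v. a \<in> homs A x y \<Longrightarrow> u \<in> paths A y p \<Longrightarrow> v \<in> paths A q x \<Longrightarrow>
      lin_on (smul A) (mor A p q d) s R (\<lambda>e. f (Coef a # map Bar (u @ Arr p q d e # v)))"
    and unit: "\<And>a x y B z. a \<in> homs A x y \<Longrightarrow> B \<in> paths A y x \<Longrightarrow> unit_arr A z \<in> set B \<Longrightarrow>
      f (Coef a # map Bar B) \<in> R"
    and t: "t \<in> rel A N (CH A)"
  shows "lext s f t \<in> R"
proof (rule lext_rel_in_subspace[OF assms(1,2) _ _ _ _ t])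
  fix u v :: "('o, 'a, 'm) word" and x y d
  show "lin_on (smul A) {e. u @ [Coef (Arr x y d e)] @ v \<in> CH A} s R (\<lambda>e. f (u @ [Coef (Arr x y d e)] @ v))"
  proof (rule lin_on_nonempty_subset)
    fix e assume "e \<in> {e. u @ [Coef (Arr x y d e)] @ v \<in> CH A}"
    then obtain a B where B: "u @ [Coef (Arr x y d e)] @ v = Coef a # map Bar B"
      "a \<in> homs A (src a) (tgt a)" "B \<in> paths A (tgt a) (src a)" by (auto elim: CH_E)
    from Coef_in_chain_word[OF B(1)[symmetric]] Coef[of B y x d] B(2,3)
    show "{e. u @ [Coef (Arr x y d e)] @ v \<in> CH A} \<subseteq> mor A x y d \<and>
      lin_on (smul A) (mor A x y d) s R (\<lambda>e. f (u @ [Coef (Arr x y d e)] @ v))"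
      by (auto simp: CH_iff homs_iff)
  qed
  show "lin_on (smul A) {e. u @ [Bar (Arr x y d e)] @ v \<in> CH A} s R (\<lambda>e. f (u @ [Bar (Arr x y d e)] @ v))"
  proof (rule lin_on_nonempty_subset)
    fix e assume "e \<in> {e. u @ [Bar (Arr x y d e)] @ v \<in> CH A}"
    then obtain a B where B: "u @ [Bar (Arr x y d e)] @ v = Coef a # map Bar B"
      "a \<in> homs A (src a) (tgt a)" "B \<in> paths A (tgt a) (src a)" by (auto elim: CH_E)
    from B(1)[symmetric] obtain u' v' where u: "u = Coef a # map Bar u'" "v = map Bar v'"
      "B = u' @ Arr x y d e # v'" by (rule Bar_in_chain_word)
    have "e' \<in> mor A x y d" if "u @ [Bar (Arr x y d e')] @ v \<in> CH A" for e'
      using CH_letters[OF that, of "Bar (Arr x y d e')"] by auto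
    with Bar[OF B(2), of u' x v' y d] B(3) u
    show "{e. u @ [Bar (Arr x y d e)] @ v \<in> CH A} \<subseteq> mor A x y d \<and>
      lin_on (smul A) (mor A x y d) s R (\<lambda>e. f (u @ [Bar (Arr x y d e)] @ v))"
      by auto
  qed
  show "lin_on (msmul N) {e. u @ [Dual (Arr x y d e)] @ v \<in> CH A} s R (\<lambda>e. f (u @ [Dual (Arr x y d e)] @ v))"
    by (rule lin_on_nonempty) (auto dest: CH_letters)
next
  fix u v :: "('o, 'a, 'm) word" and x assume "u @ [Bar (unit_arr A x)] @ v \<in> CH A"
  then obtain a B where B: "u @ [Bar (unit_arr A x)] @ v = Coef a # map Bar B"
    "a \<in> homs A (src a) (tgt a)" "B \<in> paths A (tgt a) (src a)" by (auto elim: CH_E)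
  from B(1)[symmetric] obtain u' v' where "B = u' @ unit_arr A x # v'" by (rule Bar_in_chain_word)
  with unit[OF B(2,3), of x] show "f (u @ [Bar (unit_arr A x)] @ v) \<in> R" by (simp add: B(1) flip: append_Cons)
qed

lemma lext_rel_W2:
  fixes A :: "('k::comm_ring_1, 'o, 'a::ab_group_add) ainf" and N :: "('k, 'o, 'a, 'm::ab_group_add) abim"
    and f :: "('o, 'a, 'm) word \<Rightarrow> 'b::ab_group_add"
  assumes "module s" "module.subspace s R"
    and fst: "\<And>y d. y \<in> homs A w q \<Longrightarrow>
      lin_on (smul A) (mor A p v d) s R (\<lambda>e. f [Coef (Arr p v d e), Coef y])"
    and snd: "\<And>x d. x \<in> homs A p v \<Longrightarrow>
      lin_on (smul A) (mor A w q d) s R (\<lambda>e. f [Coef x, Coef (Arr w q d e)])"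
    and t: "t \<in> rel A N (W2 A p v w q)"
  shows "lext s f t \<in> R"
proof (rule lext_rel_in_subspace[OF assms(1,2) _ _ _ _ t])
  fix u u' :: "('o, 'a, 'm) word" and x y d
  let ?S = "{e. u @ [Coef (Arr x y d e)] @ u' \<in> W2 A p v w q}"
  show "lin_on (smul A) ?S s R (\<lambda>e. f (u @ [Coef (Arr x y d e)] @ u'))"
  proof (rule lin_on_nonempty)
    fix e assume "e \<in> ?S"
    then consider (fst) b where "u = []" "u' = [Coef b]" "b \<in> homs A w q" "x = p" "y = v"
      | (snd) a where "u = [Coef a]" "u' = []" "a \<in> homs A p v" "x = w" "y = q"
      by (auto simp: W2_def append_eq_Cons_conv homs_iff)
    then show "lin_on (smul A) ?S s R (\<lambda>e. f (u @ [Coef (Arr x y d e)] @ u'))"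
    proof cases
      case fst
      then show ?thesis
        using lin_on_subset[OF assms(3)[of b d], of ?S] by (auto simp: W2_def homs_iff)
    next
      case snd
      then show ?thesis
        using lin_on_subset[OF assms(4)[of a d], of ?S] by (auto simp: W2_def homs_iff)
    qed
  qed
  show "lin_on (smul A) {e. u @ [Bar (Arr x y d e)] @ u' \<in> W2 A p v w q} s R (\<lambda>e. f (u @ [Bar (Arr x y d e)] @ u'))"
    "lin_on (msmul N) {e. u @ [Dual (Arr x y d e)] @ u' \<in> W2 A p v w q} s R (\<lambda>e. f (u @ [Dual (Arr x y d e)] @ u'))"
    by (rule lin_on_nonempty; auto simp: W2_def append_eq_Cons_conv)+
next
  fix u u' :: "('o, 'a, 'm) word" and x assume "u @ [Bar (unit_arr A x)] @ u' \<in> W2 A p v w q"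
  then show "f (u @ [Bar (unit_arr A x)] @ u') \<in> R" by (auto simp: W2_def append_eq_Cons_conv)
qed

lemma mlin_lin_on:
  assumes "mlin A N V f V'" "lin_rels mk s V \<subseteq> rel A N V" "\<And>e. e \<in> S \<Longrightarrow> u @ [mk (Arr x y d e)] @ v \<in> V"
  shows "lin_on s S fscl (rel A N V') (\<lambda>e. f (u @ [mk (Arr x y d e)] @ v))"
proof -
  have "lin_on s S fscl (rel A N V') (\<lambda>e. ext f (wd (u @ [mk (Arr x y d e)] @ v)))"
    by (rule lin_on_lext_image[OF module_fscl lin_on_wd[OF assms(2,3)]])
       (use assms(1) in \<open>auto simp: mlin_def\<close>)
  then show ?thesis by simp
qed

section \<open>The cochain \<open>g\<^sub>\<alpha>(t)\<close>\<close>

text \<open>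
  Normalized Hochschild cochains of cohomological degree \<open>q\<close>, as functions of representatives in \<open>A\<close>
  of the arguments in \<open>A/k1\<close>.
\<close>

definition cochain :: "('k::comm_ring_1, 'o, 'a::ab_group_add) ainf \<Rightarrow> int \<Rightarrow> ('o, 'a) cochain \<Rightarrow> bool" where
  "cochain A q \<phi> \<longleftrightarrow>
    (\<forall>x y. \<forall>Y\<in>paths A x y. \<phi> x Y \<in> mor A x y (bdeg Y - q) \<and>
       ((\<exists>z. unit_arr A z \<in> set Y) \<longrightarrow> \<phi> x Y = 0)) \<and>
    (\<forall>x p q y d. \<forall>u\<in>paths A x p. \<forall>v\<in>paths A q y.
       lin_on (smul A) (mor A p q d) (smul A) {0} (\<lambda>e. \<phi> x (u @ Arr p q d e # v)))"

text \<open>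
  Decomposition of \<open>g\<^sub>\<alpha>\<close>. One drawing of the diagram corresponds to \<open>g_term\<close>, the part of it
  formed by the two vertices \<open>\<mu>\<close>, as a function of the outputs of \<open>\<alpha>\<close>, to \<open>g_outputs\<close>, and \<open>g_word\<close> is the sum over all drawings for a
  chain consisting of a single word.
\<close>

definition g_outputs :: "('k::comm_ring_1, 'o, 'a::ab_group_add) ainf \<Rightarrow> ('o, 'a) arr
    \<Rightarrow> ('o, 'a) arr list \<Rightarrow> ('o, 'a) arr list \<Rightarrow> ('o, 'a) arr list \<Rightarrow> ('o, 'a) arr list
    \<Rightarrow> ('o, 'a) arr list \<Rightarrow> ('o, 'a) arr list \<Rightarrow> ('o, 'a, 'm) word \<Rightarrow> 'a" where
  "g_outputs A a X1 X3 X4 Y1 Y3 Y4 = two (\<lambda>o1 o2.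
     smul A (koszul [1, 1, 1, 1, adeg o1, adeg o2, adeg a, bdeg X1, bdeg X3, bdeg X4,
                     bdeg Y1, bdeg Y3, bdeg Y4] [10, 3, 4, 8, 0, 9, 1, 6, 7, 2, 5, 11, 12])
     (mu A (Y1 @ [o1] @ X3 @ [mu_arr A (X4 @ [a] @ X1 @ [o2] @ Y3)] @ Y4)))"

definition g_term :: "('k::comm_ring_1, 'o, 'a::ab_group_add) ainf \<Rightarrow> int \<Rightarrow> ('k, 'o, 'a, 'm) vertex2
    \<Rightarrow> 'o \<Rightarrow> ('o, 'a) arr \<Rightarrow> ('o, 'a) arr list \<Rightarrow> ('o, 'a) arr list \<Rightarrow> ('o, 'a) arr list \<Rightarrow> ('o, 'a) arr list
    \<Rightarrow> ('o, 'a) arr list \<Rightarrow> ('o, 'a) arr list \<Rightarrow> ('o, 'a) arr list \<Rightarrow> ('o, 'a) arr list \<Rightarrow> 'a" where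
  "g_term A n \<alpha> x a X1 X2 X3 X4 Y1 Y2 Y3 Y4 =
     smul A (koszul [n, adeg a, bdeg X1, bdeg X2, bdeg X3, bdeg X4, bdeg Y1, bdeg Y2, bdeg Y3, bdeg Y4]
                    [0, 7, 3, 1, 2, 4, 5, 6, 8, 9])
     (lext (smul A) (g_outputs A a X1 X3 X4 Y1 Y3 Y4) (\<alpha> (pend x Y1) Y2 (pend (tgt a) X1) X2))"

definition g_word where
  "g_word A n \<alpha> x Y a X =
    (\<Sum>(X1, X2, X3, X4)\<in>cut4 X. \<Sum>(Y1, Y2, Y3, Y4)\<in>cut4 Y. g_term A n \<alpha> x a X1 X2 X3 X4 Y1 Y2 Y3 Y4)"

lemma tgt_last: "tgt (last (a # X)) = pend (tgt a) X"
  by (simp add: pend_def)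

lemma g_eq: "g A n \<alpha> t x Y = lext (smul A) (on_chain (g_word A n \<alpha> x Y)) t"
  unfolding g_def g_word_def g_term_def g_outputs_def tgt_last ..

locale ainf_cat =
  fixes A :: "('k::comm_ring_1, 'o, 'a::ab_group_add) ainf"
  assumes A: "ainf_category A"
begin

lemma module_A: "module (smul A)"
  and subspace_mor: "module.subspace (smul A) (mor A x y d)"
  using A unfolding ainf_category_def by simp_all

lemma zero_mor [simp]: "0 \<in> mor A x y d"
  by (rule module.subspace_0[OF module_A subspace_mor])

lemma subspace_zero: "module.subspace (smul A) {0}"
  by (rule module.subspace_single_0[OF module_A])

lemma mu_mor:
  assumes "as \<in> paths A x y" "as \<noteq> []"
  shows "mu A as \<in> mor A x y (bdeg as - 2)"
proof -
  have "\<forall>x y. \<forall>as\<in>paths A x y. as \<noteq> [] \<longrightarrow> mu A as \<in> mor A x y (bdeg as - 2)"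
    using A unfolding ainf_category_def by (elim conjE)
  with assms show ?thesis by blast
qed

lemma mu_arr_eq:
  assumes "as \<in> paths A x y" "as \<noteq> []"
  shows "mu_arr A as = Arr x y (bdeg as - 2) (mu A as)"
  using assms pend_eq[OF assms(1)] by (cases as) (auto simp: mu_arr_def pend_def)

text \<open>
  Composability of a list depends on the endpoints of its letters only, so it can be stated for the
  list with a zero morphism in the place of the variable letter. The same device is used for all
  lists with a variable letter below.
\<close>

lemma lin_on_mu:
  assumes "u @ Arr x y d 0 # v \<in> paths A p q"
  shows "lin_on (smul A) (mor A x y d) (smul A) {0} (\<lambda>e. mu A (u @ Arr x y d e # v))"
proof -
  have "\<forall>p x y q d c. \<forall>u\<in>paths A p x. \<forall>v\<in>paths A y q. \<forall>a\<in>mor A x y d. \<forall>b\<in>mor A x y d.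
        mu A (u @ [Arr x y d (smul A c a + b)] @ v)
          = smul A c (mu A (u @ [Arr x y d a] @ v)) + mu A (u @ [Arr x y d b] @ v)"
    using A unfolding ainf_category_def by (elim conjE)
  moreover have "u \<in> paths A p x" "v \<in> paths A y q" using assms by simp_all
  ultimately show ?thesis by (simp add: lin_on_def)
qed

lemma lin_on_mu_mu:
  assumes "L @ Arr x y d 0 # R \<in> paths A s t" "P \<in> paths A p s" "Q \<in> paths A t q"
  shows "lin_on (smul A) (mor A x y d) (smul A) {0} (\<lambda>e. mu A (P @ mu_arr A (L @ Arr x y d e # R) # Q))"
proof (rule lin_on_cong)
  let ?d = "bdeg L + d + 1 + bdeg R - 2"
  have path: "L @ Arr x y d e # R \<in> paths A s t" if "e \<in> mor A x y d" for e
    using assms(1) that by simp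
  show "mu A (P @ mu_arr A (L @ Arr x y d e # R) # Q) = mu A (P @ Arr s t ?d (mu A (L @ Arr x y d e # R)) # Q)"
    if "e \<in> mor A x y d" for e
    using mu_arr_eq[OF path[OF that]] by (simp add: algebra_simps)
  show "lin_on (smul A) (mor A x y d) (smul A) {0} (\<lambda>e. mu A (P @ Arr s t ?d (mu A (L @ Arr x y d e # R)) # Q))"
  proof (rule lin_on_compose[OF lin_on_mu[OF assms(1)]])
    show "mu A (L @ Arr x y d e # R) \<in> mor A s t ?d" if "e \<in> mor A x y d" for e
      using mu_mor[OF path[OF that]] by (simp add: algebra_simps)
    show "lin_on (smul A) (mor A s t ?d) (smul A) {0} (\<lambda>e. mu A (P @ Arr s t ?d e # Q))"
      by (rule lin_on_mu[where p = p and q = q]) (use assms(2,3) pend_eq[OF assms(2)] in simp)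
  qed
qed

lemma mu_zero_letter:
  assumes "u @ Arr x y d 0 # v \<in> paths A p q"
  shows "mu A (u @ Arr x y d 0 # v) = 0"
  using lin_on_zero[OF module_A module_A subspace_zero zero_mor lin_on_mu[OF assms]] by simp

text \<open>
  The only nonzero operation with a unit among its arguments is the product, which has two of them.
\<close>

lemma mu_unit:
  assumes "as \<in> paths A x y" "unit_arr A z \<in> set as" "length as \<ge> 3"
  shows "mu A as = 0"
proof -
  from assms(2) obtain u v where as: "as = u @ unit_arr A z # v" by (auto dest: split_list)
  have "\<forall>x y z. \<forall>u\<in>paths A x y. \<forall>v\<in>paths A y z.
        length u + length v \<ge> 2 \<longrightarrow> mu A (u @ [unit_arr A y] @ v) = 0"
    using A unfolding ainf_category_def by (elim conjE)
  moreover have "u \<in> paths A x z" "v \<in> paths A z y" "length u + length v \<ge> 2"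
    using assms(1,3) pend_eq[of u A x "pend x u"] as by (auto simp: unit_arr_def)
  ultimately show ?thesis by (simp add: as)
qed

end

locale ainf_cat_vertex2 = ainf_cat A for A :: "('k::comm_ring_1, 'o, 'a::ab_group_add) ainf" +
  fixes N :: "('k, 'o, 'a, 'm::ab_group_add) abim" and \<alpha> :: "('k, 'o, 'a, 'm) vertex2" and n :: int
  assumes \<alpha>: "\<alpha> \<in> C2 A N n"
begin

lemma alpha_free:
  assumes "P \<in> paths A p p'" "Q \<in> paths A q q'"
  shows "\<alpha> p P q Q \<in> free {w\<in>W2 A p q' q p'. wdeg w = bdeg P + bdeg Q - n}"
  using \<alpha> assms unfolding C2_def by blast

lemma alpha_mlin:
  assumes "P \<in> paths A p p'" "Q \<in> paths A q q'"
  shows "mlin A N (map Bar ` paths A p p') (\<lambda>u. \<alpha> p (arrs u) q Q) (W2 A p q' q p')"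
    "mlin A N (map Bar ` paths A q q') (\<lambda>u. \<alpha> p P q (arrs u)) (W2 A p q' q p')"
  using \<alpha> assms unfolding C2_def by blast+

lemma alpha_outputs:
  assumes "X1 @ X2 \<in> paths A x0 x2" "Y1 @ Y2 \<in> paths A y0 y2"
    and "w \<in> Poly_Mapping.keys (\<alpha> (pend y0 Y1) Y2 (pend x0 X1) X2)"
  obtains o1 o2 where "w = [Coef o1, Coef o2]" "o1 \<in> homs A (pend y0 Y1) x2"
    "o2 \<in> homs A (pend x0 X1) y2" "adeg o1 + adeg o2 = bdeg Y2 + bdeg X2 - n"
proof -
  have "w \<in> {w\<in>W2 A (pend y0 Y1) x2 (pend x0 X1) y2. wdeg w = bdeg Y2 + bdeg X2 - n}"
    using alpha_free[of Y2 "pend y0 Y1" y2 X2 "pend x0 X1" x2] assms by (auto simp: free_def)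
  then show thesis using that by (auto simp: W2_def)
qed

text \<open>
  The outputs of \<open>\<alpha>\<close> are elements of \<open>A \<otimes> A\<close>, given by representatives. The value of the diagram does
  not depend on these: the second output is an argument of the inner \<open>\<mu>\<close>, the first one is an argument
  of the outer \<open>\<mu>\<close>.
\<close>

lemma g_outputs_kills_rel:
  assumes "a \<in> homs A (src a) (tgt a)" "X1 \<in> paths A (tgt a) q" "X3 \<in> paths A q' r" "X4 \<in> paths A r (src a)"
    and "Y1 \<in> paths A x p" "Y3 \<in> paths A p' s" "Y4 \<in> paths A s y"
    and "t \<in> rel A N (W2 A p q' q p')"
  shows "lext (smul A) (g_outputs A a X1 X3 X4 Y1 Y3 Y4) t = 0"
proof -
  note pe = assms(2-7)[THEN pend_eq]
  have "lext (smul A) (g_outputs A a X1 X3 X4 Y1 Y3 Y4) t \<in> {0}"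
  proof (rule lext_rel_W2[OF module_A subspace_zero _ _ assms(8)])
    fix o2 d assume o2: "o2 \<in> homs A q p'"
    have path: "X4 @ a # X1 @ o2 # Y3 \<in> paths A r s"
      using assms(1-7) o2 pe by (simp add: homs_iff)
    have "lin_on (smul A) (mor A p q' d) (smul A) {0}
       (\<lambda>e. mu A (Y1 @ Arr p q' d e # X3 @ mu_arr A (X4 @ a # X1 @ o2 # Y3) # Y4))"
      by (rule lin_on_mu[where p = x and q = y])
         (use assms(1-7) o2 pe mu_arr_eq[OF path] mu_mor[OF path] in \<open>simp add: homs_iff\<close>)
    then show "lin_on (smul A) (mor A p q' d) (smul A) {0}
       (\<lambda>e. g_outputs A a X1 X3 X4 Y1 Y3 Y4 [Coef (Arr p q' d e), Coef o2])"
      by (simp add: g_outputs_def lin_on_scale[OF module_A subspace_zero])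
  next
    fix o1 d assume o1: "o1 \<in> homs A p q'"
    have "lin_on (smul A) (mor A q p' d) (smul A) {0}
       (\<lambda>e. mu A ((Y1 @ o1 # X3) @ mu_arr A ((X4 @ a # X1) @ Arr q p' d e # Y3) # Y4))"
      by (rule lin_on_mu_mu[where p = x and q = y and s = r and t = s])
         (use assms(1-7) o1 pe in \<open>simp_all add: homs_iff\<close>)
    then show "lin_on (smul A) (mor A q p' d) (smul A) {0}
       (\<lambda>e. g_outputs A a X1 X3 X4 Y1 Y3 Y4 [Coef o1, Coef (Arr q p' d e)])"
      by (simp add: g_outputs_def lin_on_scale[OF module_A subspace_zero])
  qed
  then show ?thesis by simp
qed

text \<open>
  Degrees: the two vertices \<open>\<mu>\<close> contribute \<open>-4\<close>, the suspensions of \<open>o1\<close>, \<open>o2\<close>, \<open>a\<close> and of the inner value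
  contribute \<open>4\<close>, and \<open>\<alpha>\<close> contributes \<open>-n\<close>.
\<close>

lemma g_term_mor:
  assumes "a \<in> homs A (src a) (tgt a)" "X1 @ X2 @ X3 @ X4 \<in> paths A (tgt a) (src a)"
    "Y1 @ Y2 @ Y3 @ Y4 \<in> paths A x y"
  shows "g_term A n \<alpha> x a X1 X2 X3 X4 Y1 Y2 Y3 Y4
    \<in> mor A x y (bdeg (Y1 @ Y2 @ Y3 @ Y4) - (n - (adeg a + bdeg (X1 @ X2 @ X3 @ X4))))"
  unfolding g_term_def
proof (intro module.subspace_scale[OF module_A subspace_mor] lext_in_subspace[OF module_A subspace_mor])
  let ?q' = "pend (tgt a) (X1 @ X2)" and ?p' = "pend x (Y1 @ Y2)"
  have X: "X1 @ X2 \<in> paths A (tgt a) ?q'"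
      and Y: "Y1 @ Y2 \<in> paths A x ?p'" using assms by simp_all
  fix w assume "w \<in> Poly_Mapping.keys (\<alpha> (pend x Y1) Y2 (pend (tgt a) X1) X2)"
  from alpha_outputs[OF X Y this] obtain o1 o2 where w: "w = [Coef o1, Coef o2]"
    and o: "o1 \<in> homs A (pend x Y1) ?q'" "o2 \<in> homs A (pend (tgt a) X1) ?p'"
      "adeg o1 + adeg o2 = bdeg Y2 + bdeg X2 - n" .
  note pe = pend_eq[OF assms(2), simplified] pend_eq[OF assms(3), simplified]
  have path: "X4 @ a # X1 @ o2 # Y3 \<in> paths A (pend ?q' X3) (pend ?p' Y3)"
    using assms o pe by (simp add: homs_iff)
  have P: "Y1 @ o1 # X3 @ mu_arr A (X4 @ a # X1 @ o2 # Y3) # Y4 \<in> paths A x y"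
    using assms o pe mu_arr_eq[OF path] mu_mor[OF path] by (simp add: homs_iff)
  have D: "bdeg (Y1 @ o1 # X3 @ mu_arr A (X4 @ a # X1 @ o2 # Y3) # Y4) - 2
      = bdeg (Y1 @ Y2 @ Y3 @ Y4) - (n - (adeg a + bdeg (X1 @ X2 @ X3 @ X4)))"
    using o(3) by (simp add: mu_arr_eq[OF path])
  from mu_mor[OF P] have "mu A (Y1 @ o1 # X3 @ mu_arr A (X4 @ a # X1 @ o2 # Y3) # Y4)
    \<in> mor A x y (bdeg (Y1 @ Y2 @ Y3 @ Y4) - (n - (adeg a + bdeg (X1 @ X2 @ X3 @ X4))))"
    unfolding D by simp
  then show "g_outputs A a X1 X3 X4 Y1 Y3 Y4 w
    \<in> mor A x y (bdeg (Y1 @ Y2 @ Y3 @ Y4) - (n - (adeg a + bdeg (X1 @ X2 @ X3 @ X4))))"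
    by (simp add: w g_outputs_def module.subspace_scale[OF module_A subspace_mor])
qed

text \<open>
  An argument \<open>1\<close> is killed by the vertex that it reaches: \<open>\<alpha>\<close> is normalized, the inner \<open>\<mu>\<close> has the
  further arguments \<open>a\<close> and \<open>o2\<close>, and the outer \<open>\<mu>\<close> has the first output of \<open>\<alpha>\<close> and the value of the inner
  \<open>\<mu>\<close> as further arguments. So none of these is a product with a unit.
\<close>

lemma g_term_unit:
  assumes "a \<in> homs A (src a) (tgt a)" "X1 @ X2 @ X3 @ X4 \<in> paths A (tgt a) (src a)"
    "Y1 @ Y2 @ Y3 @ Y4 \<in> paths A x y"
    and unit: "unit_arr A z \<in> set (X1 @ X2 @ X3 @ X4 @ Y1 @ Y2 @ Y3 @ Y4)"
  shows "g_term A n \<alpha> x a X1 X2 X3 X4 Y1 Y2 Y3 Y4 = 0"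
proof -
  let ?q = "pend (tgt a) X1" and ?q' = "pend (tgt a) (X1 @ X2)"
  let ?p = "pend x Y1" and ?p' = "pend x (Y1 @ Y2)"
  note pe = pend_eq[OF assms(2), simplified] pend_eq[OF assms(3), simplified]
  have "lext (smul A) (g_outputs A a X1 X3 X4 Y1 Y3 Y4) (\<alpha> ?p Y2 ?q X2) = 0"
  proof (cases "unit_arr A z \<in> set X2 \<union> set Y2")
    case True
    have unit_rel: "wd (map Bar B) \<in> rel A N (map Bar ` paths A v w)"
      if "B \<in> paths A v w" "unit_arr A z \<in> set B" for B v w
    proof -
      from that(2) obtain u u' where B: "B = u @ unit_arr A z # u'" by (auto dest: split_list)
      have "map Bar u @ [Bar (unit_arr A z)] @ map Bar u' \<in> map Bar ` paths A v w"
        using that(1) B by (intro image_eqI[of _ _ B]) simp_all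
      from rel_generators(4)[OF this, of N] show ?thesis by (simp add: B)
    qed
    have X2: "X2 \<in> paths A ?q ?q'"
    and Y2: "Y2 \<in> paths A ?p ?p'" using assms by simp_all
    have "\<alpha> ?p Y2 ?q X2 \<in> rel A N (W2 A ?p ?q' ?q ?p')"
    proof (cases "unit_arr A z \<in> set X2")
      case True
      from bspec[OF alpha_mlin(2)[OF Y2 X2, unfolded mlin_def] unit_rel[OF X2 this]]
      show ?thesis by simp
    next
      case False
      with True have "unit_arr A z \<in> set Y2" by simp
      from bspec[OF alpha_mlin(1)[OF Y2 X2, unfolded mlin_def] unit_rel[OF Y2 this]]
      show ?thesis by simp
    qed
    then show ?thesis
      by (rule g_outputs_kills_rel[rotated 7, where x = x and y = y and r = "pend ?q' X3" and s = "pend ?p' Y3"])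
         (use assms pe in simp_all)
  next
    case False
    have "lext (smul A) (g_outputs A a X1 X3 X4 Y1 Y3 Y4) (\<alpha> ?p Y2 ?q X2) \<in> {0}"
    proof (rule lext_in_subspace[OF module_A subspace_zero])
      have X: "X1 @ X2 \<in> paths A (tgt a) ?q'"
      and Y: "Y1 @ Y2 \<in> paths A x ?p'" using assms by simp_all
      fix w assume "w \<in> Poly_Mapping.keys (\<alpha> (pend x Y1) Y2 (pend (tgt a) X1) X2)"
      from alpha_outputs[OF X Y this] obtain o1 o2 where w: "w = [Coef o1, Coef o2]"
        and o: "o1 \<in> homs A ?p ?q'" "o2 \<in> homs A ?q ?p'"
          "adeg o1 + adeg o2 = bdeg Y2 + bdeg X2 - n" .
      let ?I = "X4 @ a # X1 @ o2 # Y3" and ?O = "\<lambda>m. Y1 @ o1 # X3 @ m # Y4"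
      have I: "?I \<in> paths A (pend ?q' X3) (pend ?p' Y3)"
        using assms o pe by (simp add: homs_iff)
      have O: "?O (mu_arr A ?I) \<in> paths A x y"
        using assms o pe mu_arr_eq[OF I] mu_mor[OF I] by (simp add: homs_iff)
      have "mu A (?O (mu_arr A ?I)) = 0"
      proof (cases "unit_arr A z \<in> set X1 \<union> set X4 \<union> set Y3")
        case True
        then have "unit_arr A z \<in> set ?I" by auto
        moreover from True have "length ?I \<ge> 3" by (auto simp: Suc_le_eq dest: length_pos_if_in_set)
        ultimately have "mu A ?I = 0" using mu_unit[OF I] by blast
        then show ?thesis
          using mu_zero_letter[of "Y1 @ o1 # X3" _ _ _ Y4 x y] O mu_arr_eq[OF I] by simp
      next
        case False
        with unit \<open>unit_arr A z \<notin> set X2 \<union> set Y2\<close>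
        have "unit_arr A z \<in> set Y1 \<union> set X3 \<union> set Y4" by auto
        moreover from this have "length (?O (mu_arr A ?I)) \<ge> 3"
          by (auto simp: Suc_le_eq dest: length_pos_if_in_set)
        ultimately show ?thesis using mu_unit[OF O] by auto
      qed
      then show "g_outputs A a X1 X3 X4 Y1 Y3 Y4 w \<in> {0}"
        by (simp add: w g_outputs_def module.scale_zero_right[OF module_A])
    qed
    then show ?thesis by simp
  qed
  then show ?thesis by (simp add: g_term_def module.scale_zero_right[OF module_A])
qed

text \<open>
  Linearity of a drawing in each letter. The coefficient \<open>a\<close> and the letters of \<open>X1\<close>, \<open>X4\<close>, \<open>Y3\<close> reach the inner
  \<open>\<mu>\<close>, those of \<open>X3\<close>, \<open>Y1\<close>, \<open>Y4\<close> the outer one. The letters of \<open>X2\<close> and \<open>Y2\<close> reach \<open>\<alpha>\<close>, which is linear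
  only modulo relations, so that these two cases rest on \<open>g_outputs_kills_rel\<close>.
\<close>

lemma g_term_linear_a:
  assumes "X1 @ X2 @ X3 @ X4 \<in> paths A c b" "Y1 @ Y2 @ Y3 @ Y4 \<in> paths A x y"
  shows "lin_on (smul A) (mor A b c d) (smul A) {0}
    (\<lambda>e. g_term A n \<alpha> x (Arr b c d e) X1 X2 X3 X4 Y1 Y2 Y3 Y4)"
proof -
  note pe = pend_eq[OF assms(1), simplified] pend_eq[OF assms(2), simplified]
  have "lin_on (smul A) (mor A b c d) (smul A) {0} (\<lambda>e. g_outputs A (Arr b c d e) X1 X3 X4 Y1 Y3 Y4 w)"
    if w: "w \<in> Poly_Mapping.keys (\<alpha> (pend x Y1) Y2 (pend c X1) X2)" for w
  proof -
    have X: "X1 @ X2 \<in> paths A c (pend c (X1 @ X2))"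
      and Y: "Y1 @ Y2 \<in> paths A x (pend x (Y1 @ Y2))"
      using assms pe by simp_all
    from alpha_outputs[OF X Y w] obtain o1 o2 where w: "w = [Coef o1, Coef o2]"
      and o: "o1 \<in> homs A (pend x Y1) (pend c (X1 @ X2))" "o2 \<in> homs A (pend c X1) (pend x (Y1 @ Y2))"
      "adeg o1 + adeg o2 = bdeg Y2 + bdeg X2 - n" .
    have "lin_on (smul A) (mor A b c d) (smul A) {0}
        (\<lambda>e. mu A ((Y1 @ o1 # X3) @ mu_arr A (X4 @ Arr b c d e # X1 @ o2 # Y3) # Y4))"
      by (rule lin_on_mu_mu[where p = x and q = y and s = "pend c (X1 @ X2 @ X3)" and t = "pend x (Y1 @ Y2 @ Y3)"])
         (use assms o pe in \<open>simp_all add: homs_iff\<close>)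
    then show ?thesis
      by (simp add: w g_outputs_def lin_on_scale[OF module_A subspace_zero])
  qed
  then show ?thesis
    by (simp add: g_term_def lin_on_scale[OF module_A subspace_zero] lin_on_lext[OF module_A subspace_zero])
qed

lemma g_term_linear_X1:
  assumes "a \<in> homs A (src a) (tgt a)" "u \<in> paths A (tgt a) b"
    "v @ X2 @ X3 @ X4 \<in> paths A c (src a)" "Y1 @ Y2 @ Y3 @ Y4 \<in> paths A x y"
  shows "lin_on (smul A) (mor A b c d) (smul A) {0}
    (\<lambda>e. g_term A n \<alpha> x a (u @ Arr b c d e # v) X2 X3 X4 Y1 Y2 Y3 Y4)"
proof -
  note pe = pend_eq[OF assms(2), simplified] pend_eq[OF assms(3), simplified] pend_eq[OF assms(4), simplified]
  have "lin_on (smul A) (mor A b c d) (smul A) {0} (\<lambda>e. g_outputs A a (u @ Arr b c d e # v) X3 X4 Y1 Y3 Y4 w)"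
    if w: "w \<in> Poly_Mapping.keys (\<alpha> (pend x Y1) Y2 (pend (tgt a) (u @ Arr b c d 0 # v)) X2)" for w
  proof -
    have X: "(u @ Arr b c d 0 # v) @ X2 \<in> paths A (tgt a) (pend (tgt a) ((u @ Arr b c d 0 # v) @ X2))"
      and Y: "Y1 @ Y2 \<in> paths A x (pend x (Y1 @ Y2))"
      using assms pe by simp_all
    from alpha_outputs[OF X Y w] obtain o1 o2 where w: "w = [Coef o1, Coef o2]"
      and o: "o1 \<in> homs A (pend x Y1) (pend (tgt a) ((u @ Arr b c d 0 # v) @ X2))"
        "o2 \<in> homs A (pend (tgt a) (u @ Arr b c d 0 # v)) (pend x (Y1 @ Y2))"
      "adeg o1 + adeg o2 = bdeg Y2 + bdeg X2 - n" .
    have "lin_on (smul A) (mor A b c d) (smul A) {0}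
        (\<lambda>e. mu A ((Y1 @ o1 # X3) @ mu_arr A ((X4 @ a # u) @ Arr b c d e # v @ o2 # Y3) # Y4))"
      by (rule lin_on_mu_mu[where p = x and q = y and s = "pend (tgt a) (u @ Arr b c d 0 # v @ X2 @ X3)" and t = "pend x (Y1 @ Y2 @ Y3)"])
         (use assms o pe in \<open>simp_all add: homs_iff\<close>)
    then show ?thesis
      by (simp add: w g_outputs_def lin_on_scale[OF module_A subspace_zero])
  qed
  then show ?thesis
    by (simp add: g_term_def lin_on_scale[OF module_A subspace_zero] lin_on_lext[OF module_A subspace_zero])
qed

lemma g_term_linear_X2:
  assumes "a \<in> homs A (src a) (tgt a)" "X1 @ u \<in> paths A (tgt a) b"
    "v @ X3 @ X4 \<in> paths A c (src a)" "Y1 @ Y2 @ Y3 @ Y4 \<in> paths A x y"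
  shows "lin_on (smul A) (mor A b c d) (smul A) {0}
    (\<lambda>e. g_term A n \<alpha> x a X1 (u @ Arr b c d e # v) X3 X4 Y1 Y2 Y3 Y4)"
proof -
  note pe = pend_eq[OF assms(2), simplified] pend_eq[OF assms(3), simplified] pend_eq[OF assms(4), simplified]
  have X2: "u @ Arr b c d 0 # v \<in> paths A (pend (tgt a) X1) (pend (tgt a) (X1 @ u @ Arr b c d 0 # v))"
    and Y2: "Y2 \<in> paths A (pend x Y1) (pend x (Y1 @ Y2))"
    using assms pe by simp_all
  have "lin_on (smul A) (mor A b c d) fscl (rel A N (W2 A (pend x Y1) (pend (tgt a) (X1 @ u @ Arr b c d 0 # v)) (pend (tgt a) X1) (pend x (Y1 @ Y2))))
    (\<lambda>e. \<alpha> (pend x Y1) Y2 (pend (tgt a) X1) (u @ Arr b c d e # v))"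
  proof -
    have "map Bar u @ [Bar (Arr b c d e)] @ map Bar v \<in> map Bar ` paths A (pend (tgt a) X1) (pend (tgt a) (X1 @ u @ Arr b c d 0 # v))"
      if "e \<in> mor A b c d" for e
      using X2 that by (intro image_eqI[of _ _ "u @ Arr b c d e # v"]) simp_all
    from mlin_lin_on[where S = "mor A b c d", OF alpha_mlin(2)[OF Y2 X2] rel_generators(2) this]
    show ?thesis by simp
  qed
  from lin_on_lext_image[OF module_A this, of "g_outputs A a X1 X3 X4 Y1 Y3 Y4" "{0}"]
  have "lin_on (smul A) (mor A b c d) (smul A) {0}
    (\<lambda>e. lext (smul A) (g_outputs A a X1 X3 X4 Y1 Y3 Y4) (\<alpha> (pend x Y1) Y2 (pend (tgt a) X1) (u @ Arr b c d e # v)))"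
    using g_outputs_kills_rel[of a X1 "pend (tgt a) X1" X3 "pend (tgt a) (X1 @ u @ Arr b c d 0 # v)"
      "pend (tgt a) (X1 @ u @ Arr b c d 0 # v @ X3)" X4 Y1 x "pend x Y1" Y3 "pend x (Y1 @ Y2)"
      "pend x (Y1 @ Y2 @ Y3)" Y4 y] assms pe
    by simp
  then show ?thesis
    by (simp add: g_term_def lin_on_scale[OF module_A subspace_zero])
qed

lemma g_term_linear_X3:
  assumes "a \<in> homs A (src a) (tgt a)" "X1 @ X2 @ u \<in> paths A (tgt a) b"
    "v @ X4 \<in> paths A c (src a)" "Y1 @ Y2 @ Y3 @ Y4 \<in> paths A x y"
  shows "lin_on (smul A) (mor A b c d) (smul A) {0}
    (\<lambda>e. g_term A n \<alpha> x a X1 X2 (u @ Arr b c d e # v) X4 Y1 Y2 Y3 Y4)"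
proof -
  note pe = pend_eq[OF assms(2), simplified] pend_eq[OF assms(3), simplified] pend_eq[OF assms(4), simplified]
  have "lin_on (smul A) (mor A b c d) (smul A) {0} (\<lambda>e. g_outputs A a X1 (u @ Arr b c d e # v) X4 Y1 Y3 Y4 w)"
    if w: "w \<in> Poly_Mapping.keys (\<alpha> (pend x Y1) Y2 (pend (tgt a) X1) X2)" for w
  proof -
    have X: "X1 @ X2 \<in> paths A (tgt a) (pend (tgt a) (X1 @ X2))"
      and Y: "Y1 @ Y2 \<in> paths A x (pend x (Y1 @ Y2))"
      using assms pe by simp_all
    from alpha_outputs[OF X Y w] obtain o1 o2 where w: "w = [Coef o1, Coef o2]"
      and o: "o1 \<in> homs A (pend x Y1) (pend (tgt a) (X1 @ X2))"
        "o2 \<in> homs A (pend (tgt a) X1) (pend x (Y1 @ Y2))"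
      "adeg o1 + adeg o2 = bdeg Y2 + bdeg X2 - n" .
    have path: "X4 @ a # X1 @ o2 # Y3 \<in> paths A (pend (tgt a) (X1 @ X2 @ u @ Arr b c d 0 # v)) (pend x (Y1 @ Y2 @ Y3))"
      using assms o pe by (simp add: homs_iff)
    have "lin_on (smul A) (mor A b c d) (smul A) {0} (\<lambda>e. mu A ((Y1 @ o1 # u) @ Arr b c d e # v @ mu_arr A (X4 @ a # X1 @ o2 # Y3) # Y4))"
      by (rule lin_on_mu[where p = x and q = y])
         (use assms o pe mu_arr_eq[OF path] mu_mor[OF path] in \<open>simp add: homs_iff\<close>)
    then show ?thesis
      by (simp add: w g_outputs_def lin_on_scale[OF module_A subspace_zero])
  qed
  then show ?thesis
    by (simp add: g_term_def lin_on_scale[OF module_A subspace_zero] lin_on_lext[OF module_A subspace_zero])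
qed

lemma g_term_linear_X4:
  assumes "a \<in> homs A (src a) (tgt a)" "X1 @ X2 @ X3 @ u \<in> paths A (tgt a) b"
    "v \<in> paths A c (src a)" "Y1 @ Y2 @ Y3 @ Y4 \<in> paths A x y"
  shows "lin_on (smul A) (mor A b c d) (smul A) {0}
    (\<lambda>e. g_term A n \<alpha> x a X1 X2 X3 (u @ Arr b c d e # v) Y1 Y2 Y3 Y4)"
proof -
  note pe = pend_eq[OF assms(2), simplified] pend_eq[OF assms(3), simplified] pend_eq[OF assms(4), simplified]
  have "lin_on (smul A) (mor A b c d) (smul A) {0} (\<lambda>e. g_outputs A a X1 X3 (u @ Arr b c d e # v) Y1 Y3 Y4 w)"
    if w: "w \<in> Poly_Mapping.keys (\<alpha> (pend x Y1) Y2 (pend (tgt a) X1) X2)" for w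
  proof -
    have X: "X1 @ X2 \<in> paths A (tgt a) (pend (tgt a) (X1 @ X2))"
      and Y: "Y1 @ Y2 \<in> paths A x (pend x (Y1 @ Y2))"
      using assms pe by simp_all
    from alpha_outputs[OF X Y w] obtain o1 o2 where w: "w = [Coef o1, Coef o2]"
      and o: "o1 \<in> homs A (pend x Y1) (pend (tgt a) (X1 @ X2))"
        "o2 \<in> homs A (pend (tgt a) X1) (pend x (Y1 @ Y2))"
      "adeg o1 + adeg o2 = bdeg Y2 + bdeg X2 - n" .
    have "lin_on (smul A) (mor A b c d) (smul A) {0}
        (\<lambda>e. mu A ((Y1 @ o1 # X3) @ mu_arr A (u @ Arr b c d e # v @ a # X1 @ o2 # Y3) # Y4))"
      by (rule lin_on_mu_mu[where p = x and q = y and s = "pend (tgt a) (X1 @ X2 @ X3)" and t = "pend x (Y1 @ Y2 @ Y3)"])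
         (use assms o pe in \<open>simp_all add: homs_iff\<close>)
    then show ?thesis
      by (simp add: w g_outputs_def lin_on_scale[OF module_A subspace_zero])
  qed
  then show ?thesis
    by (simp add: g_term_def lin_on_scale[OF module_A subspace_zero] lin_on_lext[OF module_A subspace_zero])
qed

lemma g_term_linear_Y1:
  assumes "a \<in> homs A (src a) (tgt a)" "X1 @ X2 @ X3 @ X4 \<in> paths A (tgt a) (src a)"
    "u \<in> paths A x b" "v @ Y2 @ Y3 @ Y4 \<in> paths A c y"
  shows "lin_on (smul A) (mor A b c d) (smul A) {0}
    (\<lambda>e. g_term A n \<alpha> x a X1 X2 X3 X4 (u @ Arr b c d e # v) Y2 Y3 Y4)"
proof -
  note pe = pend_eq[OF assms(2), simplified] pend_eq[OF assms(3), simplified] pend_eq[OF assms(4), simplified]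
  have "lin_on (smul A) (mor A b c d) (smul A) {0} (\<lambda>e. g_outputs A a X1 X3 X4 (u @ Arr b c d e # v) Y3 Y4 w)"
    if w: "w \<in> Poly_Mapping.keys (\<alpha> (pend x (u @ Arr b c d 0 # v)) Y2 (pend (tgt a) X1) X2)" for w
  proof -
    have X: "X1 @ X2 \<in> paths A (tgt a) (pend (tgt a) (X1 @ X2))"
      and Y: "(u @ Arr b c d 0 # v) @ Y2 \<in> paths A x (pend x ((u @ Arr b c d 0 # v) @ Y2))"
      using assms pe by simp_all
    from alpha_outputs[OF X Y w] obtain o1 o2 where w: "w = [Coef o1, Coef o2]"
      and o: "o1 \<in> homs A (pend x (u @ Arr b c d 0 # v)) (pend (tgt a) (X1 @ X2))"
        "o2 \<in> homs A (pend (tgt a) X1) (pend x ((u @ Arr b c d 0 # v) @ Y2))"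
      "adeg o1 + adeg o2 = bdeg Y2 + bdeg X2 - n" .
    have path: "X4 @ a # X1 @ o2 # Y3 \<in> paths A (pend (tgt a) (X1 @ X2 @ X3)) (pend x (u @ Arr b c d 0 # v @ Y2 @ Y3))"
      using assms o pe by (simp add: homs_iff)
    have "lin_on (smul A) (mor A b c d) (smul A) {0} (\<lambda>e. mu A (u @ Arr b c d e # v @ o1 # X3 @ mu_arr A (X4 @ a # X1 @ o2 # Y3) # Y4))"
      by (rule lin_on_mu[where p = x and q = y])
         (use assms o pe mu_arr_eq[OF path] mu_mor[OF path] in \<open>simp add: homs_iff\<close>)
    then show ?thesis
      by (simp add: w g_outputs_def lin_on_scale[OF module_A subspace_zero])
  qed
  then show ?thesis
    by (simp add: g_term_def lin_on_scale[OF module_A subspace_zero] lin_on_lext[OF module_A subspace_zero])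
qed

lemma g_term_linear_Y2:
  assumes "a \<in> homs A (src a) (tgt a)" "X1 @ X2 @ X3 @ X4 \<in> paths A (tgt a) (src a)"
    "Y1 @ u \<in> paths A x b" "v @ Y3 @ Y4 \<in> paths A c y"
  shows "lin_on (smul A) (mor A b c d) (smul A) {0}
    (\<lambda>e. g_term A n \<alpha> x a X1 X2 X3 X4 Y1 (u @ Arr b c d e # v) Y3 Y4)"
proof -
  note pe = pend_eq[OF assms(2), simplified] pend_eq[OF assms(3), simplified] pend_eq[OF assms(4), simplified]
  have X2: "X2 \<in> paths A (pend (tgt a) X1) (pend (tgt a) (X1 @ X2))"
    and Y2: "u @ Arr b c d 0 # v \<in> paths A (pend x Y1) (pend x (Y1 @ u @ Arr b c d 0 # v))"
    using assms pe by simp_all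
  have "lin_on (smul A) (mor A b c d) fscl (rel A N (W2 A (pend x Y1) (pend (tgt a) (X1 @ X2)) (pend (tgt a) X1) (pend x (Y1 @ u @ Arr b c d 0 # v))))
    (\<lambda>e. \<alpha> (pend x Y1) (u @ Arr b c d e # v) (pend (tgt a) X1) X2)"
  proof -
    have "map Bar u @ [Bar (Arr b c d e)] @ map Bar v \<in> map Bar ` paths A (pend x Y1) (pend x (Y1 @ u @ Arr b c d 0 # v))"
      if "e \<in> mor A b c d" for e
      using Y2 that by (intro image_eqI[of _ _ "u @ Arr b c d e # v"]) simp_all
    from mlin_lin_on[where S = "mor A b c d", OF alpha_mlin(1)[OF Y2 X2] rel_generators(2) this]
    show ?thesis by simp
  qed
  from lin_on_lext_image[OF module_A this, of "g_outputs A a X1 X3 X4 Y1 Y3 Y4" "{0}"]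
  have "lin_on (smul A) (mor A b c d) (smul A) {0}
    (\<lambda>e. lext (smul A) (g_outputs A a X1 X3 X4 Y1 Y3 Y4) (\<alpha> (pend x Y1) (u @ Arr b c d e # v) (pend (tgt a) X1) X2))"
    using g_outputs_kills_rel[of a X1 "pend (tgt a) X1" X3 "pend (tgt a) (X1 @ X2)"
      "pend (tgt a) (X1 @ X2 @ X3)" X4 Y1 x "pend x Y1" Y3 "pend x (Y1 @ u @ Arr b c d 0 # v)"
      "pend x (Y1 @ u @ Arr b c d 0 # v @ Y3)" Y4 y] assms pe
    by simp
  then show ?thesis
    by (simp add: g_term_def lin_on_scale[OF module_A subspace_zero])
qed

lemma g_term_linear_Y3:
  assumes "a \<in> homs A (src a) (tgt a)" "X1 @ X2 @ X3 @ X4 \<in> paths A (tgt a) (src a)"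
    "Y1 @ Y2 @ u \<in> paths A x b" "v @ Y4 \<in> paths A c y"
  shows "lin_on (smul A) (mor A b c d) (smul A) {0}
    (\<lambda>e. g_term A n \<alpha> x a X1 X2 X3 X4 Y1 Y2 (u @ Arr b c d e # v) Y4)"
proof -
  note pe = pend_eq[OF assms(2), simplified] pend_eq[OF assms(3), simplified] pend_eq[OF assms(4), simplified]
  have "lin_on (smul A) (mor A b c d) (smul A) {0} (\<lambda>e. g_outputs A a X1 X3 X4 Y1 (u @ Arr b c d e # v) Y4 w)"
    if w: "w \<in> Poly_Mapping.keys (\<alpha> (pend x Y1) Y2 (pend (tgt a) X1) X2)" for w
  proof -
    have X: "X1 @ X2 \<in> paths A (tgt a) (pend (tgt a) (X1 @ X2))"
      and Y: "Y1 @ Y2 \<in> paths A x (pend x (Y1 @ Y2))"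
      using assms pe by simp_all
    from alpha_outputs[OF X Y w] obtain o1 o2 where w: "w = [Coef o1, Coef o2]"
      and o: "o1 \<in> homs A (pend x Y1) (pend (tgt a) (X1 @ X2))"
        "o2 \<in> homs A (pend (tgt a) X1) (pend x (Y1 @ Y2))"
      "adeg o1 + adeg o2 = bdeg Y2 + bdeg X2 - n" .
    have "lin_on (smul A) (mor A b c d) (smul A) {0}
        (\<lambda>e. mu A ((Y1 @ o1 # X3) @ mu_arr A ((X4 @ a # X1 @ o2 # u) @ Arr b c d e # v) # Y4))"
      by (rule lin_on_mu_mu[where p = x and q = y and s = "pend (tgt a) (X1 @ X2 @ X3)" and t = "pend x (Y1 @ Y2 @ u @ Arr b c d 0 # v)"])
         (use assms o pe in \<open>simp_all add: homs_iff\<close>)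
    then show ?thesis
      by (simp add: w g_outputs_def lin_on_scale[OF module_A subspace_zero])
  qed
  then show ?thesis
    by (simp add: g_term_def lin_on_scale[OF module_A subspace_zero] lin_on_lext[OF module_A subspace_zero])
qed

lemma g_term_linear_Y4:
  assumes "a \<in> homs A (src a) (tgt a)" "X1 @ X2 @ X3 @ X4 \<in> paths A (tgt a) (src a)"
    "Y1 @ Y2 @ Y3 @ u \<in> paths A x b" "v \<in> paths A c y"
  shows "lin_on (smul A) (mor A b c d) (smul A) {0}
    (\<lambda>e. g_term A n \<alpha> x a X1 X2 X3 X4 Y1 Y2 Y3 (u @ Arr b c d e # v))"
proof -
  note pe = pend_eq[OF assms(2), simplified] pend_eq[OF assms(3), simplified] pend_eq[OF assms(4), simplified]
  have "lin_on (smul A) (mor A b c d) (smul A) {0} (\<lambda>e. g_outputs A a X1 X3 X4 Y1 Y3 (u @ Arr b c d e # v) w)"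
    if w: "w \<in> Poly_Mapping.keys (\<alpha> (pend x Y1) Y2 (pend (tgt a) X1) X2)" for w
  proof -
    have X: "X1 @ X2 \<in> paths A (tgt a) (pend (tgt a) (X1 @ X2))"
      and Y: "Y1 @ Y2 \<in> paths A x (pend x (Y1 @ Y2))"
      using assms pe by simp_all
    from alpha_outputs[OF X Y w] obtain o1 o2 where w: "w = [Coef o1, Coef o2]"
      and o: "o1 \<in> homs A (pend x Y1) (pend (tgt a) (X1 @ X2))"
        "o2 \<in> homs A (pend (tgt a) X1) (pend x (Y1 @ Y2))"
      "adeg o1 + adeg o2 = bdeg Y2 + bdeg X2 - n" .
    have path: "X4 @ a # X1 @ o2 # Y3 \<in> paths A (pend (tgt a) (X1 @ X2 @ X3)) (pend x (Y1 @ Y2 @ Y3))"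
      using assms o pe by (simp add: homs_iff)
    have "lin_on (smul A) (mor A b c d) (smul A) {0} (\<lambda>e. mu A ((Y1 @ o1 # X3 @ mu_arr A (X4 @ a # X1 @ o2 # Y3) # u) @ Arr b c d e # v))"
      by (rule lin_on_mu[where p = x and q = y])
         (use assms o pe mu_arr_eq[OF path] mu_mor[OF path] in \<open>simp add: homs_iff\<close>)
    then show ?thesis
      by (simp add: w g_outputs_def lin_on_scale[OF module_A subspace_zero])
  qed
  then show ?thesis
    by (simp add: g_term_def lin_on_scale[OF module_A subspace_zero] lin_on_lext[OF module_A subspace_zero])
qed

lemma g_word_mor:
  assumes "a \<in> homs A (src a) (tgt a)" "X \<in> paths A (tgt a) (src a)" "Y \<in> paths A x y"
  shows "g_word A n \<alpha> x Y a X \<in> mor A x y (bdeg Y - (n - (adeg a + bdeg X)))"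
  unfolding g_word_def
proof (intro module.subspace_sum[OF module_A subspace_mor], clarify, intro module.subspace_sum[OF module_A subspace_mor], clarify)
  fix X1 X2 X3 X4 Y1 Y2 Y3 Y4
  assume "(X1, X2, X3, X4) \<in> cut4 X" "(Y1, Y2, Y3, Y4) \<in> cut4 Y"
  then have X: "X = X1 @ X2 @ X3 @ X4" and Y: "Y = Y1 @ Y2 @ Y3 @ Y4" by (auto simp: cut4_def)
  show "g_term A n \<alpha> x a X1 X2 X3 X4 Y1 Y2 Y3 Y4 \<in> mor A x y (bdeg Y - (n - (adeg a + bdeg X)))"
    by (rule g_term_mor[of a X1 X2 X3 X4 Y1 Y2 Y3 Y4 x y, folded X Y, OF assms])
qed

lemma g_word_unit:
  assumes "a \<in> homs A (src a) (tgt a)" "X \<in> paths A (tgt a) (src a)" "Y \<in> paths A x y"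
    "unit_arr A z \<in> set X \<union> set Y"
  shows "g_word A n \<alpha> x Y a X = 0"
  unfolding g_word_def
proof (intro sum.neutral ballI, clarify, intro sum.neutral ballI, clarify)
  fix X1 X2 X3 X4 Y1 Y2 Y3 Y4
  assume "(X1, X2, X3, X4) \<in> cut4 X" "(Y1, Y2, Y3, Y4) \<in> cut4 Y"
  then have "X = X1 @ X2 @ X3 @ X4" "Y = Y1 @ Y2 @ Y3 @ Y4" by (auto simp: cut4_def)
  with g_term_unit[of a X1 X2 X3 X4 Y1 Y2 Y3 Y4 x y z] assms
  show "g_term A n \<alpha> x a X1 X2 X3 X4 Y1 Y2 Y3 Y4 = 0" by simp
qed

lemma g_word_linear_Y:
  assumes "a \<in> homs A (src a) (tgt a)" "X \<in> paths A (tgt a) (src a)" "u \<in> paths A x b" "v \<in> paths A c y"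
  shows "lin_on (smul A) (mor A b c d) (smul A) {0} (\<lambda>e. g_word A n \<alpha> x (u @ Arr b c d e # v) a X)"
  unfolding g_word_def
proof (rule lin_on_sum[OF module_A subspace_zero], clarify)
  fix X1 X2 X3 X4 assume "(X1, X2, X3, X4) \<in> cut4 X"
  with assms(2) have X: "X1 @ X2 @ X3 @ X4 \<in> paths A (tgt a) (src a)" by (simp add: cut4_def)
  show "lin_on (smul A) (mor A b c d) (smul A) {0} (\<lambda>e. \<Sum>(Y1, Y2, Y3, Y4)\<in>cut4 (u @ Arr b c d e # v).
      g_term A n \<alpha> x a X1 X2 X3 X4 Y1 Y2 Y3 Y4)"
  proof (rule lin_on_cut4[OF module_A subspace_zero])
    show "lin_on (smul A) (mor A b c d) (smul A) {0} (\<lambda>e. g_term A n \<alpha> x a X1 X2 X3 X4 Y1 Y2 Y3 (u' @ Arr b c d e # v))"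
      if "Y1 @ Y2 @ Y3 @ u' = u" for Y1 Y2 Y3 u'
      by (rule g_term_linear_Y4[OF assms(1) X]) (use assms(3,4) that in \<open>simp_all only:\<close>)
    show "lin_on (smul A) (mor A b c d) (smul A) {0} (\<lambda>e. g_term A n \<alpha> x a X1 X2 X3 X4 Y1 Y2 (u' @ Arr b c d e # v') Y4)"
      if "Y1 @ Y2 @ u' = u" "v' @ Y4 = v" for Y1 Y2 u' v' Y4
      by (rule g_term_linear_Y3[OF assms(1) X]) (use assms(3,4) that in \<open>simp_all only:\<close>)
    show "lin_on (smul A) (mor A b c d) (smul A) {0} (\<lambda>e. g_term A n \<alpha> x a X1 X2 X3 X4 Y1 (u' @ Arr b c d e # v') Y3 Y4)"
      if "Y1 @ u' = u" "v' @ Y3 @ Y4 = v" for Y1 u' v' Y3 Y4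
      by (rule g_term_linear_Y2[OF assms(1) X]) (use assms(3,4) that in \<open>simp_all only:\<close>)
    show "lin_on (smul A) (mor A b c d) (smul A) {0} (\<lambda>e. g_term A n \<alpha> x a X1 X2 X3 X4 (u @ Arr b c d e # v') Y2 Y3 Y4)"
      if "v' @ Y2 @ Y3 @ Y4 = v" for v' Y2 Y3 Y4
      by (rule g_term_linear_Y1[OF assms(1) X]) (use assms(3,4) that in \<open>simp_all only:\<close>)
  qed
qed

lemma g_word_linear_X:
  assumes "a \<in> homs A (src a) (tgt a)" "u \<in> paths A (tgt a) b" "v \<in> paths A c (src a)" "Y \<in> paths A x y"
  shows "lin_on (smul A) (mor A b c d) (smul A) {0} (\<lambda>e. g_word A n \<alpha> x Y a (u @ Arr b c d e # v))"
proof -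
  have sumI: "lin_on (smul A) (mor A b c d) (smul A) {0} (\<lambda>e. \<Sum>(Y1, Y2, Y3, Y4)\<in>cut4 Y. F e Y1 Y2 Y3 Y4)"
    if "\<And>Y1 Y2 Y3 Y4. Y1 @ Y2 @ Y3 @ Y4 \<in> paths A x y \<Longrightarrow>
      lin_on (smul A) (mor A b c d) (smul A) {0} (\<lambda>e. F e Y1 Y2 Y3 Y4)" for F
    by (rule lin_on_sum[OF module_A subspace_zero], clarify, rule that) (use assms(4) in \<open>simp add: cut4_def\<close>)
  show ?thesis
    unfolding g_word_def
  proof (rule lin_on_cut4[OF module_A subspace_zero])
    show "lin_on (smul A) (mor A b c d) (smul A) {0} (\<lambda>e. \<Sum>(Y1, Y2, Y3, Y4)\<in>cut4 Y. g_term A n \<alpha> x a X1 X2 X3 (u' @ Arr b c d e # v) Y1 Y2 Y3 Y4)"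
      if "X1 @ X2 @ X3 @ u' = u" for X1 X2 X3 u'
      by (rule sumI, rule g_term_linear_X4[OF assms(1)]) (use assms(2,3) that in \<open>simp_all only:\<close>)
    show "lin_on (smul A) (mor A b c d) (smul A) {0} (\<lambda>e. \<Sum>(Y1, Y2, Y3, Y4)\<in>cut4 Y. g_term A n \<alpha> x a X1 X2 (u' @ Arr b c d e # v') X4 Y1 Y2 Y3 Y4)"
      if "X1 @ X2 @ u' = u" "v' @ X4 = v" for X1 X2 u' v' X4
      by (rule sumI, rule g_term_linear_X3[OF assms(1)]) (use assms(2,3) that in \<open>simp_all only:\<close>)
    show "lin_on (smul A) (mor A b c d) (smul A) {0} (\<lambda>e. \<Sum>(Y1, Y2, Y3, Y4)\<in>cut4 Y. g_term A n \<alpha> x a X1 (u' @ Arr b c d e # v') X3 X4 Y1 Y2 Y3 Y4)"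
      if "X1 @ u' = u" "v' @ X3 @ X4 = v" for X1 u' v' X3 X4
      by (rule sumI, rule g_term_linear_X2[OF assms(1)]) (use assms(2,3) that in \<open>simp_all only:\<close>)
    show "lin_on (smul A) (mor A b c d) (smul A) {0} (\<lambda>e. \<Sum>(Y1, Y2, Y3, Y4)\<in>cut4 Y. g_term A n \<alpha> x a (u @ Arr b c d e # v') X2 X3 X4 Y1 Y2 Y3 Y4)"
      if "v' @ X2 @ X3 @ X4 = v" for v' X2 X3 X4
      by (rule sumI, rule g_term_linear_X1[OF assms(1)]) (use assms(2,3) that in \<open>simp_all only:\<close>)
  qed
qed

lemma g_word_linear_a:
  assumes "X \<in> paths A c b" "Y \<in> paths A x y"
  shows "lin_on (smul A) (mor A b c d) (smul A) {0} (\<lambda>e. g_word A n \<alpha> x Y (Arr b c d e) X)"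
  unfolding g_word_def
proof (intro lin_on_sum[OF module_A subspace_zero], clarify, intro lin_on_sum[OF module_A subspace_zero], clarify)
  fix X1 X2 X3 X4 Y1 Y2 Y3 Y4
  assume "(X1, X2, X3, X4) \<in> cut4 X" "(Y1, Y2, Y3, Y4) \<in> cut4 Y"
  then have X: "X = X1 @ X2 @ X3 @ X4" and Y: "Y = Y1 @ Y2 @ Y3 @ Y4" by (auto simp: cut4_def)
  show "lin_on (smul A) (mor A b c d) (smul A) {0} (\<lambda>e. g_term A n \<alpha> x (Arr b c d e) X1 X2 X3 X4 Y1 Y2 Y3 Y4)"
    by (rule g_term_linear_a[of X1 X2 X3 X4 c b Y1 Y2 Y3 Y4 x y d, folded X Y, OF assms])
qed

text \<open>
  Being multilinear and normalized is what makes the cap product with \<open>g\<^sub>\<alpha>(t)\<close> respect relations.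
\<close>

lemma cochain_g:
  assumes t: "t \<in> free (CH A)" "\<And>w. w \<in> Poly_Mapping.keys t \<Longrightarrow> wdeg w = p"
  shows "cochain A (n - p) (g A n \<alpha> t)"
  unfolding cochain_def
proof (intro conjI allI ballI impI)
  have CH: "w \<in> CH A" if "w \<in> Poly_Mapping.keys t" for w using that t(1) by (auto simp: free_def)
  fix x y Y assume Y: "Y \<in> paths A x y"
  show "g A n \<alpha> t x Y \<in> mor A x y (bdeg Y - (n - p))"
    unfolding g_eq
  proof (rule lext_in_subspace[OF module_A subspace_mor])
    fix w assume w: "w \<in> Poly_Mapping.keys t"
    from CH[OF w] obtain a X where aX: "w = Coef a # map Bar X" "a \<in> homs A (src a) (tgt a)"
      "X \<in> paths A (tgt a) (src a)" by (rule CH_E)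
    with g_word_mor[OF aX(2,3) Y] t(2)[OF w]
    show "on_chain (g_word A n \<alpha> x Y) w \<in> mor A x y (bdeg Y - (n - p))" by simp
  qed
  assume unit: "\<exists>z. unit_arr A z \<in> set Y"
  have "g A n \<alpha> t x Y \<in> {0}"
    unfolding g_eq
  proof (rule lext_in_subspace[OF module_A subspace_zero])
    fix w assume w: "w \<in> Poly_Mapping.keys t"
    from CH[OF w] obtain a X where aX: "w = Coef a # map Bar X" "a \<in> homs A (src a) (tgt a)"
      "X \<in> paths A (tgt a) (src a)" by (rule CH_E)
    with g_word_unit[OF aX(2,3) Y] unit
    show "on_chain (g_word A n \<alpha> x Y) w \<in> {0}" by auto
  qed
  then show "g A n \<alpha> t x Y = 0" by simp
next
  have CH: "w \<in> CH A" if "w \<in> Poly_Mapping.keys t" for w using that t(1) by (auto simp: free_def)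
  fix x b c y d u v assume uv: "u \<in> paths A x b" "v \<in> paths A c y"
  show "lin_on (smul A) (mor A b c d) (smul A) {0} (\<lambda>e. g A n \<alpha> t x (u @ Arr b c d e # v))"
    unfolding g_eq
  proof (rule lin_on_lext[OF module_A subspace_zero])
    fix w assume w: "w \<in> Poly_Mapping.keys t"
    from CH[OF w] obtain a X where aX: "w = Coef a # map Bar X" "a \<in> homs A (src a) (tgt a)"
      "X \<in> paths A (tgt a) (src a)" by (rule CH_E)
    with g_word_linear_Y[OF aX(2,3) uv]
    show "lin_on (smul A) (mor A b c d) (smul A) {0} (\<lambda>e. on_chain (g_word A n \<alpha> x (u @ Arr b c d e # v)) w)"
      by simp
  qed
qed

text \<open>
  A chain that is zero in the Hochschild complex has a representative in \<open>rel A N (CH A)\<close>, so this is the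
  well-definedness of \<open>g\<^sub>\<alpha>\<close>. It disposes of the elements of \<open>W\<close> of nonzero degree.
\<close>

lemma g_kills_rel:
  assumes "t \<in> rel A N (CH A)" "Y \<in> paths A x y"
  shows "g A n \<alpha> t x Y = 0"
proof -
  have "g A n \<alpha> t x Y \<in> {0}"
    unfolding g_eq
  proof (rule lext_rel_CH[OF module_A subspace_zero _ _ _ assms(1)])
    show "lin_on (smul A) (mor A b c d) (smul A) {0}
      (\<lambda>e. on_chain (g_word A n \<alpha> x Y) (Coef (Arr b c d e) # map Bar X))"
      if "X \<in> paths A c b" for b c d X
      using g_word_linear_a[OF that assms(2)] by simp
    show "lin_on (smul A) (mor A p q d) (smul A) {0}
      (\<lambda>e. on_chain (g_word A n \<alpha> x Y) (Coef a # map Bar (u @ Arr p q d e # v)))"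
      if "a \<in> homs A x' y'" "u \<in> paths A y' p" "v \<in> paths A q x'" for a x' y' u p q d v
      using g_word_linear_X[of a u p v q Y x y d] that assms(2) by (simp only: on_chain_Coef) (simp add: homs_iff)
    show "on_chain (g_word A n \<alpha> x Y) (Coef a # map Bar B) \<in> {0}"
      if "a \<in> homs A x' y'" "B \<in> paths A y' x'" "unit_arr A z \<in> set B" for a x' y' B z
      using g_word_unit[of a B Y x y z] that assms(2) by (simp add: homs_iff)
  qed
  then show ?thesis by simp
qed

end

section \<open>The cap product\<close>

definition cap_term :: "('k::comm_ring_1, 'o, 'a) ainf \<Rightarrow> int \<Rightarrow> ('o, 'a) cochain \<Rightarrow> ('o, 'a) arr
    \<Rightarrow> ('o, 'a) arr list \<Rightarrow> ('o, 'a) arr list \<Rightarrow> ('o, 'a) arr list \<Rightarrow> ('o, 'a) arr list \<Rightarrow> ('o, 'a) arr list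
    \<Rightarrow> ('k, 'o, 'a, 'm) ten" where
  "cap_term A q \<phi> a B1 B2 B3 B4 B5 =
     fscl (koszul [1, 1, q, adeg a, bdeg B1, bdeg B2, bdeg B3, bdeg B4, bdeg B5]
                  [6, 1, 2, 7, 8, 0, 3, 4, 5])
     (wd (Coef (mu_arr A (B3 @ out_arr q \<phi> (pend (tgt a) (B1 @ B2 @ B3)) B4 # B5 @ a # B1)) # map Bar B2))"

lemma cap_eq:
  "cap A q \<phi> (Coef a # map Bar B) = (\<Sum>(B1, B2, B3, B4, B5)\<in>cut5 B. cap_term A q \<phi> a B1 B2 B3 B4 B5)"
  unfolding cap_def cap_term_def tgt_last by simp

lemma out_arr_sel [simp]:
  "src (out_arr q \<phi> x B) = x" "tgt (out_arr q \<phi> x B) = pend x B"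
  "adeg (out_arr q \<phi> x B) = bdeg B - q" "elt (out_arr q \<phi> x B) = \<phi> x B"
  by (simp_all add: out_arr_def)

lemma adeg_mu_arr [simp]: "adeg (mu_arr A as) = bdeg as - 2"
  by (simp add: mu_arr_def)

lemma out_arr_path: "B \<in> paths A x y \<Longrightarrow> out_arr q \<phi> x B = Arr x y (bdeg B - q) (\<phi> x B)"
  by (simp add: out_arr_def pend_eq)

context ainf_cat
begin

lemma cochain_mor: "cochain A q \<phi> \<Longrightarrow> Y \<in> paths A x y \<Longrightarrow> \<phi> x Y \<in> mor A x y (bdeg Y - q)"
  and cochain_unit: "cochain A q \<phi> \<Longrightarrow> Y \<in> paths A x y \<Longrightarrow> unit_arr A z \<in> set Y \<Longrightarrow> \<phi> x Y = 0"
  and cochain_linear: "cochain A q \<phi> \<Longrightarrow> u \<in> paths A x b \<Longrightarrow> v \<in> paths A c y \<Longrightarrow>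
    lin_on (smul A) (mor A b c d) (smul A) {0} (\<lambda>e. \<phi> x (u @ Arr b c d e # v))"
  unfolding cochain_def by blast+

lemma cap_path:
  assumes "cochain A q \<phi>" "a \<in> homs A (src a) (tgt a)" "B1 @ B2 @ B3 @ B4 @ B5 \<in> paths A (tgt a) (src a)"
  shows "B3 @ out_arr q \<phi> (pend (tgt a) (B1 @ B2 @ B3)) B4 # B5 @ a # B1
    \<in> paths A (pend (tgt a) (B1 @ B2)) (pend (tgt a) B1)"
proof -
  let ?s = "pend (tgt a) (B1 @ B2 @ B3)"
  have B4: "B4 \<in> paths A ?s (pend ?s B4)" using assms(3) by simp
  show ?thesis
    using assms(2,3) cochain_mor[OF assms(1) B4] pend_eq[OF assms(3)]
    by (simp add: homs_iff)
qed

lemma mu_word_CH: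
  assumes "as \<in> paths A s t" "as \<noteq> []" "B \<in> paths A t s"
  shows "Coef (mu_arr A as) # map Bar B \<in> CH A"
  using assms(3) mu_mor[OF assms(1,2)] by (simp add: CH_iff homs_iff mu_arr_eq[OF assms(1,2)])

lemma zero_Coef_rel:
  assumes "Coef (Arr x y d 0) # w \<in> V"
  shows "wd (Coef (Arr x y d 0) # w) \<in> rel A N V"
  using rel_zero_letter[OF module_A, of "[]" Coef x y d w V N] assms by simp

lemma mu_word_zero:
  assumes "as \<in> paths A s t" "as \<noteq> []" "B \<in> paths A t s" "mu A as = 0"
  shows "wd (Coef (mu_arr A as) # map Bar B) \<in> rel A N (CH A)"
  unfolding mu_arr_eq[OF assms(1,2)] assms(4)
  by (rule zero_Coef_rel) (use assms(3) in \<open>simp add: CH_iff homs_iff\<close>)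

lemma cap_term_free:
  assumes "cochain A q \<phi>" "a \<in> homs A (src a) (tgt a)" "B1 @ B2 @ B3 @ B4 @ B5 \<in> paths A (tgt a) (src a)"
  shows "cap_term A q \<phi> a B1 B2 B3 B4 B5
    \<in> free {w\<in>CH A. wdeg w = adeg a + bdeg (B1 @ B2 @ B3 @ B4 @ B5) - q}"
  unfolding cap_term_def
proof (intro fs.subspace_scale[OF subspace_free] wd_in_free CollectI conjI)
  note path = cap_path[OF assms]
  show "Coef (mu_arr A (B3 @ out_arr q \<phi> (pend (tgt a) (B1 @ B2 @ B3)) B4 # B5 @ a # B1)) # map Bar B2 \<in> CH A"
    by (rule mu_word_CH[OF path]) (use assms(3) in simp_all)
  show "wdeg (Coef (mu_arr A (B3 @ out_arr q \<phi> (pend (tgt a) (B1 @ B2 @ B3)) B4 # B5 @ a # B1)) # map Bar B2)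
     = adeg a + bdeg (B1 @ B2 @ B3 @ B4 @ B5) - q"
    by simp
qed

lemma cap_free:
  assumes "cochain A q \<phi>" "w \<in> CH A"
  shows "cap A q \<phi> w \<in> free {w'\<in>CH A. wdeg w' = wdeg w - q}"
proof -
  from assms(2) obtain a B where w: "w = Coef a # map Bar B" "a \<in> homs A (src a) (tgt a)"
      "B \<in> paths A (tgt a) (src a)" by (rule CH_E)
  have "(\<Sum>(B1, B2, B3, B4, B5)\<in>cut5 B. cap_term A q \<phi> a B1 B2 B3 B4 B5)
      \<in> free {w'\<in>CH A. wdeg w' = adeg a + bdeg B - q}"
  proof (rule fs.subspace_sum[OF subspace_free], clarify)
    fix B1 B2 B3 B4 B5 assume "(B1, B2, B3, B4, B5) \<in> cut5 B"
    then have "B = B1 @ B2 @ B3 @ B4 @ B5" by (simp add: cut5_def)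
    from cap_term_free[OF assms(1) w(2), of B1 B2 B3 B4 B5, folded this, OF w(3)]
    show "cap_term A q \<phi> a B1 B2 B3 B4 B5 \<in> free {w'\<in>CH A. wdeg w' = adeg a + bdeg B - q}" .
  qed
  then show ?thesis by (simp add: w(1) cap_eq)
qed

text \<open>
  A unit among the bar factors stays a bar factor, is an argument of \<open>\<phi>\<close>, or is an argument of \<open>\<mu>\<close> next
  to \<open>a\<close> and the value of \<open>\<phi>\<close>.
\<close>

lemma cap_term_unit:
  assumes "cochain A q \<phi>" "a \<in> homs A (src a) (tgt a)" "B1 @ B2 @ B3 @ B4 @ B5 \<in> paths A (tgt a) (src a)"
    "unit_arr A z \<in> set (B1 @ B2 @ B3 @ B4 @ B5)"
  shows "cap_term A q \<phi> a B1 B2 B3 B4 B5 \<in> rel A N (CH A)"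
  unfolding cap_term_def
proof (rule fs.subspace_scale[OF subspace_rel])
  let ?s = "pend (tgt a) (B1 @ B2 @ B3)"
  let ?M = "B3 @ out_arr q \<phi> ?s B4 # B5 @ a # B1"
  note path = cap_path[OF assms(1-3)]
  have CH: "Coef (mu_arr A ?M) # map Bar B2 \<in> CH A"
    by (rule mu_word_CH[OF path]) (use assms(3) in simp_all)
  show "wd (Coef (mu_arr A ?M) # map Bar B2) \<in> rel A N (CH A)"
  proof (cases "unit_arr A z \<in> set B2")
    case True
    then obtain u v where "B2 = u @ unit_arr A z # v" by (auto dest: split_list)
    with CH rel_generators(4)[of "Coef (mu_arr A ?M) # map Bar u" A z "map Bar v" "CH A" N]
    show ?thesis by simp
  next
    case False
    have "mu A ?M = 0"
    proof (cases "unit_arr A z \<in> set B4")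
      case True
      have B4: "B4 \<in> paths A ?s (pend ?s B4)" using assms(3) by simp
      have out: "out_arr q \<phi> ?s B4 = Arr ?s (pend ?s B4) (bdeg B4 - q) 0"
        using out_arr_path[OF B4] cochain_unit[OF assms(1) B4 True] by simp
      from mu_zero_letter[OF path[unfolded out]] show ?thesis unfolding out .
    next
      case F: False
      with False assms(4) have "unit_arr A z \<in> set B3 \<union> set B5 \<union> set B1" by auto
      moreover from this have "length ?M \<ge> 3" by (auto simp: Suc_le_eq dest: length_pos_if_in_set)
      ultimately show ?thesis using mu_unit[OF path] by auto
    qed
    then show ?thesis by (intro mu_word_zero[OF path]) (use assms(3) in simp_all)
  qed
qed

lemma cap_term_zero:
  assumes "cochain A q \<phi>" "a \<in> homs A (src a) (tgt a)" "B1 @ B2 @ B3 @ B4 @ B5 \<in> paths A (tgt a) (src a)"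
    "\<And>x y Y. Y \<in> paths A x y \<Longrightarrow> \<phi> x Y = 0"
  shows "cap_term A q \<phi> a B1 B2 B3 B4 B5 \<in> rel A N (CH A)"
  unfolding cap_term_def
proof (rule fs.subspace_scale[OF subspace_rel])
  let ?s = "pend (tgt a) (B1 @ B2 @ B3)"
  let ?M = "B3 @ out_arr q \<phi> ?s B4 # B5 @ a # B1"
  note path = cap_path[OF assms(1-3)]
  have B4: "B4 \<in> paths A ?s (pend ?s B4)" using assms(3) by simp
  have out: "out_arr q \<phi> ?s B4 = Arr ?s (pend ?s B4) (bdeg B4 - q) 0"
    using out_arr_path[OF B4] assms(4)[OF B4] by simp
  have "mu A ?M = 0" unfolding out by (rule mu_zero_letter[OF path[unfolded out]])
  then show "wd (Coef (mu_arr A ?M) # map Bar B2) \<in> rel A N (CH A)"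
    by (intro mu_word_zero[OF path]) (use assms(3) in simp_all)
qed

lemma lin_on_mu_word:
  assumes "L @ Arr b c d 0 # R \<in> paths A s t" "B \<in> paths A t s"
  shows "lin_on (smul A) (mor A b c d) fscl (rel A N (CH A))
    (\<lambda>e. wd (Coef (mu_arr A (L @ Arr b c d e # R)) # map Bar B))"
proof (rule lin_on_cong)
  let ?D = "bdeg L + d + 1 + bdeg R - 2"
  have path: "L @ Arr b c d e # R \<in> paths A s t" if "e \<in> mor A b c d" for e
    using assms(1) that by simp
  show "wd (Coef (mu_arr A (L @ Arr b c d e # R)) # map Bar B)
      = wd ([] @ [Coef (Arr s t ?D (mu A (L @ Arr b c d e # R)))] @ map Bar B)"
    if "e \<in> mor A b c d" for e
    using mu_arr_eq[OF path[OF that]] by (simp add: algebra_simps)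
  show "lin_on (smul A) (mor A b c d) fscl (rel A N (CH A))
      (\<lambda>e. wd ([] @ [Coef (Arr s t ?D (mu A (L @ Arr b c d e # R)))] @ map Bar B))"
  proof (rule lin_on_compose[OF lin_on_mu[OF assms(1)]])
    show "mu A (L @ Arr b c d e # R) \<in> mor A s t ?D" if "e \<in> mor A b c d" for e
      using mu_mor[OF path[OF that]] by (simp add: algebra_simps)
    show "lin_on (smul A) (mor A s t ?D) fscl (rel A N (CH A)) (\<lambda>e. wd ([] @ [Coef (Arr s t ?D e)] @ map Bar B))"
      by (rule lin_on_wd[OF rel_generators(1)]) (use assms(2) in \<open>simp add: CH_iff homs_iff\<close>)
  qed
qed

lemma lin_on_cap:
  assumes \<phi>: "cochain A q \<phi>"
  shows "X \<in> paths A c b \<Longrightarrow>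
      lin_on (smul A) (mor A b c d) fscl (rel A N (CH A)) (\<lambda>e. cap A q \<phi> (Coef (Arr b c d e) # map Bar X))"
    and "a \<in> homs A (src a) (tgt a) \<Longrightarrow> u \<in> paths A (tgt a) b \<Longrightarrow> v \<in> paths A c (src a) \<Longrightarrow>
      lin_on (smul A) (mor A b c d) fscl (rel A N (CH A)) (\<lambda>e. cap A q \<phi> (Coef a # map Bar (u @ Arr b c d e # v)))"
proof -
  assume X: "X \<in> paths A c b"
  show "lin_on (smul A) (mor A b c d) fscl (rel A N (CH A)) (\<lambda>e. cap A q \<phi> (Coef (Arr b c d e) # map Bar X))"
    unfolding cap_eq
  proof (rule lin_on_sum[OF module_fscl subspace_rel], clarify)
    fix B1 B2 B3 B4 B5 assume "(B1, B2, B3, B4, B5) \<in> cut5 X"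
    with X have B: "B1 @ B2 @ B3 @ B4 @ B5 \<in> paths A c b" by (simp add: cut5_def)
    from cap_path[OF \<phi>, of "Arr b c d 0" B1 B2 B3 B4 B5] B
    have "lin_on (smul A) (mor A b c d) fscl (rel A N (CH A))
      (\<lambda>e. wd (Coef (mu_arr A ((B3 @ out_arr q \<phi> (pend c (B1 @ B2 @ B3)) B4 # B5) @ Arr b c d e # B1)) # map Bar B2))"
      by (intro lin_on_mu_word[where s = "pend c (B1 @ B2)" and t = "pend c B1"]) (simp_all add: homs_iff)
    then show "lin_on (smul A) (mor A b c d) fscl (rel A N (CH A)) (\<lambda>e. cap_term A q \<phi> (Arr b c d e) B1 B2 B3 B4 B5)"
      by (simp add: cap_term_def lin_on_scale[OF module_fscl subspace_rel])
  qed
next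
  assume a: "a \<in> homs A (src a) (tgt a)" and u: "u \<in> paths A (tgt a) b" and v: "v \<in> paths A c (src a)"
  note pu = pend_eq[OF u] and pv = pend_eq[OF v]
  show "lin_on (smul A) (mor A b c d) fscl (rel A N (CH A)) (\<lambda>e. cap A q \<phi> (Coef a # map Bar (u @ Arr b c d e # v)))"
    unfolding cap_eq
  proof (rule lin_on_cut5[OF module_fscl subspace_rel])
    fix B1 B2 B3 B4 f assume [symmetric]: "B1 @ B2 @ B3 @ B4 @ f = u"
    with u v pu pv have B: "B1 @ B2 @ B3 @ B4 @ (f @ Arr b c d 0 # v) \<in> paths A (tgt a) (src a)" by simp
    from cap_path[OF \<phi> a B] B
    have "lin_on (smul A) (mor A b c d) fscl (rel A N (CH A))
      (\<lambda>e. wd (Coef (mu_arr A ((B3 @ out_arr q \<phi> (pend (tgt a) (B1 @ B2 @ B3)) B4 # f) @ Arr b c d e # v @ a # B1)) # map Bar B2))"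
      by (intro lin_on_mu_word[where s = "pend (tgt a) (B1 @ B2)" and t = "pend (tgt a) B1"]) simp_all
    then show "lin_on (smul A) (mor A b c d) fscl (rel A N (CH A)) (\<lambda>e. cap_term A q \<phi> a B1 B2 B3 B4 (f @ Arr b c d e # v))"
      by (simp add: cap_term_def lin_on_scale[OF module_fscl subspace_rel])
  next
    fix B1 B2 B3 u' v' B5 assume [symmetric]: "B1 @ B2 @ B3 @ u' = u" "v' @ B5 = v"
    with u v pu pv have B: "B1 @ B2 @ B3 @ (u' @ Arr b c d 0 # v') @ B5 \<in> paths A (tgt a) (src a)"
      and u': "u' \<in> paths A (pend (tgt a) (B1 @ B2 @ B3)) b" and v': "v' \<in> paths A c (pend c v')" by simp_all
    let ?s = "pend (tgt a) (B1 @ B2 @ B3)" and ?d = "bdeg u' + d + 1 + bdeg v' - q"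
    have path: "u' @ Arr b c d e # v' \<in> paths A ?s (pend c v')" if "e \<in> mor A b c d" for e
      using u' v' that pend_eq[OF u'] by simp
    have "lin_on (smul A) (mor A b c d) fscl (rel A N (CH A))
      (\<lambda>e. wd (Coef (mu_arr A (B3 @ out_arr q \<phi> ?s (u' @ Arr b c d e # v') # B5 @ a # B1)) # map Bar B2))"
    proof (rule lin_on_cong)
      show "wd (Coef (mu_arr A (B3 @ out_arr q \<phi> ?s (u' @ Arr b c d e # v') # B5 @ a # B1)) # map Bar B2) =
        wd (Coef (mu_arr A (B3 @ Arr ?s (pend c v') ?d (\<phi> ?s (u' @ Arr b c d e # v')) # B5 @ a # B1)) # map Bar B2)"
        if "e \<in> mor A b c d" for e
        using out_arr_path[OF path[OF that]] by (simp add: algebra_simps)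
      show "lin_on (smul A) (mor A b c d) fscl (rel A N (CH A)) (\<lambda>e.
        wd (Coef (mu_arr A (B3 @ Arr ?s (pend c v') ?d (\<phi> ?s (u' @ Arr b c d e # v')) # B5 @ a # B1)) # map Bar B2))"
      proof (rule lin_on_compose[OF cochain_linear[OF \<phi> u' v']])
        show "\<phi> ?s (u' @ Arr b c d e # v') \<in> mor A ?s (pend c v') ?d" if "e \<in> mor A b c d" for e
          using cochain_mor[OF \<phi> path[OF that]] by (simp add: algebra_simps)
        show "lin_on (smul A) (mor A ?s (pend c v') ?d) fscl (rel A N (CH A)) (\<lambda>e.
          wd (Coef (mu_arr A (B3 @ Arr ?s (pend c v') ?d e # B5 @ a # B1)) # map Bar B2))"
          using cap_path[OF \<phi> a B] B
          by (intro lin_on_mu_word[where s = "pend (tgt a) (B1 @ B2)" and t = "pend (tgt a) B1"]) (simp_all add: out_arr_def)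
      qed
    qed
    then show "lin_on (smul A) (mor A b c d) fscl (rel A N (CH A)) (\<lambda>e. cap_term A q \<phi> a B1 B2 B3 (u' @ Arr b c d e # v') B5)"
      by (simp add: cap_term_def lin_on_scale[OF module_fscl subspace_rel])
  next
    fix B1 B2 u' v' B4 B5 assume [symmetric]: "B1 @ B2 @ u' = u" "v' @ B4 @ B5 = v"
    with u v pu pv have B: "B1 @ B2 @ (u' @ Arr b c d 0 # v') @ B4 @ B5 \<in> paths A (tgt a) (src a)" by simp
    from cap_path[OF \<phi> a B] B
    have "lin_on (smul A) (mor A b c d) fscl (rel A N (CH A))
      (\<lambda>e. wd (Coef (mu_arr A (u' @ Arr b c d e # v' @ out_arr q \<phi> (pend c v') B4 # B5 @ a # B1)) # map Bar B2))"
      by (intro lin_on_mu_word[where s = "pend (tgt a) (B1 @ B2)" and t = "pend (tgt a) B1"]) simp_all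
    then show "lin_on (smul A) (mor A b c d) fscl (rel A N (CH A)) (\<lambda>e. cap_term A q \<phi> a B1 B2 (u' @ Arr b c d e # v') B4 B5)"
      by (simp add: cap_term_def lin_on_scale[OF module_fscl subspace_rel])
  next
    fix B1 u' v' B3 B4 B5 assume [symmetric]: "B1 @ u' = u" "v' @ B3 @ B4 @ B5 = v"
    with u v pu pv have B: "B1 @ (u' @ Arr b c d e # v') @ B3 @ B4 @ B5 \<in> paths A (tgt a) (src a)"
      if "e \<in> mor A b c d" for e using that by simp
    let ?m = "mu_arr A (B3 @ out_arr q \<phi> (pend c (v' @ B3)) B4 # B5 @ a # B1)"
    have m: "Coef ?m # map Bar (u' @ Arr b c d e # v') \<in> CH A" if "e \<in> mor A b c d" for e
      using mu_word_CH[OF cap_path[OF \<phi> a B[OF that]], of "u' @ Arr b c d e # v'"] B[OF that] by simp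
    have "lin_on (smul A) (mor A b c d) fscl (rel A N (CH A))
      (\<lambda>e. wd ((Coef ?m # map Bar u') @ [Bar (Arr b c d e)] @ map Bar v'))"
      by (rule lin_on_wd[OF rel_generators(2)]) (use m in simp)
    then show "lin_on (smul A) (mor A b c d) fscl (rel A N (CH A)) (\<lambda>e. cap_term A q \<phi> a B1 (u' @ Arr b c d e # v') B3 B4 B5)"
      by (simp add: cap_term_def lin_on_scale[OF module_fscl subspace_rel])
  next
    fix v' B2 B3 B4 B5 assume [symmetric]: "v' @ B2 @ B3 @ B4 @ B5 = v"
    with u v pu pv have B: "(u @ Arr b c d 0 # v') @ B2 @ B3 @ B4 @ B5 \<in> paths A (tgt a) (src a)" by simp
    from cap_path[OF \<phi> a B] B
    have "lin_on (smul A) (mor A b c d) fscl (rel A N (CH A))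
      (\<lambda>e. wd (Coef (mu_arr A ((B3 @ out_arr q \<phi> (pend c (v' @ B2 @ B3)) B4 # B5 @ a # u) @ Arr b c d e # v')) # map Bar B2))"
      by (intro lin_on_mu_word[where s = "pend c (v' @ B2)" and t = "pend c v'"]) simp_all
    then show "lin_on (smul A) (mor A b c d) fscl (rel A N (CH A)) (\<lambda>e. cap_term A q \<phi> a (u @ Arr b c d e # v') B2 B3 B4 B5)"
      by (simp add: cap_term_def lin_on_scale[OF module_fscl subspace_rel])
  qed
qed

text \<open>
  The cap product is defined on words; it descends to the Hochschild complex because \<open>\<phi>\<close> and \<open>\<mu>\<close> are
  multilinear and each term with a unit among the bar factors is zero.
\<close>

lemma mlin_cap:
  assumes "cochain A q \<phi>"
  shows "mlin A N (CH A) (cap A q \<phi>) (CH A)"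
  unfolding mlin_def
proof
  fix t assume t: "t \<in> rel A N (CH A)"
  show "ext (cap A q \<phi>) t \<in> rel A N (CH A)"
  proof (rule lext_rel_CH[OF module_fscl subspace_rel _ _ _ t])
    show "lin_on (smul A) (mor A b c d) fscl (rel A N (CH A)) (\<lambda>e. cap A q \<phi> (Coef (Arr b c d e) # map Bar X))"
      if "X \<in> paths A c b" for b c d X using that by (rule lin_on_cap(1)[OF assms])
    show "lin_on (smul A) (mor A b c d) fscl (rel A N (CH A)) (\<lambda>e. cap A q \<phi> (Coef a # map Bar (u @ Arr b c d e # v)))"
      if "a \<in> homs A x y" "u \<in> paths A y b" "v \<in> paths A c x" for a x y u b c d v
      using lin_on_cap(2)[OF assms, of a u b v c d N] that by (simp only: homs_iff)
    show "cap A q \<phi> (Coef a # map Bar B) \<in> rel A N (CH A)"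
      if "a \<in> homs A x y" "B \<in> paths A y x" "unit_arr A z \<in> set B" for a x y B z
      unfolding cap_eq
    proof (rule fs.subspace_sum[OF subspace_rel], clarify)
      fix B1 B2 B3 B4 B5 assume "(B1, B2, B3, B4, B5) \<in> cut5 B"
      then have "B = B1 @ B2 @ B3 @ B4 @ B5" by (simp add: cut5_def)
      with that show "cap_term A q \<phi> a B1 B2 B3 B4 B5 \<in> rel A N (CH A)"
        using cap_term_unit[OF assms, of a B1 B2 B3 B4 B5 z N] by (simp add: homs_iff)
    qed
  qed
qed

lemma cap_zero:
  assumes "cochain A q \<phi>" "\<And>x y Y. Y \<in> paths A x y \<Longrightarrow> \<phi> x Y = 0" "w \<in> CH A"
  shows "cap A q \<phi> w \<in> rel A N (CH A)"
proof -
  from assms(3) obtain a B where w: "w = Coef a # map Bar B" "a \<in> homs A (src a) (tgt a)"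
      "B \<in> paths A (tgt a) (src a)" by (rule CH_E)
  show ?thesis unfolding w(1) cap_eq
  proof (rule fs.subspace_sum[OF subspace_rel], clarify)
    fix B1 B2 B3 B4 B5 assume "(B1, B2, B3, B4, B5) \<in> cut5 B"
    then have "B1 @ B2 @ B3 @ B4 @ B5 \<in> paths A (tgt a) (src a)" using w(3) by (simp add: cut5_def)
    from cap_term_zero[OF assms(1) w(2) this assms(2)]
    show "cap_term A q \<phi> a B1 B2 B3 B4 B5 \<in> rel A N (CH A)" .
  qed
qed

end

section \<open>Operators on one tensor factor\<close>

text \<open>
  A letter of a word for \<open>C\<^sub>*(A,A) \<otimes> C\<^sub>*(A,A)\<close> belongs to exactly one of the two chains; this is how a
  relation between such words becomes a relation in one tensor factor.
\<close>

lemma CHCH_split: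
  assumes "u @ [l] @ v \<in> CHCH A"
  shows "(\<exists>v1 w2. v = v1 @ w2 \<and> u @ [l] @ v1 \<in> CH A \<and> w2 \<in> CH A) \<or>
    (\<exists>w1 u2. u = w1 @ u2 \<and> w1 \<in> CH A \<and> u2 @ [l] @ v \<in> CH A)"
proof -
  from assms obtain w1 w2 where w: "u @ [l] @ v = w1 @ w2" "w1 \<in> CH A" "w2 \<in> CH A"
    by (metis CHCH_E)
  from w(1) consider us where "u @ us = w1" "[l] @ v = us @ w2" | us where "u = w1 @ us" "us @ [l] @ v = w2"
    by (auto simp: append_eq_append_conv2)
  then show ?thesis
  proof cases
    case 1
    show ?thesis
    proof (cases us)
      case Nil
      then show ?thesis using 1 w(2,3) by (intro disjI2 exI[of _ w1] exI[of _ "[]"]) simp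
    next
      case (Cons l' us')
      then show ?thesis using 1 w(2,3) by (intro disjI1 exI[of _ us'] exI[of _ w2]) auto
    qed
  next
    case 2
    then show ?thesis using w(2,3) by auto
  qed
qed

lemma CHCH_I: "w1 \<in> CH A \<Longrightarrow> w2 \<in> CH A \<Longrightarrow> w1 @ w2 \<in> CHCH A"
  by (auto simp: CHCH_def)

lemma ldeg_letter: "mk = Coef \<or> mk = Bar \<Longrightarrow> ldeg (mk (Arr x y d e)) = ldeg (mk (Arr x y d e'))"
  by auto

definition fst_word where "fst_word f w = fcat (f (fst_chain w)) (wd (snd_chain w))"
definition snd_word where
  "snd_word q f w = fscl (sg (q * wdeg (fst_chain w))) (fcat (wd (fst_chain w)) (f (snd_chain w)))"

lemma on_fst_eq: "on_fst f t = ext (fst_word f) t" and on_snd_eq: "on_snd q f t = ext (snd_word q f) t"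
  unfolding on_fst_def on_snd_def fst_word_def snd_word_def by simp_all

lemma fst_word_append: "w1 \<in> CH A \<Longrightarrow> w2 \<in> CH A \<Longrightarrow> fst_word f (w1 @ w2) = ext (\<lambda>z. wd (z @ w2)) (f w1)"
  and snd_word_append: "w1 \<in> CH A \<Longrightarrow> w2 \<in> CH A \<Longrightarrow>
    snd_word q f (w1 @ w2) = fscl (sg (q * wdeg w1)) (ext (\<lambda>z. wd (w1 @ z)) (f w2))"
  by (simp_all add: fst_word_def snd_word_def fcat_wd_left fcat_wd_right)

lemma rel_append_right: "t \<in> rel A N (CH A) \<Longrightarrow> w2 \<in> CH A \<Longrightarrow> ext (\<lambda>z. wd (z @ w2)) t \<in> rel A N (CHCH A)"
  using rel_shift[of "CH A" "[]" w2 "CHCH A" t A N] by (simp add: CHCH_I)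

lemma rel_append_left: "t \<in> rel A N (CH A) \<Longrightarrow> w1 \<in> CH A \<Longrightarrow> ext (\<lambda>z. wd (w1 @ z)) t \<in> rel A N (CHCH A)"
  using rel_shift[of "CH A" w1 "[]" "CHCH A" t A N] by (simp add: CHCH_I)

context
  fixes A :: "('k::comm_ring_1, 'o, 'a::ab_group_add) ainf" and N :: "('k, 'o, 'a, 'm::ab_group_add) abim"
    and f :: "('o, 'a, 'm) word \<Rightarrow> ('k, 'o, 'a, 'm) ten"
  assumes f_free: "\<And>w. w \<in> CH A \<Longrightarrow> f w \<in> free (CH A)" and f_mlin: "mlin A N (CH A) f (CH A)"
begin

lemma lin_on_factor_words:
  fixes u v :: "('o, 'a, 'm) word"
  assumes mk: "mk = Coef \<or> mk = Bar"
  shows "lin_on (smul A) {e. u @ [mk (Arr x y d e)] @ v \<in> CHCH A} fscl (rel A N (CHCH A))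
      (\<lambda>e. fst_word f (u @ [mk (Arr x y d e)] @ v))"
    and "lin_on (smul A) {e. u @ [mk (Arr x y d e)] @ v \<in> CHCH A} fscl (rel A N (CHCH A))
      (\<lambda>e. snd_word q f (u @ [mk (Arr x y d e)] @ v))"
proof -
  let ?S = "{e. u @ [mk (Arr x y d e)] @ v \<in> CHCH A}"
  have gen: "lin_rels mk (smul A) V \<subseteq> rel A N V" for V
    using mk rel_generators by blast
  have S: "?S \<subseteq> mor A x y d" using mk CHCH_letters by force
  have both: "lin_on (smul A) ?S fscl (rel A N (CHCH A)) (\<lambda>e. fst_word f (u @ [mk (Arr x y d e)] @ v)) \<and>
    lin_on (smul A) ?S fscl (rel A N (CHCH A)) (\<lambda>e. snd_word q f (u @ [mk (Arr x y d e)] @ v))"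
    if e: "e \<in> ?S" for e
    using CHCH_split[OF CollectD[OF e]]
  proof (elim disjE exE conjE)
    fix v1 w2 assume v: "v = v1 @ w2" and 1: "u @ [mk (Arr x y d e)] @ v1 \<in> CH A" and w2: "w2 \<in> CH A"
    have CH: "u @ [mk (Arr x y d e')] @ v1 \<in> CH A" if "e' \<in> ?S" for e'
      by (rule CH_replace[OF 1 _ mk]) (use S that in blast)
    have L: "lin_on (smul A) ?S fscl (rel A N (CHCH A))
        (\<lambda>e. ext (\<lambda>z. wd (z @ w2)) (f (u @ [mk (Arr x y d e)] @ v1)))"
      by (rule lin_on_lext_image[OF module_fscl mlin_lin_on[OF f_mlin gen CH]])
         (assumption, rule rel_append_right[OF _ w2])
    have E: "fst_word f (u @ [mk (Arr x y d e')] @ v) = ext (\<lambda>z. wd (z @ w2)) (f (u @ [mk (Arr x y d e')] @ v1))"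
      if "e' \<in> ?S" for e'
      using fst_word_append[OF CH[OF that] w2, of f] by (simp add: v)
    have fst: "lin_on (smul A) ?S fscl (rel A N (CHCH A)) (\<lambda>e. fst_word f (u @ [mk (Arr x y d e)] @ v))"
      by (rule lin_on_cong[OF E L])
    let ?k = "sg (q * wdeg (u @ [mk (Arr x y d e)] @ v1)) :: 'k"
    have L: "lin_on (smul A) ?S fscl (rel A N (CHCH A))
        (\<lambda>e'. fscl ?k (ext (\<lambda>z. wd (u @ [mk (Arr x y d e')] @ (v1 @ z))) (f w2)))"
    proof (intro lin_on_scale[OF module_fscl subspace_rel] lin_on_lext[OF module_fscl subspace_rel] lin_on_wd[OF gen])
      fix z e' assume "z \<in> Poly_Mapping.keys (f w2)" "e' \<in> ?S"
      with f_free[OF w2] CHCH_I[OF CH, of e' z] show "u @ [mk (Arr x y d e')] @ (v1 @ z) \<in> CHCH A"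
        by (auto simp: free_def)
    qed
    have E: "snd_word q f (u @ [mk (Arr x y d e')] @ v) =
        fscl ?k (ext (\<lambda>z. wd (u @ [mk (Arr x y d e')] @ (v1 @ z))) (f w2))" if "e' \<in> ?S" for e'
      using snd_word_append[OF CH[OF that] w2, of q f] ldeg_letter[OF mk, of x y d e' e] by (simp add: v)
    have "lin_on (smul A) ?S fscl (rel A N (CHCH A)) (\<lambda>e. snd_word q f (u @ [mk (Arr x y d e)] @ v))"
      by (rule lin_on_cong[OF E L])
    with fst show ?thesis by blast
  next
    fix w1 u2 assume u: "u = w1 @ u2" and w1: "w1 \<in> CH A" and 2: "u2 @ [mk (Arr x y d e)] @ v \<in> CH A"
    have CH: "u2 @ [mk (Arr x y d e')] @ v \<in> CH A" if "e' \<in> ?S" for e'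
      by (rule CH_replace[OF 2 _ mk]) (use S that in blast)
    have L: "lin_on (smul A) ?S fscl (rel A N (CHCH A))
        (\<lambda>e'. ext (\<lambda>z. wd ((z @ u2) @ [mk (Arr x y d e')] @ v)) (f w1))"
    proof (intro lin_on_lext[OF module_fscl subspace_rel] lin_on_wd[OF gen])
      fix z e' assume "z \<in> Poly_Mapping.keys (f w1)" "e' \<in> ?S"
      with f_free[OF w1] CHCH_I[OF _ CH, of z e'] show "(z @ u2) @ [mk (Arr x y d e')] @ v \<in> CHCH A"
        by (auto simp: free_def)
    qed
    have E: "fst_word f (u @ [mk (Arr x y d e')] @ v) =
        ext (\<lambda>z. wd ((z @ u2) @ [mk (Arr x y d e')] @ v)) (f w1)" if "e' \<in> ?S" for e'
      using fst_word_append[OF w1 CH[OF that], of f] by (simp add: u)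
    have fst: "lin_on (smul A) ?S fscl (rel A N (CHCH A)) (\<lambda>e. fst_word f (u @ [mk (Arr x y d e)] @ v))"
      by (rule lin_on_cong[OF E L])
    have L: "lin_on (smul A) ?S fscl (rel A N (CHCH A))
        (\<lambda>e. fscl (sg (q * wdeg w1)) (ext (\<lambda>z. wd (w1 @ z)) (f (u2 @ [mk (Arr x y d e)] @ v))))"
      by (intro lin_on_scale[OF module_fscl subspace_rel]
          lin_on_lext_image[OF module_fscl mlin_lin_on[OF f_mlin gen CH]] rel_append_left[OF _ w1])
    have E: "snd_word q f (u @ [mk (Arr x y d e')] @ v) =
        fscl (sg (q * wdeg w1)) (ext (\<lambda>z. wd (w1 @ z)) (f (u2 @ [mk (Arr x y d e')] @ v)))"
      if "e' \<in> ?S" for e'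
      using snd_word_append[OF w1 CH[OF that], of q f] by (simp add: u)
    have "lin_on (smul A) ?S fscl (rel A N (CHCH A)) (\<lambda>e. snd_word q f (u @ [mk (Arr x y d e)] @ v))"
      by (rule lin_on_cong[OF E L])
    with fst show ?thesis by blast
  qed
  show "lin_on (smul A) ?S fscl (rel A N (CHCH A)) (\<lambda>e. fst_word f (u @ [mk (Arr x y d e)] @ v))"
    "lin_on (smul A) ?S fscl (rel A N (CHCH A)) (\<lambda>e. snd_word q f (u @ [mk (Arr x y d e)] @ v))"
    by (rule lin_on_nonempty, rule conjunct1[OF both], assumption)
      (rule lin_on_nonempty, rule conjunct2[OF both], assumption)
qed

lemma factor_words_unit:
  fixes u v :: "('o, 'a, 'm) word"
  assumes "u @ [Bar (unit_arr A x)] @ v \<in> CHCH A"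
  shows "fst_word f (u @ [Bar (unit_arr A x)] @ v) \<in> rel A N (CHCH A) \<and>
    snd_word q f (u @ [Bar (unit_arr A x)] @ v) \<in> rel A N (CHCH A)"
  using CHCH_split[OF assms]
proof (elim disjE exE conjE)
  fix v1 w2 assume v: "v = v1 @ w2" and 1: "u @ [Bar (unit_arr A x)] @ v1 \<in> CH A" and w2: "w2 \<in> CH A"
  have "ext f (wd (u @ [Bar (unit_arr A x)] @ v1)) \<in> rel A N (CH A)"
    using f_mlin rel_generators(4)[OF 1] unfolding mlin_def by blast
  then have "fst_word f ((u @ [Bar (unit_arr A x)] @ v1) @ w2) \<in> rel A N (CHCH A)"
    unfolding fst_word_append[OF 1 w2] using rel_append_right[OF _ w2] by simp
  moreover have "snd_word q f ((u @ [Bar (unit_arr A x)] @ v1) @ w2) \<in> rel A N (CHCH A)"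
    unfolding snd_word_append[OF 1 w2]
  proof (intro fs.subspace_scale[OF subspace_rel] lext_free_in_subspace[OF module_fscl subspace_rel f_free[OF w2]])
    fix z :: "('o, 'a, 'm) word" assume "z \<in> CH A"
    then show "wd ((u @ [Bar (unit_arr A x)] @ v1) @ z) \<in> rel A N (CHCH A)"
      using rel_generators(4)[of u A x "v1 @ z" "CHCH A" N] CHCH_I[OF 1] by simp
  qed
  ultimately show ?thesis by (simp add: v)
next
  fix w1 u2 assume u: "u = w1 @ u2" and w1: "w1 \<in> CH A" and 2: "u2 @ [Bar (unit_arr A x)] @ v \<in> CH A"
  have "ext f (wd (u2 @ [Bar (unit_arr A x)] @ v)) \<in> rel A N (CH A)"
    using f_mlin rel_generators(4)[OF 2] unfolding mlin_def by blast
  then have "snd_word q f (w1 @ (u2 @ [Bar (unit_arr A x)] @ v)) \<in> rel A N (CHCH A)"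
    unfolding snd_word_append[OF w1 2]
    by (intro fs.subspace_scale[OF subspace_rel] rel_append_left[OF _ w1]) simp
  moreover have "fst_word f (w1 @ (u2 @ [Bar (unit_arr A x)] @ v)) \<in> rel A N (CHCH A)"
    unfolding fst_word_append[OF w1 2]
  proof (rule lext_free_in_subspace[OF module_fscl subspace_rel f_free[OF w1]])
    fix z :: "('o, 'a, 'm) word" assume "z \<in> CH A"
    then show "wd (z @ (u2 @ [Bar (unit_arr A x)] @ v)) \<in> rel A N (CHCH A)"
      using rel_generators(4)[of "z @ u2" A x v "CHCH A" N] CHCH_I[OF _ 2] by simp
  qed
  ultimately show ?thesis by (simp add: u)
qed

text \<open>
  The letter that varies in a relation belongs to the chain to which \<open>f\<close> is applied, where \<open>f\<close> respects
  relations, or to the other one, which is copied. The sign in \<open>id \<otimes> f\<close> depends on degrees only.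
\<close>

lemma ext_factor_words_rel:
  assumes "t \<in> rel A N (CHCH A)"
  shows "ext (fst_word f) t \<in> rel A N (CHCH A)" "ext (snd_word q f) t \<in> rel A N (CHCH A)"
proof -
  have Dual: "lin_on (msmul N) {e. u @ [Dual (Arr x y d e)] @ v \<in> CHCH A} fscl R h"
    for u v :: "('o, 'a, 'm) word" and x y d h and R :: "('k, 'o, 'a, 'm) ten set"
    by (rule lin_on_nonempty) (auto dest: CHCH_letters)
  show "ext (fst_word f) t \<in> rel A N (CHCH A)"
    by (rule lext_rel_in_subspace[OF module_fscl subspace_rel _ _ Dual _ assms])
       (rule lin_on_factor_words(1), simp, rule lin_on_factor_words(1), simp,
        rule conjunct1[OF factor_words_unit])
  show "ext (snd_word q f) t \<in> rel A N (CHCH A)"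
    by (rule lext_rel_in_subspace[OF module_fscl subspace_rel _ _ Dual _ assms])
       (rule lin_on_factor_words(2), simp, rule lin_on_factor_words(2), simp,
        rule conjunct2[OF factor_words_unit])
qed

end

lemma lookup_hpart: "Poly_Mapping.lookup (hpart p t) w = (if wdeg w = p then Poly_Mapping.lookup t w else 0)"
proof -
  have "Poly_Mapping.lookup (hpart p t) w =
      (\<Sum>v\<in>{v\<in>Poly_Mapping.keys t. wdeg v = p}. Poly_Mapping.lookup (Poly_Mapping.single v (Poly_Mapping.lookup t v)) w)"
    unfolding hpart_def by (induction "{v\<in>Poly_Mapping.keys t. wdeg v = p}" rule: infinite_finite_induct)
      (simp_all add: lookup_sum)
  also have "\<dots> = (\<Sum>v\<in>{v\<in>Poly_Mapping.keys t. wdeg v = p}. if v = w then Poly_Mapping.lookup t w else 0)"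
    by (intro sum.cong) (auto simp: lookup_single when_def)
  also have "\<dots> = (if wdeg w = p then Poly_Mapping.lookup t w else 0)"
    by (auto simp: in_keys_iff)
  finally show ?thesis .
qed

text \<open>
  The element \<open>H\<close> of a trivialization is homogeneous only modulo relations. A linear map that respects
  relations may nevertheless be computed on words of the expected degree.
\<close>

lemma ext_rel_concentrated:
  assumes "H \<in> free V" "concentrated_in d A N V H"
    and "\<And>t. t \<in> rel A N V \<Longrightarrow> ext h t \<in> R" "\<And>w. w \<in> V \<Longrightarrow> wdeg w = d \<Longrightarrow> h w \<in> R" "fs.subspace R"
  shows "ext h H \<in> R"
proof -
  let ?D = "wdeg ` Poly_Mapping.keys H"
  have "H = (\<Sum>p\<in>?D. hpart p H)"
  proof (rule poly_mapping_eqI)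
    fix w
    have "(\<Sum>p\<in>?D. if wdeg w = p then Poly_Mapping.lookup H w else 0) = Poly_Mapping.lookup H w"
      by (auto simp: in_keys_iff)
    then show "Poly_Mapping.lookup H w = Poly_Mapping.lookup (\<Sum>p\<in>?D. hpart p H) w"
      by (simp add: lookup_sum lookup_hpart)
  qed
  then have "ext h H = (\<Sum>p\<in>?D. ext h (hpart p H))"
    using lext_sum[OF module_fscl, of h "\<lambda>p. hpart p H" ?D] by simp
  also have "\<dots> \<in> R"
  proof (rule fs.subspace_sum[OF assms(5)])
    fix p
    show "ext h (hpart p H) \<in> R"
    proof (cases "p = d")
      case True
      have "hpart p H \<in> free {w\<in>V. wdeg w = d}"
        using assms(1) True by (auto simp: free_def in_keys_iff lookup_hpart split: if_splits)
      then show ?thesis using assms(4) by (intro lext_free_in_subspace[OF module_fscl assms(5)]) auto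
    next
      case False
      then show ?thesis using assms(2,3) by (auto simp: concentrated_in_def)
    qed
  qed
  finally show ?thesis .
qed

section \<open>The diagrams on the annulus\<close>

lemma rel_subset_tensor_sub: "rel A N (CHCH A) \<subseteq> tensor_sub A N S T"
  unfolding tensor_sub_def by (auto intro: fs.span_base)

lemma Wco_E:
  assumes "w \<in> Wco A N"
  obtains a r m l where "w = Coef a # map Bar r @ [Dual m] @ map Bar l" "a \<in> homs A (src a) (tgt a)"
    "r \<in> paths A (tgt a) (src m)" "m \<in> mhoms N (src m) (tgt m)" "l \<in> paths A (tgt m) (src a)"
  using assms by (auto simp: Wco_def homs_iff mhoms_def)

context ainf_cat
begin

lemma circles_word:
  assumes "x \<in> homs A (src x) (tgt x)" "l \<in> paths A (tgt x) (src x)"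
    "y \<in> homs A (src y) (tgt y)" "r \<in> paths A (tgt y) (src y)"
  shows "Coef x # map Bar l @ Coef y # map Bar r \<in> CHCH A"
  using CHCH_I[of "Coef x # map Bar l" A "Coef y # map Bar r"] assms by (simp add: CH_iff)

text \<open>
  In the diagrams \<open>G\<close> the two outputs of \<open>\<eta>\<close> are the coefficients of the two output chains. The result
  is zero if the value of \<open>\<eta>\<close> is zero in \<open>A \<otimes> A\<close>, and also if the output chains have negative
  total degree \<open>D + bdeg l + bdeg r\<close>.
\<close>

lemma to_circles_null:
  assumes "connective A" "t \<in> free {w\<in>W2 A p v w' q. wdeg w = D}" "l \<in> paths A v p" "r \<in> paths A q w'"
    and "t \<in> rel A N (W2 A p v w' q) \<or> D + bdeg l + bdeg r < 0"
  shows "to_circles l r t \<in> rel A N (CHCH A)"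
  unfolding to_circles_def using assms(5)
proof
  let ?f = "two (\<lambda>x y. fscl (koszul [1, 1, 1, 1, adeg x, adeg y, bdeg l, bdeg r] [0, 3, 4, 6, 1, 2, 5, 7])
       (wd (Coef x # map Bar l @ Coef y # map Bar r)))"
  {
    assume t: "t \<in> rel A N (W2 A p v w' q)"
    show "ext ?f t \<in> rel A N (CHCH A)"
    proof (rule lext_rel_W2[OF module_fscl subspace_rel _ _ t])
      fix y d assume y: "y \<in> homs A w' q"
      have "lin_on (smul A) (mor A p v d) fscl (rel A N (CHCH A))
        (\<lambda>e. wd ([] @ [Coef (Arr p v d e)] @ (map Bar l @ Coef y # map Bar r)))"
        by (rule lin_on_wd[OF rel_generators(1)])
           (simp, rule circles_word, use assms(3,4) y in \<open>simp_all add: homs_iff\<close>)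
      then show "lin_on (smul A) (mor A p v d) fscl (rel A N (CHCH A)) (\<lambda>e. ?f [Coef (Arr p v d e), Coef y])"
        by (simp add: lin_on_scale[OF module_fscl subspace_rel])
    next
      fix x d assume x: "x \<in> homs A p v"
      have "lin_on (smul A) (mor A w' q d) fscl (rel A N (CHCH A))
        (\<lambda>e. wd ((Coef x # map Bar l) @ [Coef (Arr w' q d e)] @ map Bar r))"
        by (rule lin_on_wd[OF rel_generators(1)])
           (simp, rule circles_word, use assms(3,4) x in \<open>simp_all add: homs_iff\<close>)
      then show "lin_on (smul A) (mor A w' q d) fscl (rel A N (CHCH A)) (\<lambda>e. ?f [Coef x, Coef (Arr w' q d e)])"
        by (simp add: lin_on_scale[OF module_fscl subspace_rel])
    qed
  }
  assume neg: "D + bdeg l + bdeg r < 0"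
  show "ext ?f t \<in> rel A N (CHCH A)"
  proof (rule lext_free_in_subspace[OF module_fscl subspace_rel assms(2)])
    fix w assume "w \<in> {w\<in>W2 A p v w' q. wdeg w = D}"
    then obtain x y where w: "w = [Coef x, Coef y]" "x \<in> homs A p v" "y \<in> homs A w' q" "adeg x + adeg y = D"
      by (auto simp: W2_def)
    have "wd (Coef x # map Bar l @ Coef y # map Bar r) \<in> rel A N (CHCH A)"
      using circles_word[of x l y r] w assms(3,4) neg
      by (intro negative_word_in_rel[OF module_A assms(1)]) (simp_all add: homs_iff)
    then show "?f w \<in> rel A N (CHCH A)"
      by (simp add: w(1) fs.subspace_scale[OF subspace_rel])
  qed
qed

end

text \<open>
  Two situations in which \<open>\<lambda>\<^sub>H(\<phi>)\<close> is zero in \<open>C\<^sub>*(A,A) \<otimes> C\<^sub>*(A,A)\<close>: either \<open>\<phi>\<close> vanishes, or its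
  cohomological degree \<open>q\<close> is at least 2, which makes the degree \<open>1 - q\<close> of \<open>\<lambda>\<^sub>H(\<phi>)\<close> negative.
\<close>

locale ainf_cat_annulus = ainf_cat A for A :: "('k::comm_ring_1, 'o, 'a::ab_group_add) ainf" +
  fixes N :: "('k, 'o, 'a, 'm::ab_group_add) abim" and \<eta> :: "('k, 'o, 'a, 'm) etamap"
    and co :: "('k, 'o, 'a, 'm) ten" and \<phi> :: "('o, 'a) cochain" and q :: int
  assumes connective: "connective A"
    and eta: "eta_cocycle A N \<eta>"
    and co: "co \<in> free {w\<in>Wco A N. wdeg w = 0}"
    and cochain: "cochain A q \<phi>"
    and null: "q \<ge> 2 \<or> (\<forall>x y. \<forall>Y\<in>paths A x y. \<phi> x Y = 0)"
begin

lemma eta_free: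
  assumes "w1 \<in> WA A u0 u1" "w2 \<in> WN A N v0 v1"
  shows "\<eta> w1 w2 \<in> free {w\<in>W2 A u0 v1 v0 u1. wdeg w = wdeg w1 + wdeg w2}"
  using eta assms unfolding eta_cocycle_def by blast

lemma eta_zero_letter:
  assumes "u @ [mk (Arr x y d 0)] @ v \<in> WA A u0 u1" "w2 \<in> WN A N v0 v1" "mk = Coef \<or> mk = Bar"
  shows "\<eta> (u @ [mk (Arr x y d 0)] @ v) w2 \<in> rel A N (W2 A u0 v1 v0 u1)"
proof -
  have "mlin A N (WA A u0 u1) (\<lambda>w. \<eta> w w2) (W2 A u0 v1 v0 u1)"
    using eta assms(1,2) unfolding eta_cocycle_def by blast
  from bspec[OF this[unfolded mlin_def] rel_zero_letter[OF module_A assms(1,3)]] show ?thesis by simp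
qed

lemma WA_I: "i \<in> paths A u0 (src a) \<Longrightarrow> a \<in> homs A (src a) (tgt a) \<Longrightarrow> j \<in> paths A (tgt a) u1 \<Longrightarrow>
    map Bar i @ [Coef a] @ map Bar j \<in> WA A u0 u1"
  and WN_I: "i \<in> paths A u0 (src m) \<Longrightarrow> m \<in> mhoms N (src m) (tgt m) \<Longrightarrow> j \<in> paths A (tgt m) u1 \<Longrightarrow>
    map Bar i @ [Dual m] @ map Bar j \<in> WN A N u0 u1"
  unfolding WA_def WN_def by blast+

text \<open>
  Common form of the first three diagrams of \<open>G\<close>: the value of \<open>\<phi>\<close> is one of the inputs \<open>i\<close>, \<open>a\<close>, \<open>j\<close> on
  the side of the \<open>A\<close>-edge. If \<open>\<phi>\<close> vanishes, this input is zero; otherwise the total degree is negative.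
\<close>

lemma eta_to_circles_null:
  assumes i: "i \<in> paths A u0 (src a)" "a \<in> homs A (src a) (tgt a)" "j \<in> paths A (tgt a) u1"
    and k: "k \<in> paths A v0 (src m)" "m \<in> mhoms N (src m) (tgt m)" "l \<in> paths A (tgt m) v1"
    and "L \<in> paths A v1 u0" "R \<in> paths A u1 v0"
    and z: "(\<exists>z\<in>set i \<union> set j \<union> {a}. elt z = 0) \<or>
      bdeg i + adeg a + bdeg j + bdeg k + adeg m + bdeg l + bdeg L + bdeg R < 0"
  shows "to_circles L R (\<eta> (map Bar i @ [Coef a] @ map Bar j) (map Bar k @ [Dual m] @ map Bar l)) \<in> rel A N (CHCH A)"
proof (rule to_circles_null[OF connective eta_free[OF WA_I[OF i] WN_I[OF k]] assms(7,8)])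
  show "\<eta> (map Bar i @ [Coef a] @ map Bar j) (map Bar k @ [Dual m] @ map Bar l) \<in> rel A N (W2 A u0 v1 v0 u1) \<or>
    wdeg (map Bar i @ [Coef a] @ map Bar j) + wdeg (map Bar k @ [Dual m] @ map Bar l) + bdeg L + bdeg R < 0"
    using z
  proof (elim disjE bexE)
    fix z assume z: "elt z = 0" "z \<in> set i \<union> set j \<union> {a}"
    obtain b c d where zd: "z = Arr b c d 0" using z(1) by (cases z) auto
    have rel: ?thesis if w: "map Bar i @ [Coef a] @ map Bar j = u @ [mk z] @ v" and mk: "mk = Coef \<or> mk = Bar"
      for mk and u v :: "('o, 'a, 'm) word"
    proof -
      have "u @ [mk (Arr b c d 0)] @ v \<in> WA A u0 u1"
        unfolding w[unfolded zd, symmetric] by (rule WA_I[OF i])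
      from eta_zero_letter[OF this WN_I[OF k] mk] show ?thesis unfolding w[unfolded zd] ..
    qed
    from z(2) consider i1 i2 where "i = i1 @ z # i2" | j1 j2 where "j = j1 @ z # j2" | "z = a"
      by (auto dest!: split_list)
    then show ?thesis
    proof cases
      case 1 then show ?thesis using rel[of "map Bar i1" Bar "map Bar i2 @ [Coef a] @ map Bar j"] by simp
    next
      case 2 then show ?thesis using rel[of "map Bar i @ [Coef a] @ map Bar j1" Bar "map Bar j2"] by simp
    next
      case 3 then show ?thesis using rel[of "map Bar i" Coef "map Bar j"] by simp
    qed
  qed simp
qed

lemma phi_mor: "Y \<in> paths A x y \<Longrightarrow> \<phi> x Y \<in> mor A x y (bdeg Y - q)"
  by (rule cochain_mor[OF cochain])

text \<open>
  The bar factors, the coefficient and the dual factor of \<open>co\<close> have total degree 0. Hence the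
  diagrams of \<open>G(\<phi>)\<close> have degree \<open>1 - q\<close>: the vertex \<open>\<phi>\<close> contributes \<open>- q\<close>, and its edge the suspension of
  its value or of one of its arguments.
\<close>

lemma ext_on_co_null:
  assumes "\<And>a r m l. \<lbrakk>a \<in> homs A (src a) (tgt a); r \<in> paths A (tgt a) (src m);
      m \<in> mhoms N (src m) (tgt m); l \<in> paths A (tgt m) (src a);
      adeg a + bdeg r + adeg m + bdeg l = 0\<rbrakk> \<Longrightarrow> f a r m l \<in> rel A N (CHCH A)"
  shows "ext (on_co f) co \<in> rel A N (CHCH A)"
proof (rule lext_free_in_subspace[OF module_fscl subspace_rel co])
  fix w assume w: "w \<in> {w\<in>Wco A N. wdeg w = 0}"
  then have "w \<in> Wco A N" by simp
  then obtain a r m l where w': "w = Coef a # map Bar r @ [Dual m] @ map Bar l" "a \<in> homs A (src a) (tgt a)"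
    "r \<in> paths A (tgt a) (src m)" "m \<in> mhoms N (src m) (tgt m)" "l \<in> paths A (tgt m) (src a)"
    by (rule Wco_E)
  have "adeg a + bdeg r + adeg m + bdeg l = 0" using w by (simp add: w'(1))
  from assms[OF w'(2-5) this] show "on_co f w \<in> rel A N (CHCH A)" unfolding w'(1) on_co_word .
qed

lemma G1_null: "G1 q \<phi> co \<eta> \<in> rel A N (CHCH A)"
  unfolding G1_def
proof (rule ext_on_co_null, intro fs.subspace_sum[OF subspace_rel], clarify,
    intro fs.subspace_sum[OF subspace_rel], clarify, intro fs.subspace_scale[OF subspace_rel])
  fix a m r l r1 r2 r3 l1 l2 l3 l4 l5
  assume w: "a \<in> homs A (src a) (tgt a)" "r \<in> paths A (tgt a) (src m)"
      "m \<in> mhoms N (src m) (tgt m)" "l \<in> paths A (tgt m) (src a)"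
    and deg: "adeg a + bdeg r + adeg m + bdeg l = 0"
    and "(r1, r2, r3) \<in> cut3 r" "(l1, l2, l3, l4, l5) \<in> cut5 l"
  then have r: "r = r1 @ r2 @ r3" and l: "l = l1 @ l2 @ l3 @ l4 @ l5" by (simp_all add: cut3_def cut5_def)
  let ?s = "pend (tgt m) (l1 @ l2 @ l3)" and ?Y = "l4"
  note pe = pend_eq[OF w(2), unfolded r, simplified] pend_eq[OF w(4), unfolded l, simplified]
  have Y: "?Y \<in> paths A ?s (pend ?s (?Y))" using w r l pe by (simp add: homs_iff)
  have phi: "q \<ge> 2 \<or> \<phi> ?s (?Y) = 0" using null Y by blast
  show "to_circles l2 r2
        (\<eta> (map Bar (l3 @ [out_arr q \<phi> (pend (tgt m) (l1 @ l2 @ l3)) l4] @ l5) @ [Coef a] @ map Bar r1)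
            (map Bar r3 @ [Dual m] @ map Bar l1)) \<in> rel A N (CHCH A)"
    by (rule eta_to_circles_null[where ?u0.0 = "pend (tgt m) (l1 @ l2)" and ?u1.0 = "pend (tgt a) r1"
          and ?v0.0 = "pend (tgt a) (r1 @ r2)" and ?v1.0 = "pend (tgt m) l1"])
       (use w deg r l pe phi_mor[OF Y] phi Y in \<open>auto simp: homs_iff\<close>)
qed

lemma G2_null: "G2 q \<phi> co \<eta> \<in> rel A N (CHCH A)"
  unfolding G2_def
proof (rule ext_on_co_null, intro fs.subspace_sum[OF subspace_rel], clarify,
    intro fs.subspace_sum[OF subspace_rel], clarify, intro fs.subspace_scale[OF subspace_rel])
  fix a m r l r1 r2 r3 r4 l1 l2 l3 l4
  assume w: "a \<in> homs A (src a) (tgt a)" "r \<in> paths A (tgt a) (src m)"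
      "m \<in> mhoms N (src m) (tgt m)" "l \<in> paths A (tgt m) (src a)"
    and deg: "adeg a + bdeg r + adeg m + bdeg l = 0"
    and "(r1, r2, r3, r4) \<in> cut4 r" "(l1, l2, l3, l4) \<in> cut4 l"
  then have r: "r = r1 @ r2 @ r3 @ r4" and l: "l = l1 @ l2 @ l3 @ l4" by (simp_all add: cut4_def)
  let ?s = "pend (tgt m) (l1 @ l2 @ l3)" and ?Y = "l4 @ [a] @ r1"
  note pe = pend_eq[OF w(2), unfolded r, simplified] pend_eq[OF w(4), unfolded l, simplified]
  have Y: "?Y \<in> paths A ?s (pend ?s (?Y))" using w r l pe by (simp add: homs_iff)
  have phi: "q \<ge> 2 \<or> \<phi> ?s (?Y) = 0" using null Y by blast
  show "to_circles l2 r3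
        (\<eta> (map Bar l3 @ [Coef (out_arr q \<phi> (pend (tgt m) (l1 @ l2 @ l3)) (l4 @ [a] @ r1))] @ map Bar r2)
            (map Bar r4 @ [Dual m] @ map Bar l1)) \<in> rel A N (CHCH A)"
    by (rule eta_to_circles_null[where ?u0.0 = "pend (tgt m) (l1 @ l2)" and ?u1.0 = "pend (tgt a) (r1 @ r2)"
          and ?v0.0 = "pend (tgt a) (r1 @ r2 @ r3)" and ?v1.0 = "pend (tgt m) l1"])
       (use w deg r l pe phi_mor[OF Y] phi Y in \<open>auto simp: homs_iff\<close>)
qed

lemma G3_null: "G3 q \<phi> co \<eta> \<in> rel A N (CHCH A)"
  unfolding G3_def
proof (rule ext_on_co_null, intro fs.subspace_sum[OF subspace_rel], clarify,
    intro fs.subspace_sum[OF subspace_rel], clarify, intro fs.subspace_scale[OF subspace_rel])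
  fix a m r l r1 r2 r3 r4 r5 l1 l2 l3
  assume w: "a \<in> homs A (src a) (tgt a)" "r \<in> paths A (tgt a) (src m)"
      "m \<in> mhoms N (src m) (tgt m)" "l \<in> paths A (tgt m) (src a)"
    and deg: "adeg a + bdeg r + adeg m + bdeg l = 0"
    and "(r1, r2, r3, r4, r5) \<in> cut5 r" "(l1, l2, l3) \<in> cut3 l"
  then have r: "r = r1 @ r2 @ r3 @ r4 @ r5" and l: "l = l1 @ l2 @ l3" by (simp_all add: cut5_def cut3_def)
  let ?s = "pend (tgt a) r1" and ?Y = "r2"
  note pe = pend_eq[OF w(2), unfolded r, simplified] pend_eq[OF w(4), unfolded l, simplified]
  have Y: "?Y \<in> paths A ?s (pend ?s (?Y))" using w r l pe by (simp add: homs_iff)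
  have phi: "q \<ge> 2 \<or> \<phi> ?s (?Y) = 0" using null Y by blast
  show "to_circles l2 r4
        (\<eta> (map Bar l3 @ [Coef a] @ map Bar (r1 @ [out_arr q \<phi> (pend (tgt a) r1) r2] @ r3))
            (map Bar r5 @ [Dual m] @ map Bar l1)) \<in> rel A N (CHCH A)"
    by (rule eta_to_circles_null[where ?u0.0 = "pend (tgt m) (l1 @ l2)" and ?u1.0 = "pend (tgt a) (r1 @ r2 @ r3)"
          and ?v0.0 = "pend (tgt a) (r1 @ r2 @ r3 @ r4)" and ?v1.0 = "pend (tgt m) l1"])
       (use w deg r l pe phi_mor[OF Y] phi Y in \<open>auto simp: homs_iff\<close>)
qed

text \<open>
  Here \<open>\<phi>\<close> is applied to the right output \<open>y\<close> of \<open>\<eta>\<close>, and its value becomes the coefficient of the second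
  chain; so the vanishing has to be seen on the words of the output chains.
\<close>

lemma G4_null: "G4 q \<phi> co \<eta> \<in> rel A N (CHCH A)"
  unfolding G4_def
proof (rule ext_on_co_null, intro fs.subspace_sum[OF subspace_rel], clarify,
    intro fs.subspace_sum[OF subspace_rel], clarify, intro fs.subspace_scale[OF subspace_rel])
  fix a m r l r1 r2 r3 r4 r5 l1 l2 l3
  assume w: "a \<in> homs A (src a) (tgt a)" "r \<in> paths A (tgt a) (src m)"
      "m \<in> mhoms N (src m) (tgt m)" "l \<in> paths A (tgt m) (src a)"
    and deg: "adeg a + bdeg r + adeg m + bdeg l = 0"
    and "(r1, r2, r3, r4, r5) \<in> cut5 r" "(l1, l2, l3) \<in> cut3 l"
  then have r: "r = r1 @ r2 @ r3 @ r4 @ r5" and l: "l = l1 @ l2 @ l3" by (simp_all add: cut5_def cut3_def)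
  let ?u0 = "pend (tgt m) (l1 @ l2)" and ?v0 = "pend (tgt a) (r1 @ r2 @ r3 @ r4)"
  let ?u1 = "pend (tgt a) r1" and ?v1 = "pend (tgt m) l1" and ?s = "pend (tgt a) (r1 @ r2 @ r3)"
  note pe = pend_eq[OF w(2), unfolded r, simplified] pend_eq[OF w(4), unfolded l, simplified]
  have W: "map Bar l3 @ [Coef a] @ map Bar r1 \<in> WA A ?u0 ?u1" "map Bar r5 @ [Dual m] @ map Bar l1 \<in> WN A N ?v0 ?v1"
    by (rule WA_I WN_I; use w r l pe in simp)+
  show "ext (two (\<lambda>x y.
        fscl (koszul [1, 1, 1, 1, 1, q, adeg x, adeg y, bdeg l2, bdeg r2, bdeg r3, bdeg r4]
                     [0, 3, 6, 8, 1, 2, 5, 11, 4, 7, 9, 10])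
        (wd (Coef x # map Bar l2
             @ Coef (out_arr q \<phi> (pend (tgt a) (r1 @ r2 @ r3)) (r4 @ [y] @ r2)) # map Bar r3))))
        (\<eta> (map Bar l3 @ [Coef a] @ map Bar r1) (map Bar r5 @ [Dual m] @ map Bar l1))
      \<in> rel A N (CHCH A)"
  proof (rule lext_free_in_subspace[OF module_fscl subspace_rel eta_free[OF W]])
    fix v assume "v \<in> {w\<in>W2 A ?u0 ?v1 ?v0 ?u1. wdeg w = wdeg (map Bar l3 @ [Coef a] @ map Bar r1) +
      wdeg (map Bar r5 @ [Dual m] @ map Bar l1)}"
    then obtain x y where v: "v = [Coef x, Coef y]" "x \<in> homs A ?u0 ?v1" "y \<in> homs A ?v0 ?u1"
      "adeg x + adeg y = bdeg l3 + adeg a + bdeg r1 + bdeg r5 + adeg m + bdeg l1"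
      by (auto simp: W2_def)
    let ?Y = "r4 @ [y] @ r2"
    have Y: "?Y \<in> paths A ?s (pend ?s ?Y)" using w r v(3) by (simp add: homs_iff)
    let ?w = "Coef x # map Bar l2 @ Coef (out_arr q \<phi> ?s ?Y) # map Bar r3"
    have CHCH: "?w \<in> CHCH A"
      by (rule circles_word) (use phi_mor[OF Y] v(2,3) w r l in \<open>simp_all add: homs_iff\<close>)
    have "wd ?w \<in> rel A N (CHCH A)"
      using null
    proof
      assume "q \<ge> 2"
      then show ?thesis
        by (intro negative_word_in_rel[OF module_A connective CHCH]) (use deg v(4) r l in simp)
    next
      assume "\<forall>x y. \<forall>Y\<in>paths A x y. \<phi> x Y = 0"
      then have "\<phi> ?s ?Y = 0" using Y by blast
      then have out: "out_arr q \<phi> ?s ?Y = Arr ?s (pend ?s ?Y) (bdeg ?Y - q) 0"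
        by (simp add: out_arr_def)
      from rel_zero_letter[OF module_A, of "Coef x # map Bar l2" Coef _ _ _ "map Bar r3" "CHCH A" N] CHCH
      show ?thesis unfolding out by simp
    qed
    then show "(two (\<lambda>x y.
      fscl (koszul [1, 1, 1, 1, 1, q, adeg x, adeg y, bdeg l2, bdeg r2, bdeg r3, bdeg r4]
                   [0, 3, 6, 8, 1, 2, 5, 11, 4, 7, 9, 10])
      (wd (Coef x # map Bar l2
           @ Coef (out_arr q \<phi> (pend (tgt a) (r1 @ r2 @ r3)) (r4 @ [y] @ r2)) # map Bar r3)))) v \<in> rel A N (CHCH A)"
      unfolding v(1) two_Coef by (rule fs.subspace_scale[OF subspace_rel])
  qed
qed

lemma G_null: "G co \<eta> q \<phi> \<in> rel A N (CHCH A)"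
  unfolding G_def by (intro fs.subspace_add[OF subspace_rel] G1_null G2_null G3_null G4_null)

lemma cap_on_factors_null:
  assumes "w \<in> CHCH A" "wdeg w = 1"
  shows "fst_word (cap A q \<phi>) w \<in> rel A N (CHCH A)" "snd_word q' (cap A q \<phi>) w \<in> rel A N (CHCH A)"
proof -
  from assms(1) obtain w1 w2 where w: "w = w1 @ w2" "w1 \<in> CH A" "w2 \<in> CH A" by (rule CHCH_E)
  have "ext (\<lambda>z. wd (z @ w2)) (cap A q \<phi> w1) \<in> rel A N (CHCH A) \<and>
    ext (\<lambda>z. wd (w1 @ z)) (cap A q \<phi> w2) \<in> rel A N (CHCH A)"
    using null
  proof
    assume q: "q \<ge> 2"
    have "wd (z @ w2) \<in> rel A N (CHCH A)" if "z \<in> {w'\<in>CH A. wdeg w' = wdeg w1 - q}" for z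
      using that w assms(2) q by (intro negative_word_in_rel[OF module_A connective] CHCH_I) auto
    moreover have "wd (w1 @ z) \<in> rel A N (CHCH A)" if "z \<in> {w'\<in>CH A. wdeg w' = wdeg w2 - q}" for z
      using that w assms(2) q by (intro negative_word_in_rel[OF module_A connective] CHCH_I) auto
    ultimately show ?thesis
      by (intro conjI lext_free_in_subspace[OF module_fscl subspace_rel cap_free[OF cochain w(2)]]
          lext_free_in_subspace[OF module_fscl subspace_rel cap_free[OF cochain w(3)]])
  next
    assume "\<forall>x y. \<forall>Y\<in>paths A x y. \<phi> x Y = 0"
    then have zero: "\<phi> x Y = 0" if "Y \<in> paths A x y" for x y Y using that by blast
    from cap_zero[OF cochain zero w(2)] cap_zero[OF cochain zero w(3)] w(2,3) show ?thesis
      by (auto intro: rel_append_left rel_append_right)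
  qed
  then show "fst_word (cap A q \<phi>) w \<in> rel A N (CHCH A)" "snd_word q' (cap A q \<phi>) w \<in> rel A N (CHCH A)"
    by (auto simp: w(1) fst_word_append[OF w(2,3)] snd_word_append[OF w(2,3)] intro: fs.subspace_scale[OF subspace_rel])
qed

text \<open>
  \<open>H\<close> has degree 1, and the cap product with \<open>\<phi>\<close> lowers degrees by \<open>q\<close>; so both cap product terms have the
  same degree \<open>1 - q\<close> as \<open>G(\<phi>)\<close>.
\<close>

lemma lam_null:
  assumes H: "H \<in> free (CHCH A)" "concentrated_in 1 A N (CHCH A) H"
  shows "lam A co \<eta> H q \<phi> \<in> rel A N (CHCH A)"
proof -
  have free: "cap A q \<phi> w \<in> free (CH A)" if "w \<in> CH A" for w
    using cap_free[OF cochain that] by (auto simp: free_def)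
  note rel = ext_factor_words_rel[OF free mlin_cap[OF cochain]]
  have "on_fst (cap A q \<phi>) H \<in> rel A N (CHCH A)"
    unfolding on_fst_eq by (rule ext_rel_concentrated[OF H rel(1) cap_on_factors_null(1) subspace_rel])
  moreover have "on_snd q (cap A q \<phi>) H \<in> rel A N (CHCH A)"
    unfolding on_snd_eq by (rule ext_rel_concentrated[OF H rel(2) cap_on_factors_null(2) subspace_rel])
  ultimately show ?thesis
    unfolding lam_def by (intro fs.subspace_diff[OF subspace_rel] fs.subspace_scale[OF subspace_rel] G_null)
qed

end

theorem proposition3p11:
  fixes A :: "('k::comm_ring_1, 'o, 'a::ab_group_add) ainf"
    and N :: "('k, 'o, 'a, 'm::ab_group_add) abim"
    and \<theta> \<eta> :: "('k, 'o, 'a, 'm) etamap"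
    and co E\<^sub>0 H :: "('k, 'o, 'a, 'm) ten"
    and W :: "('k, 'o, 'a, 'm) ten set"
    and \<alpha> :: "('k, 'o, 'a, 'm) vertex2"
    and n :: int
  assumes "ainf_category A"
    and "smooth A"
    and "models_dual A N \<theta>"
    and "is_co A N \<theta> co"
    and "is_eta A N co \<eta>"
    and "\<alpha> \<in> C2 A N n"
    and "C2_closed A N n \<alpha>"
    and "connective A"
    and "n \<ge> 2"
    and "subcomplex A N W"
    and "homology_injective A N W"
    and "trivialization A N (E A co \<eta>) W E\<^sub>0 H"
    and "\<forall>w\<in>W. concentrated_in 0 A N (CH A) w"
  shows "balanced A N co \<eta> n W H \<alpha>"
proof -
  interpret ainf_cat_vertex2 A N \<alpha> n by unfold_locales (rule assms)+
  show ?thesis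
    unfolding balanced_def
  proof (intro allI ballI impI)
    fix p t assume t: "t \<in> W" and deg: "\<forall>w\<in>Poly_Mapping.keys t. wdeg w = p"
    have t_free: "t \<in> free (CH A)" using assms(10) t unfolding subcomplex_def by blast
    have cochain: "cochain A (n - p) (g A n \<alpha> t)" using cochain_g[OF t_free] deg by blast
    have null: "n - p \<ge> 2 \<or> (\<forall>x y. \<forall>Y\<in>paths A x y. g A n \<alpha> t x Y = 0)"
    proof (cases "p = 0")
      case True
      then show ?thesis using assms(9) by simp
    next
      case False
      \<comment> \<open>\<open>t\<close> is homogeneous of degree \<open>p\<close>, where \<open>W\<close> is zero\<close>
      have "hpart p t = t"
        by (rule poly_mapping_eqI) (use deg in \<open>auto simp: lookup_hpart in_keys_iff\<close>)
      moreover have "hpart p t \<in> rel A N (CH A)"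
        using bspec[OF assms(13) t] False unfolding concentrated_in_def by blast
      ultimately have "t \<in> rel A N (CH A)" by simp
      then show ?thesis by (intro disjI2 allI ballI) (rule g_kills_rel)
    qed
    have H: "H \<in> free (CHCH A)" "concentrated_in 1 A N (CHCH A) H"
      using assms(12) unfolding trivialization_def by blast+
    interpret ainf_cat_annulus A N \<eta> co "g A n \<alpha> t" "n - p"
      by unfold_locales (use assms(4,5,8) cochain null in \<open>simp_all add: is_co_def is_eta_def\<close>)
    show "lam A co \<eta> H (n - p) (g A n \<alpha> t)
        \<in> tensor_sub A N (free (CH A)) W \<inter> tensor_sub A N W (free (CH A))"
      using lam_null[OF H] rel_subset_tensor_sub by blast
  qed
qed

end
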